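(* Let $T$ be an operator defined on an appropriate class of functions on $\mathbb{R}^n$ (e.g. $C_c^\infty$ or $\bigcup_p L^p(w^p)$). Suppose that for some $1\le p_0\le q_0<\infty$ there are constants $\gamma>0$ and $c>0$ such that $T$ satisfies the weak-type $(p_0,q_0)$ inequality $$\|Tf\|_{L^{q_0,\infty}(w^{q_0})}\le c\,[w]_{A_{p_0,q_0}}^{\gamma}\,\|wf\|_{L^{p_0}(\mathbb{R}^n)}$$ for every $w\in A_{p_0,q_0}$ and all $f$ in the class. Then for all $1<p\le q<\infty$ that satisfy $$\frac1p-\frac1q=\frac1{p_0}-\frac1{q_0},$$ $T$ also satisfies the weak-type $(p,q)$ inequality $$\|Tf\|_{L^{q,\infty}(w^{q})}\le C\,[w]_{A_{p,q}}^{\gamma\max\left\{1,\frac{q_0}{p_0'}\frac{p'}{q}\right\}}\,\|wf\|_{L^{p}(\mathbb{R}^n)}$$ for all $w\in A_{p,q}$ and all $f$ in the class, with a constant $C$ independent of $w$ and $f$.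
   Context: A weight is a non-negative locally integrable function on $\mathbb{R}^n$. For an exponent $p$, $p'$ is defined by $1/p+1/p'=1$ (for $p_0=1$, $p_0'=\infty$ and $q_0/p_0'=0$). Cubes have sides parallel to the axes. For $1<p\le q<\infty$, a weight $w$ belongs to $A_{p,q}$ if $$[w]_{A_{p,q}}=\sup_Q\left(\frac1{|Q|}\int_Q w^q\,dx\right)\left(\frac1{|Q|}\int_Q w^{-p'}\,dx\right)^{q/p'}<\infty,$$ the supremum being over all cubes $Q$. For $1\le q<\infty$, $w\in A_{1,q}$ if there is a constant $c$ with $\frac1{|Q|}\int_Q w^q\,dx\le c\,\inf_Q w^q$ (essential infimum) for all cubes $Q$, and $[w]_{A_{1,q}}$ is the smallest such $c$. For a weight $u$, write $u(E)=\int_E u\,dx$ and $\|g\|_{L^{q,\infty}(u)}=\sup_{\lambda>0}\lambda\,u(\{x:|g(x)|>\lambda\})^{1/q}$. *)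

theory Defs
  imports "HOL-Analysis.Analysis"
begin

(* Used only with exponents a > 0, so that infinity ^ a = infinity and 0 ^ a = 0. *)
definition ennpowr :: "ennreal \<Rightarrow> real \<Rightarrow> ennreal" where
  "ennpowr x a = (if x = \<infinity> then \<infinity> else ennreal (enn2real x powr a))"

(* p' for 1 < p; the endpoint p' = infinity for p = 1 is treated separately wherever it occurs. *)
definition conj_exponent :: "real \<Rightarrow> real" where
  "conj_exponent p = p / (p - 1)"

definition weight :: "(real ^ 'n \<Rightarrow> real) \<Rightarrow> bool" where
  "weight w \<longleftrightarrow> w \<in> borel_measurable lebesgue \<and> (\<forall>x. 0 \<le> w x) \<and>
     (\<forall>K. compact K \<longrightarrow> set_integrable lebesgue K w)"

definition cubes :: "(real ^ 'n) set set" where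
  "cubes = {cbox a (\<chi> i. a $ i + l) |a l. 0 < l}"

definition average :: "(real ^ 'n) set \<Rightarrow> (real ^ 'n \<Rightarrow> ennreal) \<Rightarrow> ennreal" where
  "average Q g = (\<integral>\<^sup>+x\<in>Q. g x \<partial>lebesgue) / emeasure lebesgue Q"

definition ess_inf :: "(real ^ 'n) set \<Rightarrow> (real ^ 'n \<Rightarrow> ennreal) \<Rightarrow> ennreal" where
  "ess_inf Q g = Sup {m. AE x in lebesgue. x \<in> Q \<longrightarrow> m \<le> g x}"

(* The negative power w^(-p') is formed in ennreal, so that it is infinite where w = 0
   (whereas 0 powr a = 0 in the reals). For p = 1 the constant is infinite if no finite c exists. *)
definition Apq_const :: "real \<Rightarrow> real \<Rightarrow> (real ^ 'n \<Rightarrow> real) \<Rightarrow> ennreal" where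
  "Apq_const p q w =
     (if p = 1 then
        Inf {c. c < \<infinity> \<and> (\<forall>Q\<in>cubes. average Q (\<lambda>x. ennreal (w x powr q))
                               \<le> c * ess_inf Q (\<lambda>x. ennreal (w x powr q)))}
      else
        (SUP Q\<in>cubes. average Q (\<lambda>x. ennreal (w x powr q)) *
           ennpowr (average Q (\<lambda>x. inverse (ennreal (w x powr conj_exponent p))))
                   (q / conj_exponent p)))"

definition Apq :: "real \<Rightarrow> real \<Rightarrow> (real ^ 'n \<Rightarrow> real) set" where
  "Apq p q = {w. weight w \<and> Apq_const p q w < \<infinity>}"

definition Lp_norm :: "real \<Rightarrow> (real ^ 'n \<Rightarrow> complex) \<Rightarrow> ennreal" where
  "Lp_norm p f = ennpowr (\<integral>\<^sup>+x. ennreal (cmod (f x) powr p) \<partial>lebesgue) (1 / p)"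

definition weighted_meas :: "(real ^ 'n \<Rightarrow> real) \<Rightarrow> (real ^ 'n) set \<Rightarrow> ennreal" where
  "weighted_meas u E = (\<integral>\<^sup>+x\<in>E. ennreal (u x) \<partial>lebesgue)"

definition weak_Lq_norm ::
    "real \<Rightarrow> (real ^ 'n \<Rightarrow> real) \<Rightarrow> (real ^ 'n \<Rightarrow> complex) \<Rightarrow> ennreal" where
  "weak_Lq_norm q u g =
     (SUP t\<in>{0<..}. ennreal t * ennpowr (weighted_meas u {x. t < cmod (g x)}) (1 / q))"

end

theory Submission
  imports Defs
begin

text \<open>Rubio de Francia extrapolation with sharp dependence on the weight constant, for weak-type
bounds off the diagonal.

For a fixed height t the hypothesis concerns a single measurable set E = {|Tf| > t}: it bounds
t (\<integral>_E W^(q_0))^(1/q_0) for every admissible weight W. The operator enters in no other way, so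
extrapolating the weak-type inequality means, for a given w \<in> A_(p,q), to choose one good W.

Put r = 1 + q/p' and r_0 = 1 + q_0/p_0'. Unless w vanishes almost everywhere, in which case there
is nothing to prove, w \<in> A_(p,q) says exactly that u = w^q is a Muckenhoupt weight of class A_r
with the same constant A, and the relation between the exponents becomes r/q = r_0/q_0. Let \<sigma> = u^(-1/(r-1)) be the dual weight.

If q < q_0, set W^(q_0) = u H^(-(r_0-r)), where H is an A_1 weight that dominates
h = (w|f|)^(p/r) w^(-q/r) and has comparable norm in L^r(u). Domination gives
||Wf||_(p_0) \<le> ||wf||_p^(p/p_0), the norm of H and Hoelder's inequality turn
\<integral>_E W^(q_0) back into \<integral>_E w^q, and W^(q_0) lies in A_(r_0) with constant at most
A [H]_(A_1)^(r_0-r) (lemma muckenhoupt_times_A1_negative_power).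

If q > q_0, set W^(q_0) = u^\<theta> H^(1-\<theta>) with \<theta> = (r_0-1)/(r-1), where H is an
A_1 weight that dominates h = 1_E u and has comparable norm in L^(r')(\<sigma>). Now domination
handles \<integral>_E W^(q_0) \<ge> \<integral>_E u, Hoelder's inequality handles ||Wf||_(p_0), and W^(q_0)
lies in A_(r_0) with constant at most A^\<theta> [H]_(A_1)^(1-\<theta>)
(lemma muckenhoupt_interpolate_A1).

The weights H come from the Rubio de Francia algorithm H = \<Sum>_k 2^(-k) N^(-k) M^k h, which makes
[H]_(A_1) at most a multiple of N when N is the norm of the maximal operator M on the weighted
space. So the exponent in the conclusion is decided by Buckley's sharp bounds for N, a multiple of
A^(1/(r-1)) on L^r(u) and, dually, a multiple of A on L^(r')(\<sigma>): the constant of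
W is of order A^((r_0-1)/(r-1)) in the first case and A in the second, which is the maximum in
the theorem because (r_0-1)/(r-1) = (q_0/p_0')(p'/q).

Buckley's bound is proved by Lerner's argument (lemma grid_max_pointwise): the A_r condition
dominates M f pointwise by a composition of maximal operators taken with respect to the measures
u dx and \<sigma> dx, and those are bounded with constants that do not depend on the measure. For
that last fact the averages have to be over nested cells, where it is Doob's maximal inequality
(theorem dmax_strong_type). Finitely many shifted dyadic grids suffice to see all cubes
(lemma cube_subset_grid_cell), so M is taken to be the maximum of the maximal operators of these
grids.

All integrals are taken in the extended nonnegative reals, so that countable sums and suprema can be
interchanged with them freely.\<close>

section \<open>Powers of extended nonnegative reals and Hoelder's inequality\<close>

lemma ennpowr_ennreal: "0 \<le> t \<Longrightarrow> ennpowr (ennreal t) a = ennreal (t powr a)"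
  by (simp add: ennpowr_def)

lemma ennpowr_top [simp]: "ennpowr top a = top"
  by (simp add: ennpowr_def)

lemma ennpowr_0 [simp]: "ennpowr 0 a = 0"
  by (simp add: ennpowr_def)

lemma ennpowr_1 [simp]: "ennpowr x 1 = x"
  by (cases x rule: ennreal_cases) (auto simp: ennpowr_ennreal)

lemma ennpowr_one [simp]: "ennpowr 1 a = 1"
  using ennpowr_ennreal[of 1 a] by simp

lemma ennpowr_eq_0_iff [simp]: "ennpowr x a = 0 \<longleftrightarrow> x = 0"
  by (cases x rule: ennreal_cases) (auto simp: ennpowr_ennreal simp flip: ennreal_0)

lemma ennpowr_eq_top_iff [simp]: "ennpowr x a = top \<longleftrightarrow> x = top"
  by (cases x rule: ennreal_cases) (auto simp: ennpowr_ennreal)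

lemma ennpowr_less_top_iff [simp]: "ennpowr x a < top \<longleftrightarrow> x < top"
  by (metis ennpowr_eq_top_iff less_top)

lemma ennpowr_mono:
  assumes "x \<le> y" "0 \<le> a"
  shows "ennpowr x a \<le> ennpowr y a"
proof (cases y rule: ennreal_cases)
  case (real t)
  then obtain s where s: "x = ennreal s" "0 \<le> s"
    using assms by (cases x rule: ennreal_cases) (auto simp: top_unique)
  with real assms show ?thesis
    by (auto simp: ennpowr_ennreal intro!: ennreal_leI powr_mono2)
qed (simp_all add: top.extremum)

lemma ennpowr_mult:
  "ennpowr (x * y) a = ennpowr x a * ennpowr y a"
  by (cases x rule: ennreal_cases; cases y rule: ennreal_cases)
     (auto simp: ennpowr_ennreal ennreal_mult_top ennreal_top_mult powr_mult
       simp flip: ennreal_mult)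

lemma ennpowr_ennpowr: "ennpowr (ennpowr x a) b = ennpowr x (a * b)"
  by (cases x rule: ennreal_cases) (auto simp: ennpowr_ennreal powr_powr)

lemma ennpowr_add: "ennpowr x (a + b) = ennpowr x a * ennpowr x b"
  by (cases x rule: ennreal_cases)
     (auto simp: ennpowr_ennreal powr_add ennreal_mult simp flip: ennreal_mult)

lemma ennreal_divide_mult_cancel:
  fixes x y :: ennreal
  assumes "y \<noteq> 0" "y \<noteq> top"
  shows "x / y * y = x"
  using assms by (simp add: ennreal_divide_times less_top)

lemma ennpowr_divide_finite:
  assumes "y \<noteq> 0" "y \<noteq> top"
  shows "ennpowr (x / y) a = ennpowr x a / ennpowr y a"
proof -
  have "ennpowr x a = ennpowr (x / y) a * ennpowr y a"
    using assms by (simp add: ennreal_divide_mult_cancel flip: ennpowr_mult)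
  then show ?thesis
    using assms by (simp add: ennreal_mult_divide_eq)
qed

text \<open>Powers with positive exponent are order isomorphisms, so a bound on a power of a supremum can be
checked term by term.\<close>

lemma ennpowr_le_iff_le:
  assumes "0 < a"
  shows "ennpowr x a \<le> y \<longleftrightarrow> x \<le> ennpowr y (1 / a)"
proof
  assume "ennpowr x a \<le> y"
  then have "ennpowr (ennpowr x a) (1 / a) \<le> ennpowr y (1 / a)"
    using assms by (intro ennpowr_mono) auto
  then show "x \<le> ennpowr y (1 / a)"
    using assms by (simp add: ennpowr_ennpowr)
next
  assume "x \<le> ennpowr y (1 / a)"
  then have "ennpowr x a \<le> ennpowr (ennpowr y (1 / a)) a"
    using assms by (intro ennpowr_mono) auto
  then show "ennpowr x a \<le> y"
    using assms by (simp add: ennpowr_ennpowr)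
qed

lemma measurable_ennpowr [measurable]:
  assumes [measurable]: "f \<in> borel_measurable M"
  shows "(\<lambda>x. ennpowr (f x) a) \<in> borel_measurable M"
  unfolding ennpowr_def by measurable

lemma ennpowr_young:
  assumes "0 < a" "a < 1"
  shows "ennpowr x a * ennpowr y (1 - a) \<le> ennreal a * x + ennreal (1 - a) * y"
proof (cases "x = 0 \<or> y = 0 \<or> x = top \<or> y = top")
  case True
  then show ?thesis
    using assms by (auto simp: ennreal_mult_top)
next
  case False
  then obtain s t where st: "x = ennreal s" "y = ennreal t" "0 < s" "0 < t"
    by (cases x rule: ennreal_cases; cases y rule: ennreal_cases) (auto simp: less_le)
  have "s powr a * t powr (1 - a) \<le> a * s + (1 - a) * t"
    using assms st by (intro Youngs_inequality_0) auto
  then show ?thesis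
    using st assms
    by (simp add: ennpowr_ennreal flip: ennreal_mult' ennreal_plus)

qed

text \<open>Hoelder's inequality in the form of an interpolation of two integrals. Young's inequality gives it
when both integrals are 1; the general case is a rescaling, except when one of the integrals is 0 or
infinite.\<close>

lemma nn_integral_Holder:
  assumes [measurable]: "F \<in> borel_measurable M" "G \<in> borel_measurable M"
    and a: "0 < a" "a < 1"
  shows "(\<integral>\<^sup>+x. ennpowr (F x) a * ennpowr (G x) (1 - a) \<partial>M)
    \<le> ennpowr (\<integral>\<^sup>+x. F x \<partial>M) a * ennpowr (\<integral>\<^sup>+x. G x \<partial>M) (1 - a)"
proof -
  define X Y where "X = (\<integral>\<^sup>+x. F x \<partial>M)" and "Y = (\<integral>\<^sup>+x. G x \<partial>M)"
  consider "X = 0 \<or> Y = 0" | "X \<noteq> 0" "Y \<noteq> 0" "X = top \<or> Y = top"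
    | "X \<noteq> 0" "Y \<noteq> 0" "X \<noteq> top" "Y \<noteq> top" by blast
  then show ?thesis
  proof cases
    case 1
    then have "(AE x in M. F x = 0) \<or> (AE x in M. G x = 0)"
      by (auto simp: X_def Y_def nn_integral_0_iff_AE)
    then have "AE x in M. ennpowr (F x) a * ennpowr (G x) (1 - a) = 0"
      by auto
    then have "(\<integral>\<^sup>+x. ennpowr (F x) a * ennpowr (G x) (1 - a) \<partial>M) = 0"
      by (subst nn_integral_0_iff_AE) auto
    then show ?thesis by simp
  next
    case 2
    then have "ennpowr X a * ennpowr Y (1 - a) = top"
      by (auto simp: ennreal_mult_eq_top_iff)
    then show ?thesis
      by (simp add: X_def Y_def)
  next
    case 3
    let ?C = "ennpowr X a * ennpowr Y (1 - a)"
    have *: "ennpowr (F x) a * ennpowr (G x) (1 - a)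
        = ?C * (ennpowr (F x / X) a * ennpowr (G x / Y) (1 - a))" for x
    proof -
      have "F x = X * (F x / X)" "G x = Y * (G x / Y)"
        using 3 by (simp_all add: ennreal_divide_mult_cancel mult.commute[of _ "_ / _"])
      then show ?thesis
        by (metis (no_types, lifting) ennpowr_mult mult.assoc mult.left_commute)
    qed
    have "(\<integral>\<^sup>+x. ennpowr (F x) a * ennpowr (G x) (1 - a) \<partial>M)
        \<le> (\<integral>\<^sup>+x. ?C * (ennreal a * (F x / X) + ennreal (1 - a) * (G x / Y)) \<partial>M)"
      unfolding * by (intro nn_integral_mono mult_left_mono ennpowr_young a) auto
    also have "\<dots> = ?C * (ennreal a * (X / X) + ennreal (1 - a) * (Y / Y))"
      by (simp add: nn_integral_cmult nn_integral_add nn_integral_divide X_def Y_def)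
    also have "\<dots> = ?C"
      using 3 a by (simp add: less_top flip: ennreal_plus)
    finally show ?thesis by (simp add: X_def Y_def)
  qed
qed

text \<open>Jensen's inequality for a probability measure on the natural numbers. In the Rubio de Francia
algorithm it replaces the triangle inequality for infinite sums in a weighted space.\<close>

lemma ennpowr_suminf_convex:
  fixes c a :: "nat \<Rightarrow> ennreal"
  assumes "1 < s" and c: "suminf c = 1"
  shows "ennpowr (\<Sum>k. c k * a k) s \<le> (\<Sum>k. c k * ennpowr (a k) s)"
proof -
  let ?N = "density (count_space UNIV) c"
  have N: "(\<integral>\<^sup>+k. f k \<partial>?N) = (\<Sum>k. c k * f k)" for f :: "nat \<Rightarrow> ennreal"
    by (subst nn_integral_density) (auto simp: nn_integral_count_space_nat)
  have "(\<integral>\<^sup>+k. ennpowr (ennpowr (a k) s) (1/s) * ennpowr 1 (1 - 1/s) \<partial>?N)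
      \<le> ennpowr (\<integral>\<^sup>+k. ennpowr (a k) s \<partial>?N) (1/s) * ennpowr (\<integral>\<^sup>+k. 1 \<partial>?N) (1 - 1/s)"
    using assms by (intro nn_integral_Holder) auto
  moreover have "(\<integral>\<^sup>+k. 1 \<partial>?N) = 1"
    unfolding N using c by simp
  ultimately have "(\<Sum>k. c k * a k) \<le> ennpowr (\<Sum>k. c k * ennpowr (a k) s) (1/s)"
    using assms by (simp only: N ennpowr_ennpowr) simp
  then show ?thesis
    using assms by (simp add: ennpowr_le_iff_le)
qed

section \<open>The maximal theorem for nested partitions\<close>

lemma ennreal_divide_mult_le: "(a::ennreal) / b * b \<le> a"
  by (cases "b = 0 \<or> b = top") (auto simp: ennreal_divide_mult_cancel)

lemma ennreal_le_suminf: "f n \<le> suminf f" for f :: "nat \<Rightarrow> ennreal"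
proof -
  have "sum f {n} \<le> suminf f" by (rule sum_le_suminf) auto
  then show ?thesis by simp
qed

text \<open>A discrete layer-cake formula: the sum runs over all dyadic levels 2^j with j an integer,
enumerated by the bijection between naturals and integers, and the level with
2^j < y \<le> 2^(j+1) alone already accounts for the left-hand side.\<close>

lemma ennreal_le_dyadic_sum:
  fixes y :: ennreal
  assumes "0 < s"
  shows "ennpowr y s \<le> (\<Sum>n. ennreal (2 powr (s * (real_of_int (int_decode n) + 1)))
      * indicator {ennreal (2 powr real_of_int (int_decode n)) <..} y)"
    (is "_ \<le> (\<Sum>n. ?f n)")
proof -
  have ge: "?f n \<le> suminf ?f" for n
    by (rule ennreal_le_suminf)
  show ?thesis
  proof (cases y rule: ennreal_cases)
    case (real t)
    show ?thesis
    proof (cases "t = 0")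
      case False
      with real have t: "0 < t" by simp
      define j where "j = \<lceil>log 2 t\<rceil> - 1"
      have "real_of_int j < log 2 t" "log 2 t \<le> real_of_int j + 1"
        unfolding j_def by linarith+
      then have j: "2 powr real_of_int j < t" "t \<le> 2 powr (real_of_int j + 1)"
        using t by (simp_all add: less_log_iff log_le_iff)
      have "t powr s \<le> (2 powr (real_of_int j + 1)) powr s"
        using j t assms by (intro powr_mono2) auto
      then have "ennpowr y s \<le> ?f (int_encode j)"
        using j t real by (simp add: ennpowr_ennreal powr_powr mult.commute ennreal_leI ennreal_less_iff)
      then show ?thesis by (rule order_trans[OF _ ge])
    qed (use real in simp)
  next
    case top
    have "ennreal (real n) \<le> suminf ?f" for n
    proof -
      have "real n \<le> 2 powr (s * (real n / s))"
        using assms of_nat_less_two_power[of n, where 'a=real] by (simp add: powr_realpow)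
      also have "\<dots> \<le> 2 powr (s * (real_of_int \<lceil>real n / s\<rceil> + 1))"
        using assms by (intro powr_mono mult_left_mono) (auto, linarith)
      finally have "ennreal (real n) \<le> ?f (int_encode \<lceil>real n / s\<rceil>)"
        by (simp add: top ennreal_leI)
      then show ?thesis by (rule order_trans[OF _ ge])
    qed
    then have "(SUP n. of_nat n :: ennreal) \<le> suminf ?f"
      by (intro SUP_least) (simp only: ennreal_of_nat_eq_real_of_nat)
    then have "suminf ?f = top"
      by (simp only: ennreal_SUP_of_nat_eq_top top_unique)
    then show ?thesis by simp
  qed
qed

text \<open>The reverse comparison: the levels below y form a geometric series dominated by its largest
term.\<close>

lemma dyadic_sum_le:
  fixes y :: ennreal
  assumes "0 < b"
  shows "(\<Sum>n. ennreal (2 powr (b * real_of_int (int_decode n)))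
      * indicator {ennreal (2 powr real_of_int (int_decode n)) <..} y)
    \<le> ennreal (1 / (1 - 2 powr (-b))) * ennpowr y b"
proof -
  let ?g = "\<lambda>j::int. ennreal (2 powr (b * real_of_int j)) * indicator {ennreal (2 powr real_of_int j) <..} y"
  have q: "0 < 2 powr (-b)" "2 powr (-b) < 1"
    using assms powr_less_mono[of "-b" 0 2] by auto
  consider "y = 0" | t where "y = ennreal t" "0 < t" | "y = top"
    by (cases y rule: ennreal_cases) (auto simp: less_le)
  then show ?thesis
  proof cases
    case 2
    define J where "J = \<lceil>log 2 t\<rceil> - 1"
    have J: "2 powr real_of_int j < t \<longleftrightarrow> j \<le> J" for j
    proof -
      have "2 powr real_of_int j < t \<longleftrightarrow> real_of_int j < log 2 t"
        using 2 by (simp add: less_log_iff)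
      also have "\<dots> \<longleftrightarrow> j \<le> J"
        unfolding J_def by linarith
      finally show ?thesis .
    qed
    have geo: "(\<lambda>i. 2 powr (b * real_of_int (J - int i))) sums
        (2 powr (b * real_of_int J) * (1 / (1 - 2 powr (-b))))"
    proof -
      have "2 powr (b * real_of_int (J - int i)) = 2 powr (b * real_of_int J) * (2 powr (-b)) ^ i" for i
        by (simp add: powr_realpow[symmetric] powr_powr right_diff_distrib flip: powr_add)
      then show ?thesis
        using sums_mult[OF geometric_sums[of "2 powr (-b)"]] q by simp
    qed
    have "(\<Sum>n. ?g (int_decode n)) = (\<integral>\<^sup>+n. ?g (int_decode n) \<partial>count_space UNIV)"
      by (simp add: nn_integral_count_space_nat)
    also have "\<dots> = (\<integral>\<^sup>+j. ?g j \<partial>count_space UNIV)"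
      by (rule nn_integral_bij_count_space) (rule bij_int_decode)
    also have "\<dots> = (\<integral>\<^sup>+j. ennreal (2 powr (b * real_of_int j)) \<partial>count_space {..J})"
      using 2 J by (subst (2) nn_integral_count_space_indicator)
        (auto intro!: nn_integral_cong simp: ennreal_less_iff split: split_indicator)
    also have "\<dots> = (\<integral>\<^sup>+i. ennreal (2 powr (b * real_of_int (J - int i))) \<partial>count_space UNIV)"
      by (intro nn_integral_bij_count_space[symmetric] bij_betwI[where g = "\<lambda>j. nat (J - j)"]) auto
    also have "\<dots> = ennreal (2 powr (b * real_of_int J) * (1 / (1 - 2 powr (-b))))"
      unfolding nn_integral_count_space_nat using geo by (intro suminf_ennreal_eq) auto
    also have "\<dots> \<le> ennreal ((1 / (1 - 2 powr (-b))) * t powr b)"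
    proof -
      have "2 powr (b * real_of_int J) = (2 powr real_of_int J) powr b"
        by (simp add: powr_powr mult.commute)
      also have "\<dots> \<le> t powr b"
        using J[of J] assms 2 by (intro powr_mono2) auto
      finally show ?thesis
        using q by (intro ennreal_leI) (simp add: divide_right_mono)
    qed
    also have "\<dots> = ennreal (1 / (1 - 2 powr (-b))) * ennpowr y b"
      unfolding 2 using q 2 by (subst ennreal_mult) (auto simp: ennpowr_ennreal)
    finally show ?thesis .
  next
    case 3
    have "ennreal (1 / (1 - 2 powr (-b))) * ennpowr y b = top"
      unfolding 3 using q assms by (simp only: ennpowr_top ennreal_mult_top) simp
    then show ?thesis by (simp only: top.extremum)
  next
    case 1
    have "(\<lambda>n. ?g (int_decode n)) = (\<lambda>n. 0)"
      by (simp add: 1 fun_eq_iff)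
    then show ?thesis by (simp only: suminf_zero zero_le)
  qed
qed

text \<open>A two-sided sequence of partitions into countably many measurable cells, finer and finer as the
index grows. A partition is given by a label for each point, so that two points share a cell of
generation k when their labels agree; this makes measurability and nestedness one-line
conditions.\<close>

locale nested_partitions =
  fixes M :: "'a measure" and L :: "int \<Rightarrow> 'a \<Rightarrow> 'l::countable"
  assumes label_measurable: "L k \<in> M \<rightarrow>\<^sub>M count_space UNIV"
    and label_nested: "L (k + 1) x = L (k + 1) y \<Longrightarrow> L k x = L k y"
begin

definition cell :: "int \<Rightarrow> 'a \<Rightarrow> 'a set" where
  "cell k x = {y \<in> space M. L k y = L k x}"

definition cell_avg :: "('a \<Rightarrow> ennreal) \<Rightarrow> int \<Rightarrow> 'a \<Rightarrow> ennreal" where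
  "cell_avg g k x = (\<integral>\<^sup>+y\<in>cell k x. g y \<partial>M) / emeasure M (cell k x)"

definition dmax :: "('a \<Rightarrow> ennreal) \<Rightarrow> 'a \<Rightarrow> ennreal" where
  "dmax g x = (SUP k. cell_avg g k x)"

lemma cell_sets [measurable]: "cell k x \<in> sets M"
proof -
  have "cell k x = L k -` {L k x} \<inter> space M"
    by (auto simp: cell_def)
  then show ?thesis
    using measurable_sets[OF label_measurable, of "{L k x}"] by simp
qed

lemma label_coarser:
  assumes "j \<le> k" "L k x = L k y"
  shows "L j x = L j y"
  using assms
proof (induction k rule: int_ge_induct)
  case (step i)
  then show ?case using label_nested by blast
qed

lemma cell_avg_cong: "L k x = L k y \<Longrightarrow> cell_avg g k x = cell_avg g k y"
  by (simp add: cell_avg_def cell_def)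

lemma cell_avg_measurable [measurable]: "cell_avg g k \<in> borel_measurable M"
proof -
  have "cell_avg g k x = (\<lambda>l. (\<integral>\<^sup>+y\<in>{y\<in>space M. L k y = l}. g y \<partial>M)
      / emeasure M {y\<in>space M. L k y = l}) (L k x)" for x
    by (simp add: cell_avg_def cell_def)
  then have "cell_avg g k = (\<lambda>l. (\<integral>\<^sup>+y\<in>{y\<in>space M. L k y = l}. g y \<partial>M)
      / emeasure M {y\<in>space M. L k y = l}) \<circ> L k"
    by auto
  then show ?thesis
    by (simp only:) (rule measurable_comp[OF label_measurable], simp)
qed

lemma dmax_measurable [measurable]: "dmax g \<in> borel_measurable M"
  unfolding dmax_def by measurable

lemma mult_emeasure_le_disjoint_family:
  assumes [measurable]: "g \<in> borel_measurable M" "\<And>i::nat. F i \<in> sets M"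
    and "disjoint_family F"
    and le: "\<And>i. l * emeasure M (F i) \<le> (\<integral>\<^sup>+x\<in>F i. g x \<partial>M)"
  shows "l * emeasure M (\<Union>i. F i) \<le> (\<integral>\<^sup>+x\<in>(\<Union>i. F i). g x \<partial>M)"
proof -
  have "l * emeasure M (\<Union>i. F i) = (\<Sum>i. l * emeasure M (F i))"
    using assms by (simp add: suminf_emeasure[symmetric] range_subsetD image_subset_iff)
  also have "\<dots> \<le> (\<Sum>i. \<integral>\<^sup>+x\<in>F i. g x \<partial>M)"
    by (intro suminf_le le) auto
  also have "\<dots> = (\<integral>\<^sup>+x\<in>(\<Union>i. F i). g x \<partial>M)"
    using assms by (intro nn_integral_disjoint_family[symmetric]) auto
  finally show ?thesis .
qed

text \<open>On a set that is a union of cells of one generation, the averages of that generation reproduce the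
integral; the conventions 0/0 = 0 and a/\<infinity> = 0 make the estimate true on null cells and on
cells of infinite measure.\<close>

lemma saturated_weak_type:
  assumes g [measurable]: "g \<in> borel_measurable M" and F [measurable]: "F \<in> sets M"
    and sat: "\<And>x y. x \<in> F \<Longrightarrow> y \<in> space M \<Longrightarrow> L k x = L k y \<Longrightarrow> y \<in> F"
    and avg: "\<And>x. x \<in> F \<Longrightarrow> l \<le> cell_avg g k x"
  shows "l * emeasure M F \<le> (\<integral>\<^sup>+x\<in>F. g x \<partial>M)"
proof -
  note label_measurable [measurable]
  define G where "G i = {x \<in> F. to_nat (L k x) = i}" for i
  have sub: "F \<subseteq> space M"
    using sets.sets_into_space[OF F] .
  have Gcell: "G (to_nat (L k x)) = cell k x" if "x \<in> F" for x
    using that sat sub by (auto simp: G_def cell_def)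
  have Gm [measurable]: "G i \<in> sets M" for i
  proof (cases "G i = {}")
    case False
    then obtain x where "x \<in> F" "i = to_nat (L k x)" by (auto simp: G_def)
    then show ?thesis using Gcell by simp
  qed simp
  have "l * emeasure M (\<Union>i. G i) \<le> (\<integral>\<^sup>+x\<in>(\<Union>i. G i). g x \<partial>M)"
  proof (intro mult_emeasure_le_disjoint_family)
    show "disjoint_family G" by (auto simp: G_def disjoint_family_on_def)
    show "l * emeasure M (G i) \<le> (\<integral>\<^sup>+x\<in>G i. g x \<partial>M)" for i
    proof (cases "G i = {}")
      case False
      then obtain x where x: "x \<in> F" "i = to_nat (L k x)" by (auto simp: G_def)
      have "l * emeasure M (cell k x) \<le> cell_avg g k x * emeasure M (cell k x)"
        by (intro mult_right_mono avg x) auto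
      also have "\<dots> \<le> (\<integral>\<^sup>+x\<in>cell k x. g x \<partial>M)"
        unfolding cell_avg_def by (rule ennreal_divide_mult_le)
      finally show ?thesis using x Gcell by simp
    qed simp
  qed auto
  moreover have "(\<Union>i. G i) = F" by (auto simp: G_def)
  ultimately show ?thesis by simp
qed

text \<open>Stopping at the first generation k \<ge> -n whose average exceeds l splits the level set into
disjoint sets, each saturated for its own generation by nestedness. The bound is uniform in n, and
n \<rightarrow> \<infinity> gives the result.\<close>

lemma dmax_weak_type:
  assumes g [measurable]: "g \<in> borel_measurable M"
  shows "l * emeasure M {x \<in> space M. l < dmax g x} \<le> (\<integral>\<^sup>+x. g x \<partial>M)"
proof -
  define S where "S k = {x \<in> space M. l < cell_avg g k x}" for k
  define U where "U n = (\<Union>m. S (int m - int n))" for n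
  have Sm [measurable]: "S k \<in> sets M" for k
    unfolding S_def by measurable
  have Um [measurable]: "U n \<in> sets M" for n
    unfolding U_def by measurable
  have U: "{x \<in> space M. l < dmax g x} = (\<Union>n. U n)"
  proof -
    have "S k \<subseteq> U (nat (-k))" for k
    proof -
      have "S k = S (int (nat k) - int (nat (-k)))" by (rule arg_cong[of _ _ S]) auto
      then show ?thesis unfolding U_def by blast
    qed
    then have "(\<Union>n. U n) = (\<Union>k. S k)"
      unfolding U_def by fast
    then show ?thesis
      by (auto simp: S_def dmax_def less_SUP_iff)
  qed
  have Uinc: "incseq U"
  proof (rule incseq_SucI)
    show "U n \<le> U (Suc n)" for n
    proof -
      have "S (int m - int n) = S (int (Suc m) - int (Suc n))" for m by simp
      then show ?thesis unfolding U_def by blast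
    qed
  qed
  have "l * emeasure M (U n) \<le> (\<integral>\<^sup>+x. g x \<partial>M)" for n
  proof -
    \<comment> \<open>the points whose first generation with a large average is the one indexed by m\<close>
    define F where "F = disjointed (\<lambda>m. S (int m - int n))"
    have "range (\<lambda>m. S (int m - int n)) \<subseteq> sets M" by auto
    then have Fm [measurable]: "F m \<in> sets M" for m
      unfolding F_def by (intro range_subsetD[OF sets.range_disjointed_sets])
    have "l * emeasure M (\<Union>m. F m) \<le> (\<integral>\<^sup>+x\<in>(\<Union>m. F m). g x \<partial>M)"
    proof (intro mult_emeasure_le_disjoint_family)
      show "disjoint_family F" unfolding F_def by (rule disjoint_family_disjointed)
      show "l * emeasure M (F m) \<le> (\<integral>\<^sup>+x\<in>F m. g x \<partial>M)" for m
      proof (rule saturated_weak_type[where k = "int m - int n"])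
        fix x y assume *: "x \<in> F m" "y \<in> space M" "L (int m - int n) x = L (int m - int n) y"
        have "cell_avg g (int i - int n) x = cell_avg g (int i - int n) y" if "i \<le> m" for i
          using that * by (intro cell_avg_cong label_coarser[of "int i - int n" "int m - int n"]) auto
        then show "y \<in> F m"
          using * by (auto simp: F_def disjointed_def S_def)
      qed (auto simp: F_def disjointed_def S_def)
    qed auto
    also have "\<dots> \<le> (\<integral>\<^sup>+x. g x \<partial>M)"
      by (intro nn_integral_mono) (auto split: split_indicator)
    finally show ?thesis
      by (simp add: F_def UN_disjointed_eq U_def)
  qed
  moreover have "emeasure M (\<Union>n. U n) = (SUP n. emeasure M (U n))"
    using Uinc by (intro SUP_emeasure_incseq[symmetric]) auto
  ultimately show ?thesis
    unfolding U by (simp add: SUP_mult_left_ennreal SUP_le_iff)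
qed

text \<open>The part of g below the level l contributes at most l to the maximal function.\<close>

lemma dmax_weak_type_truncated:
  assumes g [measurable]: "g \<in> borel_measurable M" and l: "l \<noteq> top"
  shows "l * emeasure M {x \<in> space M. 2 * l < dmax g x} \<le> (\<integral>\<^sup>+x\<in>{x. l < g x}. g x \<partial>M)"
proof -
  let ?g = "\<lambda>x. g x * indicator {x. l < g x} x"
  have "dmax g x \<le> dmax ?g x + l" for x
    unfolding dmax_def
  proof (rule SUP_least)
    fix k
    have "(\<integral>\<^sup>+y\<in>cell k x. g y \<partial>M) \<le> (\<integral>\<^sup>+y. ?g y * indicator (cell k x) y + l * indicator (cell k x) y \<partial>M)"
      by (intro nn_integral_mono) (auto split: split_indicator)
    also have "\<dots> = (\<integral>\<^sup>+y\<in>cell k x. ?g y \<partial>M) + l * emeasure M (cell k x)"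
      by (simp add: nn_integral_add nn_integral_cmult_indicator)
    finally have "cell_avg g k x \<le> cell_avg ?g k x + l * emeasure M (cell k x) / emeasure M (cell k x)"
      unfolding cell_avg_def add_divide_distrib_ennreal[symmetric] by (intro divide_right_mono_ennreal)
    also have "\<dots> \<le> cell_avg ?g k x + l"
    proof (intro add_left_mono)
      show "l * emeasure M (cell k x) / emeasure M (cell k x) \<le> l"
        by (cases "emeasure M (cell k x) = 0 \<or> emeasure M (cell k x) = top")
          (auto simp: ennreal_mult_divide_eq)
    qed
    also have "\<dots> \<le> (SUP k. cell_avg ?g k x) + l"
      by (intro add_right_mono SUP_upper) auto
    finally show "cell_avg g k x \<le> (SUP k. cell_avg ?g k x) + l" .
  qed
  note le = this
  have *: "l < dmax ?g x" if "2 * l < dmax g x" for x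
  proof (rule ccontr)
    assume "\<not> l < dmax ?g x"
    then have "dmax ?g x + l \<le> l + l" by (intro add_right_mono) simp
    with le[of x] that show False
      unfolding mult_2 by (meson leD order_trans)
  qed
  have "l * emeasure M {x \<in> space M. 2 * l < dmax g x} \<le> l * emeasure M {x \<in> space M. l < dmax ?g x}"
    using * by (intro mult_left_mono emeasure_mono) auto
  also have "\<dots> \<le> (\<integral>\<^sup>+x. ?g x \<partial>M)"
    by (rule dmax_weak_type) measurable
  finally show ?thesis .
qed

text \<open>Doob's maximal inequality, with a constant that depends on the exponent only. The truncated
weak-type estimate is summed over dyadic levels. Since truncation leaves only g on the right, the
maximal function never has to be absorbed into the left-hand side, and infinite integrals are
covered by the same argument.\<close>

theorem dmax_strong_type:
  assumes g [measurable]: "g \<in> borel_measurable M" and s: "1 < s"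
  shows "(\<integral>\<^sup>+x. ennpowr (dmax g x) s \<partial>M)
    \<le> ennreal (4 powr s / (1 - 2 powr (1 - s))) * (\<integral>\<^sup>+x. ennpowr (g x) s \<partial>M)"
proof -
  let ?e = "\<lambda>n. real_of_int (int_decode n)"
  have q: "0 < 2 powr (1 - s)" "2 powr (1 - s) < 1"
    using s powr_less_mono[of "1 - s" 0 2] by auto
  have level: "ennreal (2 powr (s * (?e n + 1)))
      * emeasure M {x \<in> space M. ennreal (2 powr ?e n) < dmax g x}
    \<le> ennreal (4 powr s) * (\<integral>\<^sup>+x. g x * (ennreal (2 powr ((s - 1) * (?e n - 1)))
        * indicator {ennreal (2 powr (?e n - 1)) <..} (g x)) \<partial>M)" for n
  proof -
    have two: "ennreal (2 powr ?e n) = 2 * ennreal (2 powr (?e n - 1))"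
      by (simp add: powr_diff numeral_mult_ennreal)
    have "2 powr (s * (?e n + 1)) = 4 powr s * 2 powr ((s - 1) * (?e n - 1)) * 2 powr (?e n - 1)"
    proof -
      have "4 powr s = 2 powr (2 * s)"
        using powr_powr[of 2 2 s] by simp
      then show ?thesis
        by (simp add: algebra_simps flip: powr_add)
    qed
    then have "ennreal (2 powr (s * (?e n + 1)))
      * emeasure M {x \<in> space M. ennreal (2 powr ?e n) < dmax g x}
      = ennreal (4 powr s * 2 powr ((s - 1) * (?e n - 1))) * (ennreal (2 powr (?e n - 1))
        * emeasure M {x \<in> space M. 2 * ennreal (2 powr (?e n - 1)) < dmax g x})"
      by (simp add: two ennreal_mult mult.assoc)
    also have "\<dots> \<le> ennreal (4 powr s * 2 powr ((s - 1) * (?e n - 1))) *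
        (\<integral>\<^sup>+x\<in>{x. ennreal (2 powr (?e n - 1)) < g x}. g x \<partial>M)"
      by (intro mult_left_mono dmax_weak_type_truncated) auto
    also have "\<dots> = ennreal (4 powr s) * (\<integral>\<^sup>+x. ennreal (2 powr ((s - 1) * (?e n - 1))) *
        (g x * indicator {x. ennreal (2 powr (?e n - 1)) < g x} x) \<partial>M)"
      by (subst nn_integral_cmult) (auto simp: ennreal_mult mult.assoc)
    finally show ?thesis
      by (simp add: indicator_def mult_ac cong: if_cong)
  qed
  have shift: "(\<Sum>n. ennreal (2 powr ((s - 1) * (?e n - 1))) * indicator {ennreal (2 powr (?e n - 1)) <..} y)
     \<le> ennreal (1 / (1 - 2 powr (1 - s))) * ennpowr y (s - 1)" for y
  proof -
    let ?G = "\<lambda>j::int. ennreal (2 powr ((s - 1) * real_of_int j)) * indicator {ennreal (2 powr real_of_int j) <..} y"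
    have eq: "(\<Sum>n. H (int_decode n)) = (\<integral>\<^sup>+j. H j \<partial>count_space UNIV)" for H :: "int \<Rightarrow> ennreal"
      by (simp add: nn_integral_count_space_nat[symmetric] nn_integral_bij_count_space[OF bij_int_decode])
    have "(\<Sum>n. ?G (int_decode n - 1)) = (\<integral>\<^sup>+j. ?G (j - 1) \<partial>count_space UNIV)"
      by (rule eq)
    also have "\<dots> = (\<integral>\<^sup>+j. ?G j \<partial>count_space UNIV)"
      by (rule nn_integral_bij_count_space) (rule bij_betwI[where g = "\<lambda>j. j + 1"], auto)
    also have "\<dots> = (\<Sum>n. ?G (int_decode n))"
      by (rule eq[symmetric])
    also have "\<dots> \<le> ennreal (1 / (1 - 2 powr (1 - s))) * ennpowr y (s - 1)"
      using dyadic_sum_le[of "s - 1" y] s by simp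
    finally show ?thesis by simp
  qed
  have "(\<integral>\<^sup>+x. ennpowr (dmax g x) s \<partial>M)
      \<le> (\<integral>\<^sup>+x. (\<Sum>n. ennreal (2 powr (s * (?e n + 1)))
          * indicator {ennreal (2 powr ?e n) <..} (dmax g x)) \<partial>M)"
    using s by (intro nn_integral_mono ennreal_le_dyadic_sum) auto
  also have "\<dots> = (\<Sum>n. \<integral>\<^sup>+x. ennreal (2 powr (s * (?e n + 1)))
          * indicator {x \<in> space M. ennreal (2 powr ?e n) < dmax g x} x \<partial>M)"
    by (subst nn_integral_suminf[symmetric]) (auto intro!: nn_integral_cong suminf_cong split: split_indicator)
  also have "\<dots> = (\<Sum>n. ennreal (2 powr (s * (?e n + 1)))
      * emeasure M {x \<in> space M. ennreal (2 powr ?e n) < dmax g x})"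
    by (intro suminf_cong nn_integral_cmult_indicator) measurable
  also have "\<dots> \<le> (\<Sum>n. ennreal (4 powr s) * (\<integral>\<^sup>+x. g x * (ennreal (2 powr ((s - 1) * (?e n - 1)))
        * indicator {ennreal (2 powr (?e n - 1)) <..} (g x)) \<partial>M))"
    by (intro suminf_le level) auto
  also have "\<dots> = ennreal (4 powr s) * (\<integral>\<^sup>+x. g x * (\<Sum>n. ennreal (2 powr ((s - 1) * (?e n - 1)))
        * indicator {ennreal (2 powr (?e n - 1)) <..} (g x)) \<partial>M)"
    by (simp add: nn_integral_suminf[symmetric])
  also have "\<dots> \<le> ennreal (4 powr s) * (\<integral>\<^sup>+x. g x * (ennreal (1 / (1 - 2 powr (1 - s))) * ennpowr (g x) (s - 1)) \<partial>M)"
    by (intro mult_left_mono nn_integral_mono shift) auto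
  also have "\<dots> = ennreal (4 powr s) * (\<integral>\<^sup>+x. ennreal (1 / (1 - 2 powr (1 - s))) * ennpowr (g x) s \<partial>M)"
    using ennpowr_add[of _ 1 "s - 1"] by (simp add: mult_ac)
  also have "\<dots> = ennreal (4 powr s / (1 - 2 powr (1 - s))) * (\<integral>\<^sup>+x. ennpowr (g x) s \<partial>M)"
    using q by (subst nn_integral_cmult) (auto simp: mult.assoc[symmetric] simp flip: ennreal_mult)
  finally show ?thesis .
qed

end

section \<open>Shifted dyadic grids\<close>

text \<open>Shifting by a third of the side length, with a sign that alternates between generations: in units of
the side length of generation k + 1 the shifts of two consecutive generations differ by an integer,
so that the shifted grid is nested just like the unshifted one.\<close>

definition grid_shift :: "bool \<Rightarrow> int \<Rightarrow> real" where
  "grid_shift b k = (if b then if even k then 1/3 else -1/3 else 0)"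

text \<open>The cells of generation k are half-open cubes of side 2^(-k); the parameter e says in which
coordinates the grid is shifted.\<close>

definition grid_label :: "('n::finite \<Rightarrow> bool) \<Rightarrow> int \<Rightarrow> real ^ 'n \<Rightarrow> ('n \<Rightarrow> int)" where
  "grid_label e k y = (\<lambda>i. \<lfloor>2 powr real_of_int k * y $ i + grid_shift (e i) k\<rfloor>)"

abbreviation grid_cell :: "('n::finite \<Rightarrow> bool) \<Rightarrow> int \<Rightarrow> real ^ 'n \<Rightarrow> (real ^ 'n) set" where
  "grid_cell e k x \<equiv> nested_partitions.cell lebesgue (grid_label e) k x"

lemma floor_eq_if_floor_double_eq:
  fixes x y :: real
  assumes "\<lfloor>2 * x\<rfloor> = \<lfloor>2 * y\<rfloor>"
  shows "\<lfloor>x\<rfloor> = \<lfloor>y\<rfloor>"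
  using floor_divide_real_eq_div[of 2 "2 * x"] floor_divide_real_eq_div[of 2 "2 * y"] assms by simp

lemma nested_partitions_grid:
  fixes e :: "'n::finite \<Rightarrow> bool"
  assumes N: "sets N = sets (lebesgue :: (real ^ 'n) measure)"
  shows "nested_partitions N (grid_label e)"
proof
  fix k :: int and x y :: "real ^ 'n"
  show "grid_label e k \<in> N \<rightarrow>\<^sub>M count_space UNIV"
  proof -
    have [measurable]: "(\<lambda>y::real^'n. y $ i) \<in> borel_measurable borel" for i
      by (intro borel_measurable_continuous_onI continuous_intros)
    have "grid_label e k -` {l} \<inter> space lebesgue \<in> sets lebesgue" for l
    proof -
      have "grid_label e k -` {l} \<inter> space lebesgue
          = {y \<in> space borel. \<forall>i\<in>UNIV. \<lfloor>2 powr real_of_int k * y $ i + grid_shift (e i) k\<rfloor> = l i}"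
        by (auto simp: grid_label_def)
      also have "\<dots> \<in> sets borel" by measurable
      finally show ?thesis by simp
    qed
    then have "grid_label e k \<in> lebesgue \<rightarrow>\<^sub>M count_space UNIV"
      by (simp add: measurable_count_space_eq2_countable)
    then show ?thesis
      using measurable_cong_sets[OF N refl] by blast
  qed
  show "grid_label e k x = grid_label e k y" if eq: "grid_label e (k + 1) x = grid_label e (k + 1) y"
  proof
    fix i
    define m where "m = (if e i then if even k then 1 else -1 else (0::int))"
    have double: "2 powr real_of_int (k + 1) * t + grid_shift (e i) (k + 1)
        = 2 * (2 powr real_of_int k * t + grid_shift (e i) k) - real_of_int m" for t
      by (auto simp: grid_shift_def m_def powr_add algebra_simps)
    have "\<lfloor>2 * (2 powr real_of_int k * x $ i + grid_shift (e i) k)\<rfloor>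
        = \<lfloor>2 * (2 powr real_of_int k * y $ i + grid_shift (e i) k)\<rfloor>"
      using fun_cong[OF eq, of i] unfolding grid_label_def double by simp
    then show "grid_label e k x i = grid_label e k y i"
      unfolding grid_label_def by (rule floor_eq_if_floor_double_eq)
  qed
qed

lemma grid_cell_eq: "grid_cell e k x = {y. grid_label e k y = grid_label e k x}"
  using nested_partitions.cell_def[OF nested_partitions_grid[OF refl]] by simp

lemma emeasure_cube:
  fixes a :: "real ^ 'n"
  assumes "0 < l"
  shows "emeasure lebesgue (cbox a (\<chi> i. a $ i + l)) = ennreal (l ^ CARD('n))"
proof -
  have "measure lborel (cbox a (\<chi> i. a $ i + l)) = l ^ CARD('n)"
  proof (subst content_cbox_cart)
    have "a \<in> cbox a (\<chi> i. a $ i + l)"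
      using assms by (simp add: mem_box_cart)
    then show "cbox a (\<chi> i. a $ i + l) \<noteq> {}" by blast
  qed simp
  moreover have "emeasure lborel (cbox a (\<chi> i. a $ i + l)) < \<infinity>"
    by (rule emeasure_lborel_cbox_finite)
  ultimately show ?thesis
    by (simp add: emeasure_eq_ennreal_measure less_top)
qed

text \<open>Half-open cells have the measure of their closures, which lets conditions on closed cubes be applied
to cells.\<close>

lemma grid_cell_cube:
  fixes x :: "real ^ 'n"
  shows "\<exists>Q\<in>cubes. grid_cell e k x \<subseteq> Q \<and> emeasure lebesgue (grid_cell e k x) = emeasure lebesgue Q
    \<and> emeasure lebesgue Q = ennreal ((2 powr - real_of_int k) ^ CARD('n))"
proof -
  define a :: "real ^ 'n" where
    "a = (\<chi> i. (real_of_int (grid_label e k x i) - grid_shift (e i) k) * 2 powr - real_of_int k)"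
  define D where "D = 2 powr - real_of_int k"
  define b where "b = (\<chi> i. a $ i + D)"
  have D: "0 < D" "2 powr real_of_int k * D = 1" "2 powr real_of_int k = 1 / D"
    by (auto simp: D_def powr_minus field_simps simp flip: powr_add)
  have cell: "y \<in> grid_cell e k x \<longleftrightarrow> (\<forall>i. a $ i \<le> y $ i \<and> y $ i < b $ i)" for y
  proof -
    have "grid_label e k y i = grid_label e k x i \<longleftrightarrow> a $ i \<le> y $ i \<and> y $ i < b $ i" for i
    proof -
      have "grid_label e k y i = grid_label e k x i \<longleftrightarrow>
          real_of_int (grid_label e k x i) \<le> y $ i / D + grid_shift (e i) k
          \<and> y $ i / D + grid_shift (e i) k < real_of_int (grid_label e k x i) + 1"
        unfolding grid_label_def[of e k y] D floor_eq_iff by simp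
      also have "\<dots> \<longleftrightarrow> a $ i \<le> y $ i \<and> y $ i < b $ i"
        using D(1) by (simp add: a_def b_def D_def[symmetric] field_simps)
      finally show ?thesis .
    qed
    then show ?thesis
      by (simp add: grid_cell_eq fun_eq_iff)
  qed
  have "cbox a b \<in> cubes"
    unfolding cubes_def b_def using D by auto
  moreover have sub: "grid_cell e k x \<subseteq> cbox a b" "box a b \<subseteq> grid_cell e k x"
    by (auto simp: cell mem_box_cart less_imp_le)
  moreover have eq: "emeasure lebesgue (box a b) = emeasure lebesgue (cbox a b)"
    by (simp add: emeasure_lborel_cbox_eq emeasure_lborel_box_eq)
  moreover have "emeasure lebesgue (grid_cell e k x) = emeasure lebesgue (cbox a b)"
  proof (rule antisym)
    show "emeasure lebesgue (grid_cell e k x) \<le> emeasure lebesgue (cbox a b)"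
      by (intro emeasure_mono sub) auto
    have "emeasure lebesgue (box a b) \<le> emeasure lebesgue (grid_cell e k x)"
      by (intro emeasure_mono sub nested_partitions.cell_sets nested_partitions_grid refl)
    then show "emeasure lebesgue (cbox a b) \<le> emeasure lebesgue (grid_cell e k x)"
      using eq by simp
  qed
  moreover have "emeasure lebesgue (cbox a b) = ennreal (D ^ CARD('n))"
    unfolding b_def by (rule emeasure_cube) (rule D)
  ultimately show ?thesis
    unfolding D_def by (intro bexI[of _ "cbox a b"] conjI)
qed

text \<open>An interval shorter than 1/3 cannot contain both an integer and a translate of an integer by
\<plusminus> 1/3.\<close>

lemma floor_constant_or_shifted:
  fixes z d s :: real
  assumes "0 \<le> d" "d < 1/3" and s: "s = 1/3 \<or> s = -1/3"
  shows "\<lfloor>z\<rfloor> = \<lfloor>z + d\<rfloor> \<or> \<lfloor>z + s\<rfloor> = \<lfloor>z + d + s\<rfloor>"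
proof (cases "\<lfloor>z\<rfloor> = \<lfloor>z + d\<rfloor>")
  case False
  define n where "n = \<lfloor>z + d\<rfloor>"
  have "\<lfloor>z\<rfloor> < n"
    using False assms floor_mono[of z "z + d"] by (simp add: n_def)
  then have z: "z < real_of_int n" "real_of_int n \<le> z + d"
    unfolding n_def by linarith+
  from s show ?thesis
  proof
    assume s: "s = 1/3"
    have "\<lfloor>z + s\<rfloor> = n" "\<lfloor>z + d + s\<rfloor> = n"
      unfolding floor_eq_iff using s z assms by auto
    then show ?thesis by simp
  next
    assume s: "s = -1/3"
    have "\<lfloor>z + s\<rfloor> = n - 1" "\<lfloor>z + d + s\<rfloor> = n - 1"
      unfolding floor_eq_iff using s z assms by auto
    then show ?thesis by simp
  qed
qed simp

text \<open>The one-third trick: for each coordinate, either the shifted or the unshifted grid of a suitable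
generation has no endpoint inside the cube.\<close>

lemma cube_subset_grid_cell:
  fixes Q :: "(real ^ 'n) set"
  assumes "Q \<in> cubes"
  shows "\<exists>e k. \<forall>x\<in>Q. Q \<subseteq> grid_cell e k x \<and>
    emeasure lebesgue (grid_cell e k x) \<le> 6 ^ CARD('n) * emeasure lebesgue Q"
proof -
  obtain a l where Q: "Q = cbox a (\<chi> i. a $ i + l)" and l: "0 < l"
    using assms by (auto simp: cubes_def)
  \<comment> \<open>the generation for which 1/6 \<le> 2^k l < 1/3\<close>
  define k where "k = \<lceil>log 2 (1 / (3 * l))\<rceil> - 1"
  have "real_of_int k < log 2 (1 / (3 * l))" "log 2 (1 / (3 * l)) \<le> real_of_int k + 1"
    unfolding k_def by linarith+
  then have "2 powr real_of_int k < 1 / (3 * l)" "1 / (3 * l) \<le> 2 powr (real_of_int k + 1)"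
    using l by (simp_all add: less_log_iff log_le_iff)
  then have k: "2 powr real_of_int k * l < 1/3" "1 \<le> 6 * l * 2 powr real_of_int k"
    using l by (simp_all add: field_simps powr_add)
  define e where "e i \<longleftrightarrow> \<lfloor>2 powr real_of_int k * a $ i\<rfloor> \<noteq> \<lfloor>2 powr real_of_int k * a $ i + 2 powr real_of_int k * l\<rfloor>" for i
  have const: "\<lfloor>2 powr real_of_int k * a $ i + grid_shift (e i) k\<rfloor>
      = \<lfloor>2 powr real_of_int k * (a $ i + l) + grid_shift (e i) k\<rfloor>" for i
  proof (cases "e i")
    case True
    then show ?thesis
      using floor_constant_or_shifted[of "2 powr real_of_int k * l" "grid_shift True k" "2 powr real_of_int k * a $ i"] k l
      by (auto simp: e_def grid_shift_def distrib_left)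
  qed (auto simp: e_def grid_shift_def distrib_left)
  have label: "grid_label e k y = grid_label e k a" if "y \<in> Q" for y
  proof
    fix i
    have y: "a $ i \<le> y $ i" "y $ i \<le> a $ i + l"
      using that by (auto simp: Q mem_box_cart)
    have "\<lfloor>2 powr real_of_int k * a $ i + grid_shift (e i) k\<rfloor> \<le> \<lfloor>2 powr real_of_int k * y $ i + grid_shift (e i) k\<rfloor>"
      using y by (intro floor_mono) auto
    moreover have "\<lfloor>2 powr real_of_int k * y $ i + grid_shift (e i) k\<rfloor>
        \<le> \<lfloor>2 powr real_of_int k * (a $ i + l) + grid_shift (e i) k\<rfloor>"
      using y by (intro floor_mono) auto
    ultimately show "grid_label e k y i = grid_label e k a i"
      unfolding grid_label_def using const[of i] by simp
  qed
  have "emeasure lebesgue (grid_cell e k x) \<le> 6 ^ CARD('n) * emeasure lebesgue Q" for x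
  proof -
    have "2 powr - real_of_int k \<le> 6 * l"
      using k by (simp add: powr_minus field_simps)
    then have "(2 powr - real_of_int k) ^ CARD('n) \<le> (6 * l) ^ CARD('n)"
      by (intro power_mono) auto
    moreover have "emeasure lebesgue (grid_cell e k x) = ennreal ((2 powr - real_of_int k) ^ CARD('n))"
      using grid_cell_cube[of e k x] by metis
    moreover have "6 ^ CARD('n) * emeasure lebesgue Q = ennreal ((6 * l) ^ CARD('n))"
      using l unfolding Q emeasure_cube[OF l]
      by (simp add: power_mult_distrib ennreal_mult ennreal_power[symmetric])
    ultimately show ?thesis
      by (simp add: ennreal_leI)
  qed
  moreover have "Q \<subseteq> grid_cell e k x" if "x \<in> Q" for x
    using label that by (auto simp: grid_cell_eq)
  ultimately show ?thesis by (intro exI[of _ e] exI[of _ k]) simp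
qed

lemma emeasure_cube_pos_finite:
  fixes Q :: "(real ^ 'n) set"
  assumes "Q \<in> cubes"
  shows "emeasure lebesgue Q \<noteq> 0" "emeasure lebesgue Q \<noteq> top"
proof -
  from assms obtain a l where "Q = cbox a (\<chi> i. a $ i + l)" and l: "0 < l"
    by (auto simp: cubes_def)
  then have "emeasure lebesgue Q = ennreal (l ^ CARD('n))"
    by (simp only: emeasure_cube)
  with l show "emeasure lebesgue Q \<noteq> 0" "emeasure lebesgue Q \<noteq> top"
    by simp_all
qed

text \<open>The maximal operator over all cells of all 2^n shifted grids. It is a finite maximum of nested
maximal operators, and up to the factor 6^n it dominates the averages over all cubes that contain
the point.\<close>

definition cube_max :: "(real ^ 'n \<Rightarrow> ennreal) \<Rightarrow> real ^ 'n \<Rightarrow> ennreal" where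
  "cube_max f x = (SUP e. nested_partitions.dmax lebesgue (grid_label e) f x)"

lemma cube_max_eq:
  "cube_max f x = (SUP e. SUP k. (\<integral>\<^sup>+y\<in>grid_cell e k x. f y \<partial>lebesgue) / emeasure lebesgue (grid_cell e k x))"
  by (simp add: cube_max_def nested_partitions.dmax_def[OF nested_partitions_grid[OF refl]]
      nested_partitions.cell_avg_def[OF nested_partitions_grid[OF refl]])

lemma cell_average_le_cube_max:
  "(\<integral>\<^sup>+y\<in>grid_cell e k x. f y \<partial>lebesgue) / emeasure lebesgue (grid_cell e k x) \<le> cube_max f x"
  unfolding cube_max_eq by (rule SUP_upper2[OF UNIV_I], rule SUP_upper[OF UNIV_I])

lemma cube_max_measurable [measurable]: "cube_max f \<in> borel_measurable lebesgue"
  unfolding cube_max_def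
  by (intro borel_measurable_SUP nested_partitions.dmax_measurable nested_partitions_grid) auto

lemma cube_max_suminf_le:
  assumes [measurable]: "\<And>n. f n \<in> borel_measurable lebesgue"
  shows "cube_max (\<lambda>x. \<Sum>n. c n * f n x) x \<le> (\<Sum>n. c n * cube_max (f n) x)"
  unfolding cube_max_eq[of "\<lambda>x. \<Sum>n. c n * f n x"]
proof (intro SUP_least)
  fix e k
  let ?Q = "grid_cell e k x"
  have [measurable]: "?Q \<in> sets lebesgue"
    by (intro nested_partitions.cell_sets nested_partitions_grid refl)
  have "(\<integral>\<^sup>+y\<in>?Q. (\<Sum>n. c n * f n y) \<partial>lebesgue) = (\<integral>\<^sup>+y. (\<Sum>n. c n * (f n y * indicator ?Q y)) \<partial>lebesgue)"
    by (simp add: mult.assoc flip: ennreal_suminf_multc)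
  also have "\<dots> = (\<Sum>n. c n * (\<integral>\<^sup>+y\<in>?Q. f n y \<partial>lebesgue))"
    by (subst nn_integral_suminf) (auto simp: nn_integral_cmult)
  finally have "(\<integral>\<^sup>+y\<in>?Q. (\<Sum>n. c n * f n y) \<partial>lebesgue) / emeasure lebesgue ?Q
      = (\<Sum>n. c n * ((\<integral>\<^sup>+y\<in>?Q. f n y \<partial>lebesgue) / emeasure lebesgue ?Q))"
    by (simp only: ennreal_times_divide ennreal_suminf_divide)
  also have "\<dots> \<le> (\<Sum>n. c n * cube_max (f n) x)"
    by (intro suminf_le mult_left_mono cell_average_le_cube_max) auto
  finally show "(\<integral>\<^sup>+y\<in>?Q. (\<Sum>n. c n * f n y) \<partial>lebesgue) / emeasure lebesgue ?Q
    \<le> (\<Sum>n. c n * cube_max (f n) x)" .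
qed

lemma average_le_cube_max:
  fixes Q :: "(real ^ 'n) set"
  assumes Q: "Q \<in> cubes" and x: "x \<in> Q"
  shows "average Q f \<le> 6 ^ CARD('n) * cube_max f x"
proof -
  obtain e k where ek: "Q \<subseteq> grid_cell e k x"
    "emeasure lebesgue (grid_cell e k x) \<le> 6 ^ CARD('n) * emeasure lebesgue Q"
    using cube_subset_grid_cell[OF Q] x by blast
  let ?I = "\<integral>\<^sup>+y\<in>grid_cell e k x. f y \<partial>lebesgue" and ?m = "emeasure lebesgue (grid_cell e k x)"
  obtain Q' :: "(real ^ 'n) set" where "Q' \<in> cubes" "?m = emeasure lebesgue Q'"
    using grid_cell_cube[of e k x] by blast
  then have m: "?m \<noteq> 0" "?m \<noteq> top"
    using emeasure_cube_pos_finite by metis+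
  have "(\<integral>\<^sup>+y\<in>Q. f y \<partial>lebesgue) \<le> ?I"
    using ek(1) by (intro nn_integral_mono) (auto split: split_indicator)
  also have "?I = ?I / ?m * ?m"
    using m by (simp add: ennreal_divide_mult_cancel)
  also have "\<dots> \<le> cube_max f x * (6 ^ CARD('n) * emeasure lebesgue Q)"
    by (intro mult_mono cell_average_le_cube_max ek(2)) auto
  finally have "average Q f \<le> cube_max f x * (6 ^ CARD('n) * emeasure lebesgue Q) / emeasure lebesgue Q"
    unfolding average_def by (rule divide_right_mono_ennreal)
  also have "\<dots> = (6 ^ CARD('n) * cube_max f x) * emeasure lebesgue Q / emeasure lebesgue Q"
    by (simp only: mult_ac)
  also have "\<dots> = 6 ^ CARD('n) * cube_max f x"
    by (intro ennreal_mult_divide_eq emeasure_cube_pos_finite[OF Q])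
  finally show ?thesis .
qed

section \<open>The sharp weighted bound for the dyadic maximal operator\<close>

text \<open>The class A_r with a prescribed bound for the constant, for weights that are positive everywhere, so
that the negative power is an honest real power.\<close>

definition muckenhoupt :: "real \<Rightarrow> real \<Rightarrow> (real ^ 'n \<Rightarrow> real) \<Rightarrow> bool" where
  "muckenhoupt r A u \<longleftrightarrow> u \<in> borel_measurable lebesgue \<and> (\<forall>x. 0 < u x) \<and> 0 < A \<and>
     (\<forall>Q\<in>cubes. average Q (\<lambda>x. ennreal (u x)) *
        ennpowr (average Q (\<lambda>x. ennreal (u x powr (- 1 / (r - 1))))) (r - 1) \<le> ennreal A)"

lemma ennreal_mult_divide_cancel_real:
  "0 < t \<Longrightarrow> ennreal t * (x / ennreal t * y) = x * y"
  using ennreal_divide_mult_cancel[of "ennreal t" x]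
  by (simp add: mult.assoc[symmetric] mult.commute[of "ennreal t"])

lemma nn_integral_pos_on:
  fixes g :: "'a \<Rightarrow> ennreal"
  assumes [measurable]: "g \<in> borel_measurable M" "Q \<in> sets M"
    and "\<And>x. 0 < g x" "emeasure M Q \<noteq> 0"
  shows "(\<integral>\<^sup>+x\<in>Q. g x \<partial>M) \<noteq> 0"
proof
  assume "(\<integral>\<^sup>+x\<in>Q. g x \<partial>M) = 0"
  then have "AE x in M. g x * indicator Q x = 0"
    by (subst (asm) nn_integral_0_iff_AE) auto
  then have "AE x in M. x \<notin> Q"
  proof (rule AE_mp, intro AE_I2 impI)
    fix x assume "g x * indicator Q x = 0"
    then show "x \<notin> Q" using assms(3)[of x] by (auto split: split_indicator_asm)
  qed
  then have "emeasure M Q = 0"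
    using AE_iff_measurable[of Q M "\<lambda>x. x \<notin> Q"] sets.sets_into_space[of Q M] by auto
  with assms show False by simp
qed

text \<open>The A_r condition on the cells, cleared of denominators, together with the finiteness that it
forces: the product of the two averages is finite and neither factor vanishes.\<close>

lemma muckenhoupt_grid_cell:
  fixes u :: "real ^ 'n \<Rightarrow> real" and e :: "'n \<Rightarrow> bool" and k :: int and x :: "real ^ 'n"
  assumes u: "muckenhoupt r A u" and r: "1 < r"
  defines "U \<equiv> \<integral>\<^sup>+y\<in>grid_cell e k x. ennreal (u y) \<partial>lebesgue"
    and "S \<equiv> \<integral>\<^sup>+y\<in>grid_cell e k x. ennreal (u y powr (- 1 / (r - 1))) \<partial>lebesgue"
    and "V \<equiv> emeasure lebesgue (grid_cell e k x)"
  shows "U * ennpowr S (r - 1) \<le> ennreal A * ennpowr V r"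
    and "U \<noteq> 0" "U \<noteq> top" "S \<noteq> 0" "S \<noteq> top" "V \<noteq> 0" "V \<noteq> top"
proof -
  let ?C = "grid_cell e k x"
  let ?U = "\<integral>\<^sup>+y\<in>?C. ennreal (u y) \<partial>lebesgue"
  let ?S = "\<integral>\<^sup>+y\<in>?C. ennreal (u y powr (- 1 / (r - 1))) \<partial>lebesgue"
  let ?V = "emeasure lebesgue ?C"
  have [measurable]: "u \<in> borel_measurable lebesgue" and pos: "\<And>x. 0 < u x"
    using u by (auto simp: muckenhoupt_def)
  obtain Q :: "(real ^ 'n) set" where Q: "Q \<in> cubes" "?C \<subseteq> Q" "?V = emeasure lebesgue Q"
    using grid_cell_cube[of e k x] by metis
  have V: "?V \<noteq> 0" "?V \<noteq> top"
    unfolding Q(3) by (rule emeasure_cube_pos_finite[OF Q(1)])+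
  have [measurable]: "?C \<in> sets lebesgue"
    by (intro nested_partitions.cell_sets nested_partitions_grid refl)
  have ne: "?U \<noteq> 0" "?S \<noteq> 0"
  proof -
    show "?U \<noteq> 0"
      using pos by (intro nn_integral_pos_on V) auto
    show "?S \<noteq> 0"
      using pos by (intro nn_integral_pos_on V) (auto simp: less_le)
  qed
  have le: "?U / ?V \<le> average Q (\<lambda>x. ennreal (u x))"
       "?S / ?V \<le> average Q (\<lambda>x. ennreal (u x powr (- 1 / (r - 1))))"
    unfolding average_def Q(3) using Q(2)
    by (auto intro!: divide_right_mono_ennreal nn_integral_mono split: split_indicator)
  have "?U / ?V * ennpowr (?S / ?V) (r - 1) \<le> average Q (\<lambda>x. ennreal (u x)) *
      ennpowr (average Q (\<lambda>x. ennreal (u x powr (- 1 / (r - 1))))) (r - 1)"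
    using r by (intro mult_mono ennpowr_mono le) auto
  also have "\<dots> \<le> ennreal A"
    using u Q(1) unfolding muckenhoupt_def by blast
  finally have "?U / ?V * ennpowr (?S / ?V) (r - 1) \<le> ennreal A" .
  then have "?U / ?V * (ennpowr ?S (r - 1) / ennpowr ?V (r - 1)) * (?V * ennpowr ?V (r - 1))
      \<le> ennreal A * (?V * ennpowr ?V (r - 1))"
    unfolding ennpowr_divide_finite[OF V] by (intro mult_right_mono) auto
  moreover have "?U / ?V * (ennpowr ?S (r - 1) / ennpowr ?V (r - 1)) * (?V * ennpowr ?V (r - 1))
      = (?U / ?V * ?V) * (ennpowr ?S (r - 1) / ennpowr ?V (r - 1) * ennpowr ?V (r - 1))"
    by (simp only: mult_ac)
  moreover have "?U / ?V * ?V = ?U"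
      "ennpowr ?S (r - 1) / ennpowr ?V (r - 1) * ennpowr ?V (r - 1) = ennpowr ?S (r - 1)"
    using V by (simp_all only: ennreal_divide_mult_cancel ennpowr_eq_0_iff ennpowr_eq_top_iff not_False_eq_True)
  moreover have "?V * ennpowr ?V (r - 1) = ennpowr ?V r"
    using ennpowr_add[of ?V 1 "r - 1"] by (simp only: ennpowr_1) simp
  ultimately have main: "?U * ennpowr ?S (r - 1) \<le> ennreal A * ennpowr ?V r"
    by (simp only:)
  moreover have "ennreal A * ennpowr ?V r < top"
    using V by (simp only: ennreal_mult_less_top ennpowr_less_top_iff) (simp add: less_top)
  ultimately have "?U * ennpowr ?S (r - 1) < top"
    by (rule le_less_trans)
  then have fin: "?U \<noteq> top" "?S \<noteq> top"
    using ne by (simp_all only: ennreal_mult_less_top ennpowr_less_top_iff ennpowr_eq_0_iff) (auto simp only: less_top)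
  show "U * ennpowr S (r - 1) \<le> ennreal A * ennpowr V r"
    "U \<noteq> 0" "U \<noteq> top" "S \<noteq> 0" "S \<noteq> top" "V \<noteq> 0" "V \<noteq> top"
    unfolding U_def S_def V_def by (fact main ne fin V)+
qed

text \<open>The constant of theorem dmax_strong_type.\<close>

definition doob_const :: "real \<Rightarrow> real" where
  "doob_const s = 4 powr s / (1 - 2 powr (1 - s))"

lemma doob_const_pos: "1 < s \<Longrightarrow> 0 < doob_const s"
  unfolding doob_const_def using powr_less_mono[of "1 - s" 0 2] by auto

text \<open>Lerner's pointwise bound. For a cell Q with m = \<sigma>(Q)^(-1)\<integral>_Q f the A_r condition gives
(|Q|^(-1)\<integral>_Q f)^(r-1) \<le> A m^(r-1) |Q| / u(Q). Here m is a \<sigma>-average of f/\<sigma>,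
hence at most the value D(y) of the \<sigma>-maximal function of f/\<sigma> at every y \<in> Q, and
m^(r-1)|Q|/u(Q) is at most the u-average of D^(r-1)/u over Q.\<close>

lemma grid_max_pointwise:
  fixes u :: "real ^ 'n \<Rightarrow> real" and e :: "'n \<Rightarrow> bool"
  assumes u: "muckenhoupt r A u" and r: "1 < r" and f [measurable]: "f \<in> borel_measurable lebesgue"
  defines "\<sigma> \<equiv> \<lambda>x. u x powr (- 1 / (r - 1))"
  defines "D \<equiv> nested_partitions.dmax (density lebesgue \<sigma>) (grid_label e) (\<lambda>y. f y / ennreal (\<sigma> y))"
  shows "ennpowr (nested_partitions.dmax lebesgue (grid_label e) f x) (r - 1)
    \<le> ennreal A * nested_partitions.dmax (density lebesgue u) (grid_label e)
        (\<lambda>y. ennpowr (D y) (r - 1) / ennreal (u y)) x"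
proof -
  have um [measurable]: "u \<in> borel_measurable lebesgue" and pos: "\<And>x. 0 < u x"
    using u by (auto simp: muckenhoupt_def)
  have \<sigma>m [measurable]: "\<sigma> \<in> borel_measurable lebesgue" and \<sigma>pos: "\<And>x. 0 < \<sigma> x"
    using pos by (auto simp: \<sigma>_def less_le)
  have np: "nested_partitions lebesgue (grid_label e)"
    "nested_partitions (density lebesgue u) (grid_label e)"
    "nested_partitions (density lebesgue \<sigma>) (grid_label e)"
    by (intro nested_partitions_grid; simp)+
  have cells: "nested_partitions.cell (density lebesgue v) (grid_label e) k x = grid_cell e k x" for v k x
    by (simp add: nested_partitions.cell_def[OF nested_partitions_grid])
  have Dm [measurable]: "D \<in> borel_measurable lebesgue"
    using nested_partitions.dmax_measurable[OF np(3)] by (simp add: D_def)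
  let ?G = "\<lambda>y. ennpowr (D y) (r - 1) / ennreal (u y)"
  let ?R = "nested_partitions.dmax (density lebesgue u) (grid_label e) ?G x"
  have "nested_partitions.cell_avg lebesgue (grid_label e) f k x \<le> ennpowr (ennreal A * ?R) (1 / (r - 1))" for k
  proof -
    define C U S V I where "C = grid_cell e k x"
      and "U = (\<integral>\<^sup>+y\<in>C. ennreal (u y) \<partial>lebesgue)"
      and "S = (\<integral>\<^sup>+y\<in>C. ennreal (\<sigma> y) \<partial>lebesgue)"
      and "V = emeasure lebesgue C" and "I = (\<integral>\<^sup>+y\<in>C. f y \<partial>lebesgue)"
    have cell: "U * ennpowr S (r - 1) \<le> ennreal A * ennpowr V r"
      "U \<noteq> 0" "U \<noteq> top" "S \<noteq> 0" "S \<noteq> top" "V \<noteq> 0" "V \<noteq> top"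
      unfolding U_def S_def V_def C_def \<sigma>_def by (rule muckenhoupt_grid_cell[OF u r])+
    have Cm [measurable]: "C \<in> sets lebesgue"
      unfolding C_def by (intro nested_partitions.cell_sets nested_partitions_grid refl)
    have D_ge: "I / S \<le> D y" if "y \<in> C" for y
    proof -
      have eq: "nested_partitions.cell (density lebesgue \<sigma>) (grid_label e) k y = C"
        using that unfolding cells C_def by (auto simp: grid_cell_eq)
      have "(\<integral>\<^sup>+z\<in>C. f z / ennreal (\<sigma> z) \<partial>density lebesgue \<sigma>) = I"
        unfolding I_def using \<sigma>pos
        by (subst nn_integral_density)
          (auto intro!: nn_integral_cong simp: ennreal_mult_divide_cancel_real)
      moreover have "emeasure (density lebesgue \<sigma>) C = S"
        unfolding S_def by (simp add: emeasure_density)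
      ultimately have "nested_partitions.cell_avg (density lebesgue \<sigma>) (grid_label e)
          (\<lambda>y. f y / ennreal (\<sigma> y)) k y = I / S"
        unfolding nested_partitions.cell_avg_def[OF np(3)] eq by (simp only:)
      moreover have "nested_partitions.cell_avg (density lebesgue \<sigma>) (grid_label e)
          (\<lambda>y. f y / ennreal (\<sigma> y)) k y \<le> D y"
        unfolding D_def nested_partitions.dmax_def[OF np(3)] by (rule SUP_upper[OF UNIV_I])
      ultimately show ?thesis
        by (simp only:)
    qed
    have "ennpowr (I / S) (r - 1) * V / U \<le> ?R"
    proof -
      have "ennpowr (I / S) (r - 1) * V = (\<integral>\<^sup>+y. ennpowr (I / S) (r - 1) * indicator C y \<partial>lebesgue)"
        unfolding V_def by (simp only: nn_integral_cmult_indicator[OF Cm])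
      also have "\<dots> \<le> (\<integral>\<^sup>+y\<in>C. ennpowr (D y) (r - 1) \<partial>lebesgue)"
        using D_ge r by (intro nn_integral_mono) (auto intro!: ennpowr_mono split: split_indicator)
      also have "\<dots> = (\<integral>\<^sup>+y\<in>C. ?G y \<partial>density lebesgue u)"
        using pos by (subst nn_integral_density)
          (auto intro!: nn_integral_cong simp: ennreal_mult_divide_cancel_real)
      finally have "ennpowr (I / S) (r - 1) * V / U \<le> (\<integral>\<^sup>+y\<in>C. ?G y \<partial>density lebesgue u) / U"
        by (rule divide_right_mono_ennreal)
      also have "\<dots> = nested_partitions.cell_avg (density lebesgue u) (grid_label e) ?G k x"
        unfolding nested_partitions.cell_avg_def[OF np(2)] cells C_def[symmetric] U_def
        by (simp add: emeasure_density)
      also have "\<dots> \<le> ?R"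
        unfolding nested_partitions.dmax_def[OF np(2)] by (rule SUP_upper[OF UNIV_I])
      finally show ?thesis .
    qed
    moreover have "ennpowr (I / V) (r - 1) \<le> ennreal A * (ennpowr (I / S) (r - 1) * V / U)"
    proof -
      have "ennpowr S (r - 1) = ennpowr S (r - 1) * U / U"
        using cell by (simp add: ennreal_mult_divide_eq)
      also have "\<dots> \<le> ennreal A * ennpowr V r / U"
        using cell(1) by (intro divide_right_mono_ennreal) (simp add: mult.commute)
      also have "ennpowr V r = V * ennpowr V (r - 1)"
        using ennpowr_add[of V 1 "r - 1"] by simp
      finally have S: "ennpowr S (r - 1) \<le> ennreal A * (V * ennpowr V (r - 1)) / U" .
      have "I = I / S * S"
        using cell by (simp add: ennreal_divide_mult_cancel)
      then have "ennpowr (I / V) (r - 1) = ennpowr (I / S) (r - 1) * ennpowr S (r - 1) / ennpowr V (r - 1)"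
        using cell by (metis ennpowr_divide_finite ennpowr_mult)
      also have "\<dots> \<le> ennpowr (I / S) (r - 1) * (ennreal A * (V * ennpowr V (r - 1)) / U) / ennpowr V (r - 1)"
        by (intro divide_right_mono_ennreal mult_left_mono S) auto
      also have "\<dots> = ennreal A * (ennpowr (I / S) (r - 1) * V / U) * ennpowr V (r - 1) / ennpowr V (r - 1)"
        by (simp only: ennreal_times_divide ennreal_divide_times[symmetric] divide_ennreal_def mult_ac)
      also have "\<dots> = ennreal A * (ennpowr (I / S) (r - 1) * V / U)"
        using cell by (simp only: ennreal_mult_divide_eq ennpowr_eq_0_iff ennpowr_eq_top_iff not_False_eq_True)
      finally show ?thesis .
    qed
    ultimately have "ennpowr (I / V) (r - 1) \<le> ennreal A * ?R"
      by (meson mult_left_mono order_trans zero_le)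
    then have "I / V \<le> ennpowr (ennreal A * ?R) (1 / (r - 1))"
      using r by (simp only: ennpowr_le_iff_le)
    then show ?thesis
      unfolding nested_partitions.cell_avg_def[OF np(1)] I_def V_def C_def .
  qed
  then have "nested_partitions.dmax lebesgue (grid_label e) f x \<le> ennpowr (ennreal A * ?R) (1 / (r - 1))"
    unfolding nested_partitions.dmax_def[OF np(1)] by (rule SUP_least)
  then show ?thesis
    using r by (simp only: ennpowr_le_iff_le)
qed

text \<open>Buckley's bound for one grid. Raising the pointwise bound to the power r' = r/(r-1) and integrating
against u leaves a u-maximal function in L^(r')(u) and then a \<sigma>-maximal function in
L^r(\<sigma>); both are bounded with constants independent of the weight, and the identities
u^(1-r') = \<sigma> and \<sigma>^(1-r) = u return the norm of f in L^r(u).\<close>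

lemma grid_max_weighted_bound:
  fixes u :: "real ^ 'n \<Rightarrow> real"
  assumes u: "muckenhoupt r A u" and r: "1 < r" and f [measurable]: "f \<in> borel_measurable lebesgue"
  shows "(\<integral>\<^sup>+x. ennpowr (nested_partitions.dmax lebesgue (grid_label e) f x) r * ennreal (u x) \<partial>lebesgue)
    \<le> ennreal (doob_const (r / (r - 1)) * doob_const r * A powr (r / (r - 1)))
        * (\<integral>\<^sup>+x. ennpowr (f x) r * ennreal (u x) \<partial>lebesgue)"
proof -
  define \<sigma> where "\<sigma> x = u x powr (- 1 / (r - 1))" for x
  define D where "D = nested_partitions.dmax (density lebesgue \<sigma>) (grid_label e) (\<lambda>y. f y / ennreal (\<sigma> y))"
  define G where "G y = ennpowr (D y) (r - 1) / ennreal (u y)" for y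
  define r' where "r' = r / (r - 1)"
  let ?M = "nested_partitions.dmax lebesgue (grid_label e) f"
  let ?Mu = "nested_partitions.dmax (density lebesgue u) (grid_label e)"
  have r': "1 < r'" "(r - 1) * r' = r" "- 1 / (r - 1) = 1 - r'"
    using r by (auto simp: r'_def field_simps)
  have um [measurable]: "u \<in> borel_measurable lebesgue" and pos: "\<And>x. 0 < u x" and A: "0 < A"
    using u by (auto simp: muckenhoupt_def)
  have \<sigma>m [measurable]: "\<sigma> \<in> borel_measurable lebesgue"
    unfolding \<sigma>_def[abs_def] by measurable
  have \<sigma>pos: "\<And>x. 0 < \<sigma> x"
    using pos by (simp add: \<sigma>_def less_le)
  have np: "nested_partitions lebesgue (grid_label e)"
    "nested_partitions (density lebesgue u) (grid_label e)"
    "nested_partitions (density lebesgue \<sigma>) (grid_label e)"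
    by (intro nested_partitions_grid; simp)+
  have Dm [measurable]: "D \<in> borel_measurable lebesgue"
    using nested_partitions.dmax_measurable[OF np(3)] by (simp add: D_def)
  have Mm [measurable]: "?M \<in> borel_measurable lebesgue"
    by (rule nested_partitions.dmax_measurable[OF np(1)])
  have Mum [measurable]: "?Mu g \<in> borel_measurable lebesgue" for g
    using nested_partitions.dmax_measurable[OF np(2)] by simp
  have Gm [measurable]: "G \<in> borel_measurable lebesgue"
    unfolding G_def by measurable
  have "(\<integral>\<^sup>+x. ennpowr (?M x) r * ennreal (u x) \<partial>lebesgue)
      \<le> (\<integral>\<^sup>+x. ennreal (A powr r') * (ennreal (u x) * ennpowr (?Mu G x) r') \<partial>lebesgue)"
  proof (intro nn_integral_mono)
    fix x
    have "ennpowr (?M x) (r - 1) \<le> ennreal A * ?Mu G x"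
      using grid_max_pointwise[OF u r f, of e x] unfolding G_def D_def \<sigma>_def .
    then have "ennpowr (ennpowr (?M x) (r - 1)) r' \<le> ennpowr (ennreal A * ?Mu G x) r'"
      using r' by (intro ennpowr_mono) auto
    then have "ennpowr (?M x) r \<le> ennreal (A powr r') * ennpowr (?Mu G x) r'"
      using A by (simp add: ennpowr_ennpowr r' ennpowr_mult ennpowr_ennreal)
    then have "ennpowr (?M x) r * ennreal (u x) \<le> ennreal (A powr r') * ennpowr (?Mu G x) r' * ennreal (u x)"
      by (rule mult_right_mono) simp
    then show "ennpowr (?M x) r * ennreal (u x) \<le> ennreal (A powr r') * (ennreal (u x) * ennpowr (?Mu G x) r')"
      by (simp only: mult_ac)
  qed
  also have "\<dots> = ennreal (A powr r') * (\<integral>\<^sup>+x. ennpowr (?Mu G x) r' \<partial>density lebesgue u)"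
    by (simp add: nn_integral_cmult nn_integral_density)
  also have "\<dots> \<le> ennreal (A powr r') * (ennreal (doob_const r') * (\<integral>\<^sup>+x. ennpowr (G x) r' \<partial>density lebesgue u))"
    unfolding doob_const_def
    by (intro mult_left_mono nested_partitions.dmax_strong_type[OF np(2)] r') auto
  also have "(\<integral>\<^sup>+x. ennpowr (G x) r' \<partial>density lebesgue u) = (\<integral>\<^sup>+x. ennpowr (D x) r \<partial>density lebesgue \<sigma>)"
  proof -
    have "ennreal (u x) * ennpowr (G x) r' = ennreal (\<sigma> x) * ennpowr (D x) r" for x
    proof -
      have "ennpowr (G x) r' = ennpowr (D x) r / ennreal (u x powr r')"
        unfolding G_def using pos[of x] less_imp_le[OF pos[of x]]
        by (subst ennpowr_divide_finite) (auto simp: ennpowr_ennpowr r' ennpowr_ennreal)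
      moreover have "ennreal (u x) / ennreal (u x powr r') = ennreal (\<sigma> x)"
      proof -
        have "u x / u x powr r' = \<sigma> x"
          unfolding \<sigma>_def r'(3) using pos[of x] by (simp add: powr_diff)
        then show ?thesis
          using pos[of x] less_imp_le[OF pos[of x]] by (subst divide_ennreal) auto
      qed
      ultimately show ?thesis
        by (metis ennreal_times_divide mult.commute)
    qed
    then show ?thesis
      by (simp add: nn_integral_density)
  qed
  also have "\<dots> \<le> ennreal (doob_const r) * (\<integral>\<^sup>+x. ennpowr (f x / ennreal (\<sigma> x)) r \<partial>density lebesgue \<sigma>)"
    unfolding doob_const_def D_def
    by (intro nested_partitions.dmax_strong_type[OF np(3)] r) auto
  also have "(\<integral>\<^sup>+x. ennpowr (f x / ennreal (\<sigma> x)) r \<partial>density lebesgue \<sigma>)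
      = (\<integral>\<^sup>+x. ennpowr (f x) r * ennreal (u x) \<partial>lebesgue)"
  proof -
    have "ennreal (\<sigma> x) * ennpowr (f x / ennreal (\<sigma> x)) r = ennpowr (f x) r * ennreal (u x)" for x
    proof -
      have "ennpowr (f x / ennreal (\<sigma> x)) r = ennpowr (f x) r / ennreal (\<sigma> x powr r)"
        using \<sigma>pos[of x] less_imp_le[OF \<sigma>pos[of x]]
        by (subst ennpowr_divide_finite) (auto simp: ennpowr_ennreal)
      moreover have "ennreal (\<sigma> x) / ennreal (\<sigma> x powr r) = ennreal (u x)"
      proof -
        have "\<sigma> x / \<sigma> x powr r = \<sigma> x powr (1 - r)"
          using \<sigma>pos[of x] by (simp add: powr_diff)
        also have "\<dots> = u x"
        proof -
          have "- 1 / (r - 1) * (1 - r) = 1"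
            using r by (simp add: field_simps)
          then show ?thesis
            unfolding \<sigma>_def powr_powr using pos[of x] by (simp only: powr_one less_imp_le)
        qed
        finally show ?thesis
          using \<sigma>pos[of x] less_imp_le[OF \<sigma>pos[of x]] by (subst divide_ennreal) auto
      qed
      ultimately show ?thesis
        by (metis ennreal_times_divide mult.commute)
    qed
    then show ?thesis
      by (simp add: nn_integral_density)
  qed
  finally have "(\<integral>\<^sup>+x. ennpowr (?M x) r * ennreal (u x) \<partial>lebesgue) \<le>
      ennreal (A powr r') * (ennreal (doob_const r') * (ennreal (doob_const r) *
        (\<integral>\<^sup>+x. ennpowr (f x) r * ennreal (u x) \<partial>lebesgue)))"
    by (meson mult_left_mono order_trans zero_le)
  also have "\<dots> = ennreal (doob_const r' * doob_const r * A powr r')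
        * (\<integral>\<^sup>+x. ennpowr (f x) r * ennreal (u x) \<partial>lebesgue)"
    using doob_const_pos[OF r] doob_const_pos[OF r'(1)] by (simp add: ennreal_mult mult_ac)
  finally show ?thesis
    by (simp only: r'_def)
qed

lemma cube_max_weighted_bound:
  fixes u :: "real ^ 'n \<Rightarrow> real"
  assumes u: "muckenhoupt r A u" and r: "1 < r" and f [measurable]: "f \<in> borel_measurable lebesgue"
  shows "(\<integral>\<^sup>+x. ennpowr (cube_max f x) r * ennreal (u x) \<partial>lebesgue)
    \<le> ennreal (2 ^ CARD('n) * (doob_const (r / (r - 1)) * doob_const r * A powr (r / (r - 1))))
        * (\<integral>\<^sup>+x. ennpowr (f x) r * ennreal (u x) \<partial>lebesgue)"
proof -
  let ?M = "\<lambda>e. nested_partitions.dmax lebesgue (grid_label e) f"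
  let ?K = "doob_const (r / (r - 1)) * doob_const r * A powr (r / (r - 1))"
  let ?J = "\<integral>\<^sup>+x. ennpowr (f x) r * ennreal (u x) \<partial>lebesgue"
  have um [measurable]: "u \<in> borel_measurable lebesgue"
    using u by (auto simp: muckenhoupt_def)
  have Mm [measurable]: "?M e \<in> borel_measurable lebesgue" for e
    by (rule nested_partitions.dmax_measurable[OF nested_partitions_grid[OF refl]])
  have K: "0 \<le> ?K"
    using r by (intro mult_nonneg_nonneg less_imp_le[OF doob_const_pos]) auto
  have "ennpowr (cube_max f x) r \<le> (\<Sum>e\<in>UNIV. ennpowr (?M e x) r)" for x
  proof -
    have "?M e x \<le> ennpowr (\<Sum>e\<in>UNIV. ennpowr (?M e x) r) (1 / r)" for e
    proof -
      have "ennpowr (?M e x) r \<le> (\<Sum>e\<in>UNIV. ennpowr (?M e x) r)"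
        by (rule member_le_sum) auto
      then show ?thesis
        using r by (simp add: ennpowr_le_iff_le)
    qed
    then have "cube_max f x \<le> ennpowr (\<Sum>e\<in>UNIV. ennpowr (?M e x) r) (1 / r)"
      unfolding cube_max_def by (rule SUP_least)
    then show ?thesis
      using r by (simp add: ennpowr_le_iff_le)
  qed
  then have "(\<integral>\<^sup>+x. ennpowr (cube_max f x) r * ennreal (u x) \<partial>lebesgue)
      \<le> (\<integral>\<^sup>+x. (\<Sum>e\<in>UNIV. ennpowr (?M e x) r * ennreal (u x)) \<partial>lebesgue)"
    unfolding sum_distrib_right[symmetric] by (intro nn_integral_mono mult_right_mono) auto
  also have "\<dots> = (\<Sum>e\<in>UNIV. \<integral>\<^sup>+x. ennpowr (?M e x) r * ennreal (u x) \<partial>lebesgue)"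
    by (intro nn_integral_sum) measurable
  also have "\<dots> \<le> (\<Sum>e\<in>(UNIV :: ('n \<Rightarrow> bool) set). ennreal ?K * ?J)"
    by (intro sum_mono grid_max_weighted_bound u r f)
  also have "\<dots> = of_nat (2 ^ CARD('n)) * (ennreal ?K * ?J)"
    by (simp add: card_fun)
  also have "of_nat (2 ^ CARD('n)) = ennreal (2 ^ CARD('n))"
    by (simp add: ennreal_of_nat_eq_real_of_nat)
  also have "ennreal (2 ^ CARD('n)) * (ennreal ?K * ?J) = ennreal (2 ^ CARD('n) * ?K) * ?J"
    using K by (subst ennreal_mult) (simp_all only: mult.assoc zero_le_power zero_le_numeral)
  finally show ?thesis .
qed

section \<open>The Rubio de Francia algorithm\<close>

text \<open>The class A_1 with a prescribed bound for the constant; the essential infimum is expressed by an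
almost everywhere inequality.\<close>

definition A1_weight :: "real \<Rightarrow> (real ^ 'n \<Rightarrow> real) \<Rightarrow> bool" where
  "A1_weight B H \<longleftrightarrow> H \<in> borel_measurable lebesgue \<and> (\<forall>x. 0 < H x) \<and> 0 < B \<and>
     (\<forall>Q\<in>cubes. AE x in lebesgue. x \<in> Q \<longrightarrow> average Q (\<lambda>x. ennreal (H x)) \<le> ennreal (B * H x))"

lemma cubes_sets [measurable]: "Q \<in> cubes \<Longrightarrow> Q \<in> sets lebesgue"
  by (auto simp: cubes_def)

lemma average_eq_0D:
  fixes Q :: "(real ^ 'n) set"
  assumes [measurable]: "g \<in> borel_measurable lebesgue" and Q: "Q \<in> cubes" and 0: "average Q g = 0"
  shows "AE x in lebesgue. x \<in> Q \<longrightarrow> g x = 0"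
proof -
  note cubes_sets[OF Q, measurable]
  have "(\<integral>\<^sup>+x\<in>Q. g x \<partial>lebesgue) = 0"
    using 0 emeasure_cube_pos_finite[OF Q] by (simp add: average_def)
  then have "AE x in lebesgue. g x * indicator Q x = 0"
    by (subst (asm) nn_integral_0_iff_AE) auto
  then show ?thesis
    by (rule AE_mp) (auto intro!: AE_I2 split: split_indicator_asm)
qed

text \<open>The cubes around a point exhaust the space.\<close>

lemma AE_of_AE_on_cubes:
  fixes x :: "real ^ 'n"
  assumes "\<And>Q. Q \<in> cubes \<Longrightarrow> x \<in> Q \<Longrightarrow> AE y in lebesgue. y \<in> Q \<longrightarrow> P y"
  shows "AE y in lebesgue. P y"
proof -
  define Q where "Q m = cbox (\<chi> i. x $ i - real (Suc m)) (\<chi> i. (\<chi> i. x $ i - real (Suc m)) $ i + 2 * real (Suc m))" for m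
  have "AE y in lebesgue. y \<in> Q m \<longrightarrow> P y" for m
  proof (rule assms)
    show "Q m \<in> cubes"
      unfolding cubes_def Q_def mem_Collect_eq
      by (intro exI[of _ "\<chi> i. x $ i - real (Suc m)"] exI[of _ "2 * real (Suc m)"] conjI refl) auto
    show "x \<in> Q m"
      by (simp add: Q_def mem_box_cart)
  qed
  then have "AE y in lebesgue. \<forall>m. y \<in> Q m \<longrightarrow> P y"
    unfolding AE_all_countable by blast
  then show ?thesis
  proof (rule AE_mp, intro AE_I2 impI)
    fix y assume y: "\<forall>m. y \<in> Q m \<longrightarrow> P y"
    obtain m where m: "norm (y - x) \<le> real m"
      using real_arch_simple by blast
    have "y \<in> Q m"
      unfolding Q_def mem_box_cart
    proof
      fix i
      have "\<bar>(y - x) $ i\<bar> \<le> real m"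
        using component_le_norm_cart[of "y - x" i] m by (rule order_trans)
      then show "(\<chi> i. x $ i - real (Suc m)) $ i \<le> y $ i \<and>
          y $ i \<le> (\<chi> i. (\<chi> i. x $ i - real (Suc m)) $ i + 2 * real (Suc m)) $ i"
        by simp linarith
    qed
    then show "P y" using y by blast
  qed
qed

text \<open>The factor 6^n compares averages over cubes with the maximal operator, the factor 2 is lost in the
geometric series, and the last factor is the constant of Buckley's bound on the norm of the maximal
operator.\<close>

definition rdf_const :: "nat \<Rightarrow> real \<Rightarrow> real" where
  "rdf_const n s = 6 ^ n * 2 * (2 ^ n * (doob_const (s / (s - 1)) * doob_const s)) powr (1 / s)"

lemma rdf_const_pos: "1 < s \<Longrightarrow> 0 < rdf_const n s"
  using doob_const_pos[of s] doob_const_pos[of "s / (s - 1)"] by (simp add: rdf_const_def)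

text \<open>With N the bound for the maximal operator on L^s(v), the function
H_0 = \<Sum>_k 2^(-k-1) N^(-k) M^k h satisfies M H_0 \<le> 2 N H_0 because M shifts the series by
one term, and its norm is at most that of h by Jensen's inequality. The first term of the series is
h/2, so 2 H_0 dominates h.\<close>

theorem rubio_de_francia:
  fixes v :: "real ^ 'n \<Rightarrow> real"
  assumes s: "1 < s" and v: "muckenhoupt s B v" and h [measurable]: "h \<in> borel_measurable lebesgue"
    and ne: "(\<integral>\<^sup>+x. ennpowr (h x) s * ennreal (v x) \<partial>lebesgue) \<noteq> 0"
    and fin: "(\<integral>\<^sup>+x. ennpowr (h x) s * ennreal (v x) \<partial>lebesgue) \<noteq> top"
  obtains H where "A1_weight (rdf_const CARD('n) s * B powr (1 / (s - 1))) H"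
    "AE x in lebesgue. h x \<le> ennreal (H x)"
    "(\<integral>\<^sup>+x. ennpowr (ennreal (H x)) s * ennreal (v x) \<partial>lebesgue)
       \<le> ennreal (2 powr s) * (\<integral>\<^sup>+x. ennpowr (h x) s * ennreal (v x) \<partial>lebesgue)"
proof -
  define K where "K = 2 ^ CARD('n) * (doob_const (s / (s - 1)) * doob_const s)"
  have "1 < s / (s - 1)"
    using s by simp
  then have K: "0 < K"
    unfolding K_def using s by (simp add: doob_const_pos)
  define L where "L = rdf_const CARD('n) s"
  have L_def': "L = 6 ^ CARD('n) * 2 * K powr (1 / s)"
    by (simp add: L_def rdf_const_def K_def)
  define J where "J g = (\<integral>\<^sup>+x. ennpowr (g x) s * ennreal (v x) \<partial>lebesgue)" for g :: "real ^ 'n \<Rightarrow> ennreal"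
  have vm [measurable]: "v \<in> borel_measurable lebesgue" and vpos: "\<And>x. 0 < v x" and B: "0 < B"
    using v by (auto simp: muckenhoupt_def)
  \<comment> \<open>Buckley's bound for the norm of the maximal operator on L^s(v)\<close>
  define N where "N = K powr (1 / s) * B powr (1 / (s - 1))"
  have N: "0 < N" using K B by (simp add: N_def)
  have Ns: "N powr s = K * B powr (s / (s - 1))"
    using K B s by (simp add: N_def powr_mult powr_powr)
  define F where "F k = (cube_max ^^ k) h" for k
  have Fm [measurable]: "F k \<in> borel_measurable lebesgue" for k
    by (induction k) (simp_all add: F_def)
  have F: "J (F k) \<le> ennreal ((N powr s) ^ k) * J h" for k
  proof (induction k)
    case (Suc k)
    have "J (F (Suc k)) \<le> ennreal (N powr s) * J (F k)"
      using cube_max_weighted_bound[OF v s Fm[of k]]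
      by (simp add: J_def F_def Ns K_def mult.assoc)
    also have "\<dots> \<le> ennreal (N powr s) * (ennreal ((N powr s) ^ k) * J h)"
      by (intro mult_left_mono Suc) auto
    also have "\<dots> = ennreal ((N powr s) ^ Suc k) * J h"
      by (simp add: ennreal_mult mult.assoc)
    finally show ?case .
  qed (simp add: F_def)
  define c where "c k = ennreal ((1/2) ^ Suc k)" for k :: nat
  define d where "d k = ennreal (1 / N ^ k)" for k :: nat
  have c: "suminf c = 1"
  proof -
    have "suminf c = ennreal 1"
      unfolding c_def[abs_def] by (rule suminf_ennreal_eq[OF _ power_half_series]) simp
    then show ?thesis by simp
  qed
  define H0 where "H0 x = (\<Sum>k. c k * (d k * F k x))" for x
  have H0m [measurable]: "H0 \<in> borel_measurable lebesgue"
    unfolding H0_def[abs_def] by measurable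
  have J_H0: "J H0 \<le> J h"
  proof -
    have "J H0 \<le> (\<integral>\<^sup>+x. (\<Sum>k. c k * ennpowr (d k * F k x) s * ennreal (v x)) \<partial>lebesgue)"
      unfolding J_def H0_def ennreal_suminf_multc
      by (intro nn_integral_mono mult_right_mono ennpowr_suminf_convex s c) auto
    also have "\<dots> = (\<Sum>k. \<integral>\<^sup>+x. c k * ennpowr (d k * F k x) s * ennreal (v x) \<partial>lebesgue)"
      by (intro nn_integral_suminf) measurable
    also have "\<dots> = (\<Sum>k. c k * (ennpowr (d k) s * J (F k)))"
      unfolding J_def ennpowr_mult by (simp add: nn_integral_cmult mult.assoc)
    also have "\<dots> \<le> (\<Sum>k. c k * J h)"
    proof (intro suminf_le mult_left_mono)
      fix k
      have "ennpowr (d k) s * J (F k) \<le> ennpowr (d k) s * (ennreal ((N powr s) ^ k) * J h)"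
        by (intro mult_left_mono F) auto
      also have "\<dots> = ennreal ((1 / N ^ k) powr s * (N powr s) ^ k) * J h"
        using N by (simp add: d_def ennpowr_ennreal mult.assoc ennreal_mult)
      also have "(1 / N ^ k) powr s * (N powr s) ^ k = 1"
      proof -
        have "(N ^ k) powr s = (N powr s) ^ k"
          using N by (simp add: powr_realpow[symmetric] powr_powr mult.commute)
        then show ?thesis
          using N by (simp add: powr_divide)
      qed
      finally show "ennpowr (d k) s * J (F k) \<le> J h" by simp
    qed auto
    also have "\<dots> = J h"
      by (simp only: ennreal_suminf_multc c mult_1)
    finally show ?thesis .
  qed
  have h_le: "h x \<le> 2 * H0 x" for x
  proof -
    have "c 0 * (d 0 * F 0 x) \<le> H0 x"
      unfolding H0_def by (rule ennreal_le_suminf)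
    then have "2 * (ennreal (1/2) * h x) \<le> 2 * H0 x"
      by (intro mult_left_mono) (simp_all add: c_def d_def F_def)
    moreover have "2 * (ennreal (1/2) * h x) = h x"
    proof -
      have "2 * ennreal (1/2) = 1"
        by (subst numeral_mult_ennreal) auto
      then show ?thesis
        by (simp only: mult.assoc[symmetric] mult_1)
    qed
    ultimately show ?thesis by simp
  qed
  have max_le: "cube_max H0 x \<le> ennreal (2 * N) * H0 x" for x
  proof -
    have "cube_max H0 x = cube_max (\<lambda>x. \<Sum>k. (c k * d k) * F k x) x"
      by (simp add: H0_def[abs_def] mult.assoc)
    also have "\<dots> \<le> (\<Sum>k. (c k * d k) * cube_max (F k) x)"
      by (rule cube_max_suminf_le) measurable
    also have "\<dots> = (\<Sum>k. ennreal (2 * N) * (c (Suc k) * (d (Suc k) * F (Suc k) x)))"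
    proof (rule suminf_cong)
      fix k
      have "c k * d k = ennreal (2 * N) * c (Suc k) * d (Suc k)"
        unfolding c_def d_def using N by (simp flip: ennreal_mult)
      then show "(c k * d k) * cube_max (F k) x = ennreal (2 * N) * (c (Suc k) * (d (Suc k) * F (Suc k) x))"
        by (simp add: F_def mult.assoc)
    qed
    also have "\<dots> = ennreal (2 * N) * (\<Sum>k. c (Suc k) * (d (Suc k) * F (Suc k) x))"
      by (rule ennreal_suminf_cmult)
    also have "\<dots> \<le> ennreal (2 * N) * H0 x"
    proof (intro mult_left_mono)
      have "(\<Sum>k. c (k + 1) * (d (k + 1) * F (k + 1) x)) \<le> H0 x"
        unfolding H0_def
        by (subst (2) suminf_offset[where i = 1]) auto
      then show "(\<Sum>k. c (Suc k) * (d (Suc k) * F (Suc k) x)) \<le> H0 x" by simp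
    qed auto
    finally show ?thesis .
  qed
  have avg_le: "average Q H0 \<le> ennreal (6 ^ CARD('n) * (2 * N)) * H0 x" if "Q \<in> cubes" "x \<in> Q" for Q x
  proof -
    have "average Q H0 \<le> 6 ^ CARD('n) * cube_max H0 x"
      by (rule average_le_cube_max[OF that])
    also have "\<dots> \<le> 6 ^ CARD('n) * (ennreal (2 * N) * H0 x)"
      by (intro mult_left_mono max_le) auto
    also have "6 ^ CARD('n) * (ennreal (2 * N) * H0 x) = ennreal (6 ^ CARD('n)) * ennreal (2 * N) * H0 x"
      by (simp add: mult.assoc ennreal_power[symmetric])
    also have "ennreal (6 ^ CARD('n)) * ennreal (2 * N) = ennreal (6 ^ CARD('n) * (2 * N))"
      using N by (intro ennreal_mult[symmetric]) auto
    finally show ?thesis .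
  qed
  have H0_pos: "H0 x \<noteq> 0" for x
  proof
    assume 0: "H0 x = 0"
    have "AE y in lebesgue. H0 y = 0"
    proof (rule AE_of_AE_on_cubes)
      fix Q assume "Q \<in> cubes" "x \<in> Q"
      then show "AE y in lebesgue. y \<in> Q \<longrightarrow> H0 y = 0"
        using avg_le[of Q x] 0 by (intro average_eq_0D) auto
    qed
    then have "AE y in lebesgue. ennpowr (h y) s * ennreal (v y) = 0"
    proof (rule AE_mp, intro AE_I2 impI)
      fix y assume "H0 y = 0"
      then have "h y = 0" using h_le[of y] by simp
      then show "ennpowr (h y) s * ennreal (v y) = 0" by simp
    qed
    then have "(\<integral>\<^sup>+x. ennpowr (h x) s * ennreal (v x) \<partial>lebesgue) = 0"
      by (subst nn_integral_0_iff_AE) auto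
    then show False using ne by simp
  qed
  have H0_fin: "AE x in lebesgue. H0 x \<noteq> top"
  proof -
    have "J H0 \<noteq> top"
      using J_H0 fin by (auto simp: J_def top_unique)
    then have "AE x in lebesgue. ennpowr (H0 x) s * ennreal (v x) \<noteq> \<infinity>"
      unfolding J_def by (intro nn_integral_PInf_AE) auto
    then show ?thesis
    proof (rule AE_mp, intro AE_I2 impI)
      fix x assume "ennpowr (H0 x) s * ennreal (v x) \<noteq> \<infinity>"
      then show "H0 x \<noteq> top"
        using vpos[of x] by (auto simp: ennreal_top_mult)
    qed
  qed
  \<comment> \<open>the value 1 on the null set where the series diverges only serves to keep H real and positive\<close>
  define H where "H x = (if H0 x = top then 1 else 2 * enn2real (H0 x))" for x
  have Hm [measurable]: "H \<in> borel_measurable lebesgue"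
    unfolding H_def[abs_def] by measurable
  have Hpos: "0 < H x" for x
    using H0_pos[of x] by (auto simp: H_def enn2real_positive_iff less_top zero_less_iff_neq_zero)
  have H_eq: "ennreal (H x) = 2 * H0 x" if "H0 x \<noteq> top" for x
    using that by (simp add: H_def less_top numeral_mult_ennreal[symmetric])
  have H_AE: "AE x in lebesgue. ennreal (H x) = 2 * H0 x"
    using H0_fin by (rule AE_mp) (intro AE_I2 impI H_eq)
  have "A1_weight (L * B powr (1 / (s - 1))) H"
    unfolding A1_weight_def
  proof (intro conjI ballI allI Hpos Hm)
    show "0 < L * B powr (1 / (s - 1))"
      using K B by (simp add: L_def')
    fix Q :: "(real ^ 'n) set" assume Q: "Q \<in> cubes"
    note cubes_sets[OF Q, measurable]
    have "(\<integral>\<^sup>+x\<in>Q. ennreal (H x) \<partial>lebesgue) = (\<integral>\<^sup>+x. 2 * (H0 x * indicator Q x) \<partial>lebesgue)"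
      using H_AE by (intro nn_integral_cong_AE) (auto simp: mult.assoc)
    also have "\<dots> = 2 * (\<integral>\<^sup>+x\<in>Q. H0 x \<partial>lebesgue)"
      by (intro nn_integral_cmult) measurable
    finally have avg: "average Q (\<lambda>x. ennreal (H x)) = 2 * average Q H0"
      by (simp only: average_def ennreal_times_divide)
    show "AE x in lebesgue. x \<in> Q \<longrightarrow> average Q (\<lambda>x. ennreal (H x)) \<le> ennreal (L * B powr (1 / (s - 1)) * H x)"
      using H_AE
    proof (rule AE_mp, intro AE_I2 impI)
      fix x assume x: "x \<in> Q" and H: "ennreal (H x) = 2 * H0 x"
      have "average Q (\<lambda>x. ennreal (H x)) \<le> 2 * (ennreal (6 ^ CARD('n) * (2 * N)) * H0 x)"
        unfolding avg by (intro mult_left_mono avg_le Q x) auto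
      also have "\<dots> = ennreal (6 ^ CARD('n) * (2 * N)) * ennreal (H x)"
        unfolding H by (simp only: mult_ac)
      also have "\<dots> = ennreal (L * B powr (1 / (s - 1)) * H x)"
        using N Hpos[of x] by (subst ennreal_mult[symmetric]) (auto simp: L_def' N_def mult_ac)
      finally show "average Q (\<lambda>x. ennreal (H x)) \<le> ennreal (L * B powr (1 / (s - 1)) * H x)" .
    qed
  qed
  moreover have "AE x in lebesgue. h x \<le> ennreal (H x)"
    using H_AE by (rule AE_mp) (intro AE_I2 impI, simp add: h_le)
  moreover have "J (\<lambda>x. ennreal (H x)) \<le> ennreal (2 powr s) * J h"
  proof -
    have "J (\<lambda>x. ennreal (H x)) = (\<integral>\<^sup>+x. ennreal (2 powr s) * (ennpowr (H0 x) s * ennreal (v x)) \<partial>lebesgue)"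
      unfolding J_def using H_AE
    proof (intro nn_integral_cong_AE, elim AE_mp, intro AE_I2 impI)
      fix x assume H: "ennreal (H x) = 2 * H0 x"
      have "ennpowr 2 s = ennreal (2 powr s)"
        using ennpowr_ennreal[of 2 s] by simp
      then show "ennpowr (ennreal (H x)) s * ennreal (v x) = ennreal (2 powr s) * (ennpowr (H0 x) s * ennreal (v x))"
        unfolding H ennpowr_mult by (simp only: mult.assoc)
    qed
    also have "\<dots> = ennreal (2 powr s) * J H0"
      unfolding J_def by (intro nn_integral_cmult) measurable
    also have "\<dots> \<le> ennreal (2 powr s) * J h"
      by (intro mult_left_mono J_H0) auto
    finally show ?thesis .
  qed
  ultimately show ?thesis
    unfolding J_def L_def by (rule that)
qed

section \<open>Construction of weights\<close>

lemma average_mono_AE: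
  assumes "AE x in lebesgue. x \<in> Q \<longrightarrow> f x \<le> g x"
  shows "average Q f \<le> average Q g"
  unfolding average_def
proof (intro divide_right_mono_ennreal nn_integral_mono_AE)
  show "AE x in lebesgue. f x * indicator Q x \<le> g x * indicator Q x"
    using assms by (rule AE_mp) (auto intro!: AE_I2 split: split_indicator)
qed

lemma average_cong_AE:
  assumes "AE x in lebesgue. f x = g x"
  shows "average Q f = average Q g"
  by (intro antisym average_mono_AE; rule AE_mp[OF assms]; simp)

lemma average_cmult:
  assumes [measurable]: "f \<in> borel_measurable lebesgue" and Q: "Q \<in> cubes"
  shows "average Q (\<lambda>x. c * f x) = c * average Q f"
proof -
  note cubes_sets[OF Q, measurable]
  have "(\<integral>\<^sup>+x\<in>Q. c * f x \<partial>lebesgue) = c * (\<integral>\<^sup>+x\<in>Q. f x \<partial>lebesgue)"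
    unfolding mult.assoc by (intro nn_integral_cmult) measurable
  then show ?thesis
    by (simp only: average_def ennreal_times_divide)
qed

lemma average_ne_0:
  assumes [measurable]: "g \<in> borel_measurable lebesgue" and "\<And>x. 0 < g x" and Q: "Q \<in> cubes"
  shows "average Q g \<noteq> 0"
proof -
  note cubes_sets[OF Q, measurable]
  have "(\<integral>\<^sup>+x\<in>Q. g x \<partial>lebesgue) \<noteq> 0"
    using assms by (intro nn_integral_pos_on emeasure_cube_pos_finite) auto
  then show ?thesis
    using emeasure_cube_pos_finite[OF Q] by (simp add: average_def)
qed

text \<open>The measure of the cube cancels because the two exponents add up to 1.\<close>

lemma average_Holder:
  assumes [measurable]: "F \<in> borel_measurable lebesgue" "G \<in> borel_measurable lebesgue"
    and Q: "Q \<in> cubes" and a: "0 < a" "a < 1"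
  shows "average Q (\<lambda>x. ennpowr (F x) a * ennpowr (G x) (1 - a))
    \<le> ennpowr (average Q F) a * ennpowr (average Q G) (1 - a)"
proof -
  note cubes_sets[OF Q, measurable]
  note V = emeasure_cube_pos_finite[OF Q]
  let ?V = "emeasure lebesgue Q" and ?I = "\<lambda>F. \<integral>\<^sup>+x\<in>Q. F x \<partial>lebesgue"
  have "?I (\<lambda>x. ennpowr (F x) a * ennpowr (G x) (1 - a))
      = (\<integral>\<^sup>+x. ennpowr (F x * indicator Q x) a * ennpowr (G x * indicator Q x) (1 - a) \<partial>lebesgue)"
    by (intro nn_integral_cong) (auto split: split_indicator)
  also have "\<dots> \<le> ennpowr (?I F) a * ennpowr (?I G) (1 - a)"
    by (intro nn_integral_Holder a) measurable
  also have "?I F = average Q F * ?V"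
    using V by (simp only: average_def ennreal_divide_mult_cancel not_False_eq_True)
  also have "?I G = average Q G * ?V"
    using V by (simp only: average_def ennreal_divide_mult_cancel not_False_eq_True)
  also have "ennpowr (average Q F * ?V) a * ennpowr (average Q G * ?V) (1 - a)
      = ennpowr (average Q F) a * ennpowr (average Q G) (1 - a) * (ennpowr ?V a * ennpowr ?V (1 - a))"
    by (simp only: ennpowr_mult mult_ac)
  also have "ennpowr ?V a * ennpowr ?V (1 - a) = ?V"
    using ennpowr_add[of ?V a "1 - a", symmetric] by simp
  finally have "average Q (\<lambda>x. ennpowr (F x) a * ennpowr (G x) (1 - a))
      \<le> ennpowr (average Q F) a * ennpowr (average Q G) (1 - a) * ?V / ?V"
    unfolding average_def by (rule divide_right_mono_ennreal)
  also have "\<dots> = ennpowr (average Q F) a * ennpowr (average Q G) (1 - a)"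
    using V by (intro ennreal_mult_divide_eq)
  finally show ?thesis .
qed

text \<open>The two factors of the A_r condition exchange their roles.\<close>

lemma muckenhoupt_dual:
  assumes u: "muckenhoupt r A u" and r: "1 < r"
  shows "muckenhoupt (r / (r - 1)) (A powr (1 / (r - 1))) (\<lambda>x. u x powr (- 1 / (r - 1)))"
  unfolding muckenhoupt_def
proof (intro conjI ballI allI)
  have um [measurable]: "u \<in> borel_measurable lebesgue" and pos: "\<And>x. 0 < u x" and A: "0 < A"
    using u by (auto simp: muckenhoupt_def)
  show "(\<lambda>x. u x powr (- 1 / (r - 1))) \<in> borel_measurable lebesgue" by measurable
  show "0 < u x powr (- 1 / (r - 1))" for x using pos[of x] by simp
  show "0 < A powr (1 / (r - 1))" using A by simp
  fix Q :: "(real ^ 'a) set" assume Q: "Q \<in> cubes"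
  let ?u = "average Q (\<lambda>x. ennreal (u x))" and ?s = "average Q (\<lambda>x. ennreal (u x powr (- 1 / (r - 1))))"
  have e: "r / (r - 1) - 1 = 1 / (r - 1)" "- 1 / (r - 1) * (- 1 / (1 / (r - 1))) = 1"
    using r by (auto simp: field_simps)
  have dual: "(u x powr (- 1 / (r - 1))) powr (- 1 / (1 / (r - 1))) = u x" for x
    unfolding powr_powr e(2) using pos[of x] by simp
  have "?u * ennpowr ?s (r - 1) \<le> ennreal A"
    using u Q unfolding muckenhoupt_def by blast
  then have "ennpowr (?u * ennpowr ?s (r - 1)) (1 / (r - 1)) \<le> ennpowr (ennreal A) (1 / (r - 1))"
    using r by (intro ennpowr_mono) auto
  also have "ennpowr (?u * ennpowr ?s (r - 1)) (1 / (r - 1)) = ?s * ennpowr ?u (1 / (r - 1))"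
    using r by (simp add: ennpowr_mult ennpowr_ennpowr mult.commute)
  finally show "?s * ennpowr (average Q (\<lambda>x. ennreal ((u x powr (- 1 / (r - 1))) powr (- 1 / (r / (r - 1) - 1)))))
      (r / (r - 1) - 1) \<le> ennreal (A powr (1 / (r - 1)))"
    unfolding e(1) dual using A by (simp only: ennpowr_ennreal less_imp_le)
qed

lemma A1_weight_average:
  assumes H: "A1_weight B H" and Q: "Q \<in> cubes"
  obtains t where "0 < t" "average Q (\<lambda>x. ennreal (H x)) = ennreal t"
    "AE x in lebesgue. x \<in> Q \<longrightarrow> t / B \<le> H x"
proof -
  let ?X = "average Q (\<lambda>x. ennreal (H x))"
  have [measurable]: "H \<in> borel_measurable lebesgue" and pos: "\<And>x. 0 < H x" and B: "0 < B"
    and AE: "AE x in lebesgue. x \<in> Q \<longrightarrow> ?X \<le> ennreal (B * H x)"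
    using H Q by (auto simp: A1_weight_def)
  note cubes_sets[OF Q, measurable]
  have "?X \<noteq> top"
  proof
    assume top: "?X = top"
    have "AE x in lebesgue. x \<notin> Q"
      using AE by (rule AE_mp) (intro AE_I2 impI, simp add: top top_unique)
    then have "emeasure lebesgue Q = 0"
      using AE_iff_measurable[of Q lebesgue "\<lambda>x. x \<notin> Q"] by auto
    then show False using emeasure_cube_pos_finite[OF Q] by simp
  qed
  moreover have "?X \<noteq> 0"
    using pos by (intro average_ne_0 Q) auto
  ultimately obtain t where t: "?X = ennreal t" "0 < t"
    by (cases ?X rule: ennreal_cases) (auto simp: less_le)
  have "AE x in lebesgue. x \<in> Q \<longrightarrow> t / B \<le> H x"
    using AE
  proof (rule AE_mp, intro AE_I2 impI)
    fix x assume "x \<in> Q \<longrightarrow> ?X \<le> ennreal (B * H x)" "x \<in> Q"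
    then have "ennreal t \<le> ennreal (B * H x)" by (simp only: t)
    then have "t \<le> B * H x"
      using B pos[of x] by (subst (asm) ennreal_le_iff) auto
    then show "t / B \<le> H x"
      using B by (simp add: field_simps)
  qed
  with t that show ?thesis by blast
qed

text \<open>In the average of u H^(-(r_0-r)) the A_1 factor is bounded by its supremum on the cube; in the
average of the dual weight \<sigma>^a H^(1-a), a = (r-1)/(r_0-1), Hoelder's inequality separates
\<sigma> from H. The averages of H then cancel up to [H]_(A_1)^(r_0-r).\<close>

lemma muckenhoupt_times_A1_negative_power:
  assumes u: "muckenhoupt r A u" and H: "A1_weight B H" and r: "1 < r" "r < r0"
  shows "muckenhoupt r0 (A * B powr (r0 - r)) (\<lambda>x. u x * H x powr (- (r0 - r)))"
  unfolding muckenhoupt_def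
proof (intro conjI ballI allI)
  have um [measurable]: "u \<in> borel_measurable lebesgue" and upos: "\<And>x. 0 < u x" and A: "0 < A"
    using u by (auto simp: muckenhoupt_def)
  have Hm [measurable]: "H \<in> borel_measurable lebesgue" and Hpos: "\<And>x. 0 < H x" and B: "0 < B"
    using H by (auto simp: A1_weight_def)
  show "(\<lambda>x. u x * H x powr (- (r0 - r))) \<in> borel_measurable lebesgue" by measurable
  show "0 < u x * H x powr (- (r0 - r))" for x using upos[of x] Hpos[of x] by simp
  show "0 < A * B powr (r0 - r)" using A B by simp
  fix Q :: "(real ^ 'a) set" assume Q: "Q \<in> cubes"
  obtain t where t: "0 < t" "average Q (\<lambda>x. ennreal (H x)) = ennreal t"
    "AE x in lebesgue. x \<in> Q \<longrightarrow> t / B \<le> H x"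
    using A1_weight_average[OF H Q] .
  define \<sigma> where "\<sigma> x = u x powr (- 1 / (r - 1))" for x
  have \<sigma>m [measurable]: "\<sigma> \<in> borel_measurable lebesgue"
    unfolding \<sigma>_def[abs_def] by measurable
  have \<sigma>pos: "0 < \<sigma> x" for x using upos[of x] by (simp add: \<sigma>_def)
  define a where "a = (r - 1) / (r0 - 1)"
  have a: "0 < a" "a < 1" "a * (r0 - 1) = r - 1" "(1 - a) * (r0 - 1) = r0 - r"
    using r by (auto simp: a_def field_simps)
  let ?U = "average Q (\<lambda>x. ennreal (u x))" and ?S = "average Q (\<lambda>x. ennreal (\<sigma> x))"
  have "average Q (\<lambda>x. ennreal (u x * H x powr (- (r0 - r))))
      \<le> average Q (\<lambda>x. ennreal ((t / B) powr (- (r0 - r))) * ennreal (u x))"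
  proof (rule average_mono_AE, rule AE_mp[OF t(3)], intro AE_I2 impI)
    fix x assume "x \<in> Q \<longrightarrow> t / B \<le> H x" "x \<in> Q"
    then have "H x powr (- (r0 - r)) \<le> (t / B) powr (- (r0 - r))"
      using t(1) B r by (intro powr_mono2') auto
    then show "ennreal (u x * H x powr (- (r0 - r))) \<le> ennreal ((t / B) powr (- (r0 - r))) * ennreal (u x)"
      using upos[of x] by (subst ennreal_mult[symmetric]) (auto intro!: ennreal_leI simp: mult.commute)
  qed
  also have "\<dots> = ennreal ((t / B) powr (- (r0 - r))) * ?U"
    by (intro average_cmult Q) measurable
  finally have 1: "average Q (\<lambda>x. ennreal (u x * H x powr (- (r0 - r))))
      \<le> ennreal ((t / B) powr (- (r0 - r))) * ?U" .
  have "ennreal ((u x * H x powr (- (r0 - r))) powr (- 1 / (r0 - 1)))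
      = ennpowr (ennreal (\<sigma> x)) a * ennpowr (ennreal (H x)) (1 - a)" for x
  proof -
    have E: "- 1 / (r0 - 1) = - 1 / (r - 1) * a" "- (r0 - r) * (- 1 / (r0 - 1)) = 1 - a"
      using r by (simp_all add: a_def field_simps)
    have "(u x * H x powr (- (r0 - r))) powr (- 1 / (r0 - 1)) = \<sigma> x powr a * H x powr (1 - a)"
      by (simp only: powr_mult powr_powr E(2) \<sigma>_def E(1)[symmetric])
    then show ?thesis
      using \<sigma>pos[of x] Hpos[of x] by (simp only: ennpowr_ennreal ennreal_mult less_imp_le powr_ge_zero)
  qed
  then have "average Q (\<lambda>x. ennreal ((u x * H x powr (- (r0 - r))) powr (- 1 / (r0 - 1))))
      = average Q (\<lambda>x. ennpowr (ennreal (\<sigma> x)) a * ennpowr (ennreal (H x)) (1 - a))"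
    by (simp only:)
  also have "\<dots> \<le> ennpowr ?S a * ennpowr (ennreal t) (1 - a)"
    unfolding t(2)[symmetric] by (intro average_Holder Q a) measurable
  finally have "ennpowr (average Q (\<lambda>x. ennreal ((u x * H x powr (- (r0 - r))) powr (- 1 / (r0 - 1))))) (r0 - 1)
      \<le> ennpowr (ennpowr ?S a * ennpowr (ennreal t) (1 - a)) (r0 - 1)"
    using r by (intro ennpowr_mono) auto
  also have "\<dots> = ennpowr ?S (r - 1) * ennreal (t powr (r0 - r))"
    unfolding ennpowr_mult ennpowr_ennpowr a(3,4) using t(1) by (simp only: ennpowr_ennreal less_imp_le)
  finally have 2: "ennpowr (average Q (\<lambda>x. ennreal ((u x * H x powr (- (r0 - r))) powr (- 1 / (r0 - 1))))) (r0 - 1)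
      \<le> ennpowr ?S (r - 1) * ennreal (t powr (r0 - r))" .
  have "average Q (\<lambda>x. ennreal (u x * H x powr (- (r0 - r)))) *
      ennpowr (average Q (\<lambda>x. ennreal ((u x * H x powr (- (r0 - r))) powr (- 1 / (r0 - 1))))) (r0 - 1)
      \<le> (ennreal ((t / B) powr (- (r0 - r))) * ?U) * (ennpowr ?S (r - 1) * ennreal (t powr (r0 - r)))"
    by (intro mult_mono 1 2) auto
  also have "\<dots> = (?U * ennpowr ?S (r - 1)) * (ennreal ((t / B) powr (- (r0 - r))) * ennreal (t powr (r0 - r)))"
    by (simp only: mult_ac)
  also have "ennreal ((t / B) powr (- (r0 - r))) * ennreal (t powr (r0 - r)) = ennreal (B powr (r0 - r))"
  proof -
    have "(t / B) powr (- d) * t powr d = B powr d" for d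
      using t(1) B by (simp add: powr_divide powr_minus field_simps)
    then show ?thesis
      by (subst ennreal_mult[symmetric]) (simp_all only: powr_ge_zero)
  qed
  also have "(?U * ennpowr ?S (r - 1)) * ennreal (B powr (r0 - r)) \<le> ennreal A * ennreal (B powr (r0 - r))"
    using u Q unfolding muckenhoupt_def \<sigma>_def by (intro mult_right_mono) auto
  also have "\<dots> = ennreal (A * B powr (r0 - r))"
    using A by (intro ennreal_mult[symmetric]) auto
  finally show "average Q (\<lambda>x. ennreal (u x * H x powr (- (r0 - r)))) *
      ennpowr (average Q (\<lambda>x. ennreal ((u x * H x powr (- (r0 - r))) powr (- 1 / (r0 - 1))))) (r0 - 1)
      \<le> ennreal (A * B powr (r0 - r))" .
qed

text \<open>This is the preceding lemma for the dual weights: with s = r' and s_0 = r_0' the condition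
r_0 < r becomes s < s_0, and the dual of \<sigma> H^(-(s_0-s)) is u^\<theta> H^(1-\<theta>).\<close>

lemma muckenhoupt_interpolate_A1:
  assumes u: "muckenhoupt r A u" and H: "A1_weight B H" and r: "1 < r0" "r0 < r"
    and \<theta>: "\<theta> = (r0 - 1) / (r - 1)"
  shows "muckenhoupt r0 (A powr \<theta> * B powr (1 - \<theta>)) (\<lambda>x. u x powr \<theta> * H x powr (1 - \<theta>))"
proof -
  have upos: "\<And>x. 0 < u x" and A: "0 < A"
    using u by (auto simp: muckenhoupt_def)
  have Hpos: "\<And>x. 0 < H x" and B: "0 < B"
    using H by (auto simp: A1_weight_def)
  define s s0 where "s = r / (r - 1)" and "s0 = r0 / (r0 - 1)"
  have s: "1 < s" "s < s0" "s0 - 1 = 1 / (r0 - 1)" "s0 / (s0 - 1) = r0"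
    using r by (auto simp: s_def s0_def field_simps)
  have e: "- 1 / (r - 1) * (- 1 / (s0 - 1)) = \<theta>" "- (s0 - s) * (- 1 / (s0 - 1)) = 1 - \<theta>"
    "1 / (r - 1) * (1 / (s0 - 1)) = \<theta>" "(s0 - s) * (1 / (s0 - 1)) = 1 - \<theta>"
  proof -
    have "s0 - s = 1 / (r0 - 1) - 1 / (r - 1)"
      using r by (simp add: s_def s0_def field_simps)
    note diff = this
    have "- 1 / a * (- 1 / (1 / b)) = b / a" "- (1 / b - 1 / a) * (- 1 / (1 / b)) = 1 - b / a" "(1 / b - 1 / a) * (1 / (1 / b)) = 1 - b / a"
      if "0 < a" "0 < b" for a b :: real
      using that by (auto simp: field_simps)
    note alg = this[of "r - 1" "r0 - 1"]
    show "- 1 / (r - 1) * (- 1 / (s0 - 1)) = \<theta>"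
      unfolding s(3) \<theta> by (rule alg(1)) (use r in simp_all)
    show "- (s0 - s) * (- 1 / (s0 - 1)) = 1 - \<theta>"
      unfolding diff s(3) \<theta> by (rule alg(2)) (use r in simp_all)
    show "1 / (r - 1) * (1 / (s0 - 1)) = \<theta>"
      unfolding s(3) \<theta> by simp
    show "(s0 - s) * (1 / (s0 - 1)) = 1 - \<theta>"
      unfolding diff s(3) \<theta> by (rule alg(3)) (use r in simp_all)
  qed
  have "muckenhoupt s0 (A powr (1 / (r - 1)) * B powr (s0 - s))
      (\<lambda>x. u x powr (- 1 / (r - 1)) * H x powr (- (s0 - s)))"
    using muckenhoupt_times_A1_negative_power[OF muckenhoupt_dual[OF u] H, of s0] r s
    by (simp add: s_def)
  then have "muckenhoupt (s0 / (s0 - 1)) ((A powr (1 / (r - 1)) * B powr (s0 - s)) powr (1 / (s0 - 1)))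
      (\<lambda>x. (u x powr (- 1 / (r - 1)) * H x powr (- (s0 - s))) powr (- 1 / (s0 - 1)))"
    using s by (intro muckenhoupt_dual) auto
  then show ?thesis
    unfolding s(4) powr_mult powr_powr e .
qed

lemma muckenhoupt_average_finite:
  assumes u: "muckenhoupt r A u" and Q: "Q \<in> cubes"
  shows "average Q (\<lambda>x. ennreal (u x)) \<noteq> top"
proof
  have [measurable]: "u \<in> borel_measurable lebesgue" and pos: "\<And>x. 0 < u x"
    using u by (auto simp: muckenhoupt_def)
  let ?s = "average Q (\<lambda>x. ennreal (u x powr (- 1 / (r - 1))))"
  assume "average Q (\<lambda>x. ennreal (u x)) = top"
  moreover have "?s \<noteq> 0"
    using pos by (intro average_ne_0 Q) (auto simp: less_le)
  then have "ennpowr ?s (r - 1) \<noteq> 0" by (simp only: ennpowr_eq_0_iff not_False_eq_True)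
  moreover have "average Q (\<lambda>x. ennreal (u x)) * ennpowr ?s (r - 1) \<le> ennreal A"
    using u Q unfolding muckenhoupt_def by blast
  ultimately show False
    by (simp only: ennreal_top_mult if_False top_unique) simp
qed

lemma bounded_subset_cube:
  fixes K :: "(real ^ 'n) set"
  assumes "bounded K"
  obtains Q where "Q \<in> cubes" "K \<subseteq> Q"
proof -
  obtain b where b: "\<And>x. x \<in> K \<Longrightarrow> norm x \<le> b"
    using assms by (auto simp: bounded_iff)
  define c where "c = \<bar>b\<bar> + 1"
  define Q where "Q = cbox (\<chi> i. - c) (\<chi> i. (\<chi> i::'n. - c) $ i + 2 * c)"
  have "Q \<in> cubes"
    unfolding cubes_def Q_def mem_Collect_eq
    by (intro exI[of _ "\<chi> i. - c"] exI[of _ "2 * c"] conjI refl) (simp add: c_def)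
  moreover have "x \<in> Q" if "x \<in> K" for x
    unfolding Q_def mem_box_cart
  proof
    fix i
    have "- c \<le> x $ i" "x $ i \<le> c"
      unfolding c_def using component_le_norm_cart[of x i] b[OF that] by linarith+
    then show "(\<chi> i. - c) $ i \<le> x $ i \<and> x $ i \<le> (\<chi> i. (\<chi> i. - c) $ i + 2 * c) $ i"
      by simp
  qed
  ultimately show ?thesis using that by blast
qed

text \<open>Local integrability of W follows from that of W^q because W \<le> 1 + W^q.\<close>

lemma weight_of_average_finite:
  fixes W :: "real ^ 'n \<Rightarrow> real"
  assumes [measurable]: "W \<in> borel_measurable lebesgue" and pos: "\<And>x. 0 \<le> W x" and q: "1 \<le> q"
    and fin: "\<And>Q. Q \<in> cubes \<Longrightarrow> average Q (\<lambda>x. ennreal (W x powr q)) \<noteq> top"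
  shows "weight W"
  unfolding weight_def
proof (intro conjI allI impI)
  fix K :: "(real ^ 'n) set" assume K: "compact K"
  obtain Q where Q: "Q \<in> cubes" and "K \<subseteq> Q"
    using bounded_subset_cube[OF compact_imp_bounded[OF K]] .
  then have KQ: "x \<in> Q" if "x \<in> K" for x
    using that by blast
  note cubes_sets[OF Q, measurable]
  have Km [measurable]: "K \<in> sets lebesgue"
    using K by (simp add: compact_imp_closed borel_closed)
  have "(\<integral>\<^sup>+x. ennreal (norm (indicator K x *\<^sub>R W x)) \<partial>lebesgue)
      \<le> (\<integral>\<^sup>+x. indicator Q x + ennreal (W x powr q) * indicator Q x \<partial>lebesgue)"
  proof (rule nn_integral_mono)
    fix x
    have "W x \<le> 1 + W x powr q"
    proof (cases "W x \<le> 1")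
      case False
      then have "W x powr 1 \<le> W x powr q" using q by (intro powr_mono) auto
      then show ?thesis using False by simp
    qed (simp add: add_increasing2)
    then have "ennreal (W x) \<le> 1 + ennreal (W x powr q)"
      using ennreal_leI[of "W x" "1 + W x powr q"] by simp
    then show "ennreal (norm (indicator K x *\<^sub>R W x)) \<le> indicator Q x + ennreal (W x powr q) * indicator Q x"
      using KQ[of x] pos[of x] by (auto split: split_indicator)
  qed
  also have "\<dots> = emeasure lebesgue Q + (\<integral>\<^sup>+x\<in>Q. ennreal (W x powr q) \<partial>lebesgue)"
    by (subst nn_integral_add) (auto simp: nn_integral_indicator simp del: emeasure_lborel_cbox_eq)
  also have "\<dots> < \<infinity>"
  proof -
    have "(\<integral>\<^sup>+x\<in>Q. ennreal (W x powr q) \<partial>lebesgue) \<noteq> top"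
      using fin[OF Q] emeasure_cube_pos_finite[OF Q]
      by (auto simp: average_def ennreal_top_divide)
    then show ?thesis
      using emeasure_cube_pos_finite[OF Q] by (simp add: less_top)
  qed
  finally show "set_integrable lebesgue K W"
    unfolding set_integrable_def by (intro integrableI_bounded) auto
qed (use pos in auto)

lemma ennreal_inverse_powr:
  assumes "0 < t"
  shows "inverse (ennreal (t powr a)) = ennreal (t powr (- a))"
  using assms by (simp add: inverse_ennreal powr_minus)

lemma conj_exponent_pos: "1 < p \<Longrightarrow> 0 < conj_exponent p"
  by (simp add: conj_exponent_def)

text \<open>For positive weights, A_(p,q) for w is A_r for w^q with r = 1 + q/p'.\<close>

lemma Apq_const_eq_SUP:
  assumes "1 < p" and pos: "\<And>x. 0 < w x" and q: "0 < q"
  defines "r \<equiv> 1 + q / conj_exponent p"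
  shows "Apq_const p q w = (SUP Q\<in>cubes. average Q (\<lambda>x. ennreal (w x powr q)) *
    ennpowr (average Q (\<lambda>x. ennreal ((w x powr q) powr (- 1 / (r - 1))))) (r - 1))"
proof -
  have "q * (- 1 / (r - 1)) = - conj_exponent p"
    using q conj_exponent_pos[OF assms(1)] by (simp add: r_def field_simps)
  then have "inverse (ennreal (w x powr conj_exponent p)) = ennreal ((w x powr q) powr (- 1 / (r - 1)))" for x
    using pos[of x] by (simp only: powr_powr ennreal_inverse_powr)
  moreover have "r - 1 = q / conj_exponent p"
    by (simp add: r_def)
  ultimately show ?thesis
    using assms(1) by (simp only: Apq_const_def) simp
qed

lemma Apq_of_muckenhoupt:
  assumes p: "1 < p" "p \<le> q" and [measurable]: "w \<in> borel_measurable lebesgue" and pos: "\<And>x. 0 < w x"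
    and u: "muckenhoupt (1 + q / conj_exponent p) A (\<lambda>x. w x powr q)"
  shows "w \<in> Apq p q" "Apq_const p q w \<le> ennreal A"
proof -
  show le: "Apq_const p q w \<le> ennreal A"
    using u p pos unfolding muckenhoupt_def by (subst Apq_const_eq_SUP) (auto intro!: SUP_least)
  have "weight w"
    using p pos less_imp_le[OF pos] by (intro weight_of_average_finite[of w q] muckenhoupt_average_finite[OF u]) auto
  moreover have "Apq_const p q w < \<infinity>"
    using le by (rule le_less_trans) simp
  ultimately show "w \<in> Apq p q"
    by (simp add: Apq_def)
qed

lemma Apq_1_of_A1_weight:
  assumes q: "1 \<le> q" and [measurable]: "w \<in> borel_measurable lebesgue" and pos: "\<And>x. 0 < w x"
    and H: "A1_weight B (\<lambda>x. w x powr q)"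
  shows "w \<in> Apq 1 q" "Apq_const 1 q w \<le> ennreal B"
proof -
  have B: "0 < B" using H by (simp add: A1_weight_def)
  have "average Q (\<lambda>x. ennreal (w x powr q)) \<le> ennreal B * ess_inf Q (\<lambda>x. ennreal (w x powr q))"
    if Q: "Q \<in> cubes" for Q
  proof -
    obtain t where t: "0 < t" "average Q (\<lambda>x. ennreal (w x powr q)) = ennreal t"
      "AE x in lebesgue. x \<in> Q \<longrightarrow> t / B \<le> w x powr q"
      using A1_weight_average[OF H Q] .
    have "ennreal (t / B) \<le> ess_inf Q (\<lambda>x. ennreal (w x powr q))"
      unfolding ess_inf_def
    proof (rule Sup_upper, unfold mem_Collect_eq)
      show "AE x in lebesgue. x \<in> Q \<longrightarrow> ennreal (t / B) \<le> ennreal (w x powr q)"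
        using t(3) by (rule AE_mp) (intro AE_I2 impI, simp add: ennreal_leI)
    qed
    then have "ennreal B * ennreal (t / B) \<le> ennreal B * ess_inf Q (\<lambda>x. ennreal (w x powr q))"
      by (rule mult_left_mono) simp
    also have "ennreal B * ennreal (t / B) = ennreal t"
      using B t(1) by (subst ennreal_mult[symmetric]) auto
    finally show ?thesis by (simp only: t(2))
  qed
  then show le: "Apq_const 1 q w \<le> ennreal B"
    unfolding Apq_const_def by (auto intro!: Inf_lower)
  have "average Q (\<lambda>x. ennreal (w x powr q)) \<noteq> top" if "Q \<in> cubes" for Q
    using A1_weight_average[OF H that] by (metis ennreal_neq_top)
  then have "weight w"
    using q pos less_imp_le[OF pos] by (intro weight_of_average_finite[of w q]) auto
  moreover have "Apq_const 1 q w < \<infinity>"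
    using le by (rule le_less_trans) simp
  ultimately show "w \<in> Apq 1 q"
    by (simp add: Apq_def)
qed

section \<open>Extrapolation to smaller exponents\<close>

text \<open>Both r/q and r_0/q_0 equal 1 - (1/p - 1/q), so the relation between (p, q) and
(p_0, q_0) is the proportionality r/q = r_0/q_0.\<close>

lemma exponent_relations:
  fixes p q p0 q0 :: real
  assumes p: "1 < p" "p \<le> q" and p0: "1 \<le> p0" "p0 \<le> q0" and d: "1 / p - 1 / q = 1 / p0 - 1 / q0"
  defines "r \<equiv> 1 + q - q / p" and "r0 \<equiv> 1 + q0 - q0 / p0"
  shows "1 < r" "1 \<le> r0" "r0 * q = r * q0"
    "1 + q / conj_exponent p = r" "1 < p0 \<Longrightarrow> 1 + q0 / conj_exponent p0 = r0"
    "p0 = 1 \<Longrightarrow> r0 = 1" "1 < p0 \<Longrightarrow> 1 < r0"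
proof -
  show "1 < r" "1 \<le> r0" "1 < p0 \<Longrightarrow> 1 < r0"
    using p p0 by (auto simp: r_def r0_def field_simps)
  have "r / q = r0 / q0"
  proof -
    have "r / q = 1 + (1 / q - 1 / p)" "r0 / q0 = 1 + (1 / q0 - 1 / p0)"
      using p p0 by (auto simp: r_def r0_def diff_divide_distrib add_divide_distrib)
    then show ?thesis using d by simp
  qed
  then show "r0 * q = r * q0"
    using p p0 by (simp add: field_simps)
  show "1 + q / conj_exponent p = r" "1 < p0 \<Longrightarrow> 1 + q0 / conj_exponent p0 = r0" "p0 = 1 \<Longrightarrow> r0 = 1"
    using p by (auto simp: conj_exponent_def r_def r0_def right_diff_distrib diff_divide_distrib)
qed

lemma Lp_norm_weighted:
  fixes f :: "real ^ 'n \<Rightarrow> complex"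
  assumes "\<And>x. 0 \<le> w x"
  shows "Lp_norm p (\<lambda>x. complex_of_real (w x) * f x)
    = ennpowr (\<integral>\<^sup>+x. ennreal ((w x * cmod (f x)) powr p) \<partial>lebesgue) (1 / p)"
  using assms by (simp add: Lp_norm_def norm_mult)

lemma A1_weight_one: "A1_weight 1 (\<lambda>_::real ^ 'n. 1)"
proof -
  have "average Q (\<lambda>_. 1) = 1" if Q: "Q \<in> cubes" for Q :: "(real ^ 'n) set"
  proof -
    note cubes_sets[OF Q, measurable]
    have "(\<integral>\<^sup>+x\<in>Q. 1 \<partial>lebesgue) = emeasure lebesgue Q"
      using nn_integral_indicator[of Q lebesgue] by simp
    then show ?thesis
      unfolding average_def using emeasure_cube_pos_finite[OF Q]
      by (simp only:) (simp add: less_top)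
  qed
  then show ?thesis
    by (simp add: A1_weight_def)
qed

lemma muckenhoupt_one:
  assumes "1 < r"
  shows "muckenhoupt r 1 (\<lambda>_::real ^ 'n. 1)"
proof -
  have "average Q (\<lambda>_. 1) \<le> 1" if Q: "Q \<in> cubes" for Q :: "(real ^ 'n) set"
  proof -
    obtain t where t: "average Q (\<lambda>_. ennreal 1) = ennreal t" "AE x in lebesgue. x \<in> Q \<longrightarrow> t / 1 \<le> 1"
      using A1_weight_average[OF A1_weight_one Q] by blast
    have "t \<le> 1"
    proof (rule ccontr)
      assume "\<not> t \<le> 1"
      with t(2) have "AE x in lebesgue. x \<notin> Q"
        by (auto elim: AE_mp)
      then have "emeasure lebesgue Q = 0"
        using AE_iff_measurable[of Q lebesgue "\<lambda>x. x \<notin> Q"] cubes_sets[OF Q] by auto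
      then show False using emeasure_cube_pos_finite[OF Q] by simp
    qed
    then show ?thesis using t(1) by (simp add: ennreal_le_1)
  qed
  then have "average Q (\<lambda>_. 1) * ennpowr (average Q (\<lambda>_. 1)) (r - 1) \<le> 1"
    if "Q \<in> cubes" for Q :: "(real ^ 'n) set"
    using that assms ennpowr_mono[of "average Q (\<lambda>_. 1)" 1 "r - 1"]
      mult_mono[of "average Q (\<lambda>_. 1)" 1 "ennpowr (average Q (\<lambda>_. 1)) (r - 1)" 1] by simp
  then show ?thesis
    by (simp add: muckenhoupt_def)
qed

text \<open>All that is used of the operator: the hypothesis at one height t, with E in the role of the set
where |Tf| exceeds t.\<close>

definition level_inequality ::
    "real \<Rightarrow> real \<Rightarrow> real \<Rightarrow> real \<Rightarrow> (real ^ 'n \<Rightarrow> complex) \<Rightarrow> (real ^ 'n) set \<Rightarrow> real \<Rightarrow> bool" where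
  "level_inequality p q \<gamma> c f E t \<longleftrightarrow> (\<forall>W. (\<forall>x. 0 < W x) \<longrightarrow> W \<in> Apq p q \<longrightarrow>
     ennreal t * ennpowr (weighted_meas (\<lambda>x. W x powr q) E) (1 / q)
       \<le> ennreal c * ennpowr (Apq_const p q W) \<gamma> * Lp_norm p (\<lambda>x. complex_of_real (W x) * f x))"

lemma level_inequalityD:
  fixes f :: "real ^ 'n \<Rightarrow> complex"
  assumes "level_inequality p q \<gamma> c f E t" and pos: "\<And>x. 0 < W x" and W: "W \<in> Apq p q"
    and B: "Apq_const p q W \<le> ennreal B" "0 < B" and \<gamma>: "0 < \<gamma>" and c: "0 < c"
  shows "ennreal t * ennpowr (\<integral>\<^sup>+x\<in>E. ennreal (W x powr q) \<partial>lebesgue) (1 / q)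
    \<le> ennreal (c * B powr \<gamma>) * ennpowr (\<integral>\<^sup>+x. ennreal ((W x * cmod (f x)) powr p) \<partial>lebesgue) (1 / p)"
proof -
  have "ennpowr (Apq_const p q W) \<gamma> \<le> ennpowr (ennreal B) \<gamma>"
    using B \<gamma> by (intro ennpowr_mono) auto
  also have "\<dots> = ennreal (B powr \<gamma>)"
    using B by (intro ennpowr_ennreal) simp
  finally have "ennreal c * ennpowr (Apq_const p q W) \<gamma> \<le> ennreal c * ennreal (B powr \<gamma>)"
    by (rule mult_left_mono) simp
  also have "\<dots> = ennreal (c * B powr \<gamma>)"
    using c by (intro ennreal_mult[symmetric]) auto
  finally have le: "ennreal c * ennpowr (Apq_const p q W) \<gamma> \<le> ennreal (c * B powr \<gamma>)" .
  have "ennreal t * ennpowr (weighted_meas (\<lambda>x. W x powr q) E) (1 / q)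
      \<le> ennreal c * ennpowr (Apq_const p q W) \<gamma> * Lp_norm p (\<lambda>x. complex_of_real (W x) * f x)"
    using assms(1) pos W unfolding level_inequality_def by blast
  also have "\<dots> \<le> ennreal (c * B powr \<gamma>) * Lp_norm p (\<lambda>x. complex_of_real (W x) * f x)"
    using le by (rule mult_right_mono) simp
  also have "Lp_norm p (\<lambda>x. complex_of_real (W x) * f x)
      = ennpowr (\<integral>\<^sup>+x. ennreal ((W x * cmod (f x)) powr p) \<partial>lebesgue) (1 / p)"
    by (intro Lp_norm_weighted less_imp_le pos)
  finally show ?thesis
    by (simp only: weighted_meas_def)
qed

text \<open>Identities between products of powers of positive numbers are reduced to linear identities between
their logarithms.\<close>

lemma exp_powr_products:
  fixes a b e s t d :: real
  shows "(exp a powr s * exp b powr t) powr e = exp (e * (s * a + t * b))"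
    "(exp a powr s * exp b powr (- d)) powr e = exp (e * (s * a - d * b))"
  by (simp_all add: powr_def flip: exp_add)

text \<open>With v = exp a and |f| = exp b this is the logarithm of (W|f|)^(p_0) = (v|f|)^p for the weight
W^(q_0) = v^q h^(-(r_0-r)) and h = (v|f|)^(p/r) v^(-q/r).\<close>

lemma smaller_exponent_identity:
  fixes a b p q p0 q0 r r0 :: real
  assumes pos: "0 < p" "0 < q" "0 < p0" "0 < q0" "0 < r" and r: "r0 * q = r * q0"
    and d: "1 / p - 1 / q = 1 / p0 - 1 / q0"
  shows "p0 * (1 / q0 * (q * a - (r0 - r) * (p / r * (a + b) - q / r * a)) + b) = p * (a + b)"
proof -
  have r0: "r0 = r * q0 / q"
    using r pos by (simp add: field_simps)
  have "(r0 - r) * (p / r * (a + b) - q / r * a) = (q0 / q - 1) * (p * (a + b) - q * a)"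
    using pos unfolding r0 by (simp add: field_simps)
  moreover have "1 / q0 * (q * a - (q0 / q - 1) * (p * (a + b) - q * a)) + b = (a + b) * (1 - p * (1 / q - 1 / q0))"
    using pos by (simp add: field_simps)
  moreover have "1 / q - 1 / q0 = 1 / p - 1 / p0"
    using d by linarith
  moreover have "p0 * ((a + b) * (1 - p * (1 / p - 1 / p0))) = p * (a + b)"
    using pos by (simp add: field_simps)
  ultimately show ?thesis
    by (simp only:)
qed

text \<open>The case q < q_0: the function h is chosen so that h^r v^q = (v|f|)^p, hence its norm in
L^r(v^q) is a power of the norm of vf in L^p, and so that W|f| computed with h in place of
H is exactly (v|f|)^(p/p_0).\<close>

lemma extrapolation_smaller_exponent:
  fixes p q p0 q0 \<gamma> c :: real
  assumes p: "1 < p" "p \<le> q" and p0: "1 \<le> p0" "p0 \<le> q0" and d: "1 / p - 1 / q = 1 / p0 - 1 / q0"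
    and lt: "q < q0" and \<gamma>: "0 < \<gamma>" and c: "0 < c"
  defines "r \<equiv> 1 + q - q / p" and "r0 \<equiv> 1 + q0 - q0 / p0"
  shows "\<exists>C>0. \<forall>(v :: real ^ 'n \<Rightarrow> real) A f E t.
    v \<in> borel_measurable lebesgue \<longrightarrow> (\<forall>x. 0 < v x) \<longrightarrow> muckenhoupt r A (\<lambda>x. v x powr q) \<longrightarrow>
    f \<in> borel_measurable lebesgue \<longrightarrow> E \<in> sets lebesgue \<longrightarrow> 0 < t \<longrightarrow> level_inequality p0 q0 \<gamma> c f E t \<longrightarrow>
    ennreal t * ennpowr (\<integral>\<^sup>+x\<in>E. ennreal (v x powr q) \<partial>lebesgue) (1 / q)
      \<le> ennreal (C * A powr (\<gamma> * ((r0 - 1) / (r - 1))))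
        * ennpowr (\<integral>\<^sup>+x. ennreal ((v x * cmod (f x)) powr p) \<partial>lebesgue) (1 / p)"
proof -
  note rel = exponent_relations[OF p p0 d, folded r_def r0_def]
  have dd: "1 / q - 1 / q0 = 1 / p - 1 / p0" using d by linarith
  have "1 / q0 < 1 / q" using lt p by (simp add: frac_less2)
  then have "1 / p0 < 1 / p" using dd by linarith
  then have pp: "p < p0" using p p0 by (simp add: field_simps)
  then have p01: "1 < p0" using p by simp
  have rr: "1 < r" "r < r0" "0 < r"
  proof -
    show "1 < r" "0 < r" using rel(1) by auto
    have "r * q < r * q0" using lt rel(1) by simp
    then have "r * q < r0 * q" using rel(3) by simp
    then show "r < r0" using p by simp
  qed
  define L where "L = rdf_const CARD('n) r"
  have L: "0 < L" unfolding L_def by (rule rdf_const_pos[OF rr(1)])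
  define \<delta> where "\<delta> = 1 / q - 1 / q0"
  define C where "C = c * (L powr (r0 - r)) powr \<gamma> * (2 powr r) powr \<delta>"
  have C: "0 < C" using c L by (simp add: C_def)
  have "ennreal t * ennpowr (\<integral>\<^sup>+x\<in>E. ennreal (v x powr q) \<partial>lebesgue) (1 / q)
      \<le> ennreal (C * A powr (\<gamma> * ((r0 - 1) / (r - 1))))
        * ennpowr (\<integral>\<^sup>+x. ennreal ((v x * cmod (f x)) powr p) \<partial>lebesgue) (1 / p)"
    if vm [measurable]: "v \<in> borel_measurable lebesgue" and vpos: "\<And>x. 0 < v x"
      and mu: "muckenhoupt r A (\<lambda>x. v x powr q)"
      and fm [measurable]: "f \<in> borel_measurable lebesgue" and Em [measurable]: "E \<in> sets lebesgue"
      and t: "0 < t" and test: "level_inequality p0 q0 \<gamma> c f E t"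
    for v :: "real ^ 'n \<Rightarrow> real" and A and f :: "real ^ 'n \<Rightarrow> complex" and E t
  proof -
    let ?F = "\<integral>\<^sup>+x. ennreal ((v x * cmod (f x)) powr p) \<partial>lebesgue"
    let ?X = "\<integral>\<^sup>+x\<in>E. ennreal (v x powr q) \<partial>lebesgue"
    have A: "0 < A" using mu by (simp add: muckenhoupt_def)
    consider "?F = 0" | "?F = top" | "?F \<noteq> 0" "?F \<noteq> top" by blast
    then show ?thesis
    proof cases
      case 1
      then have "AE x in lebesgue. ennreal ((v x * cmod (f x)) powr p) = 0"
        by (subst (asm) nn_integral_0_iff_AE) auto
      then have f0: "AE x in lebesgue. f x = 0"
      proof (rule AE_mp, intro AE_I2 impI)
        fix x assume "ennreal ((v x * cmod (f x)) powr p) = 0"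
        then have "(v x * cmod (f x)) powr p = 0"
          by (subst (asm) ennreal_eq_0_iff) (simp add: antisym)
        then show "f x = 0" using vpos[of x] by simp
      qed
      \<comment> \<open>here f = 0 almost everywhere, and the level inequality for the constant weight 1 shows that E is
      a null set\<close>
      have "muckenhoupt (1 + q0 / conj_exponent p0) 1 (\<lambda>_::real^'n. 1 powr q0)"
        using muckenhoupt_one[of r0] rel(5,7)[OF p01] by simp
      then have one: "(\<lambda>_::real^'n. 1) \<in> Apq p0 q0" "Apq_const p0 q0 (\<lambda>_::real^'n. 1) \<le> ennreal 1"
        using Apq_of_muckenhoupt[OF p01 p0(2), of "\<lambda>_. 1" 1] by simp_all
      have "(\<integral>\<^sup>+x. ennreal ((1 * cmod (f x)) powr p0) \<partial>lebesgue) = 0"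
        by (subst nn_integral_0_iff_AE) (use f0 in \<open>auto elim: AE_mp\<close>)
      then have "ennreal t * ennpowr (\<integral>\<^sup>+x\<in>E. ennreal (1 powr q0) \<partial>lebesgue) (1 / q0) \<le> 0"
        using level_inequalityD[OF test _ one _ \<gamma> c] by simp
      then have "(\<integral>\<^sup>+x\<in>E. ennreal (1 powr q0) \<partial>lebesgue) = 0"
        using t by simp
      then have "emeasure lebesgue E = 0"
        by simp
      then have "?X = 0"
        by (intro nn_integral_null_set) auto
      then show ?thesis by simp
    next
      case 2
      have "ennreal (C * A powr (\<gamma> * ((r0 - 1) / (r - 1)))) \<noteq> 0"
        using C A by simp
      then show ?thesis
        unfolding 2 ennpowr_top by (simp only: ennreal_mult_top if_False top.extremum)
    next
      case 3
      define y where "y x = v x * cmod (f x)" for x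
      define h where "h x = y x powr (p / r) * v x powr (- q / r)" for x
      have hm [measurable]: "h \<in> borel_measurable lebesgue"
        unfolding h_def[abs_def] y_def by measurable
      have y0: "0 \<le> y x" for x using vpos[of x] by (simp add: y_def)
      have h0: "0 \<le> h x" for x by (simp add: h_def)
      have hr: "ennpowr (ennreal (h x)) r * ennreal (v x powr q) = ennreal (y x powr p)" for x
      proof -
        have "h x powr r * v x powr q = y x powr p"
          using rr vpos[of x] by (simp add: h_def powr_mult powr_powr flip: powr_add)
        then show ?thesis
          using h0[of x] by (simp add: ennpowr_ennreal flip: ennreal_mult)
      qed
      obtain H where H: "A1_weight (L * A powr (1 / (r - 1))) H"
        and hH: "AE x in lebesgue. ennreal (h x) \<le> ennreal (H x)"
        and JH: "(\<integral>\<^sup>+x. ennpowr (ennreal (H x)) r * ennreal (v x powr q) \<partial>lebesgue) \<le> ennreal (2 powr r) * ?F"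
      proof (rule rubio_de_francia[OF rr(1) mu, of "\<lambda>x. ennreal (h x)"])
        fix H
        assume "A1_weight (rdf_const CARD('n) r * A powr (1 / (r - 1))) H"
          "AE x in lebesgue. ennreal (h x) \<le> ennreal (H x)"
          "(\<integral>\<^sup>+x. ennpowr (ennreal (H x)) r * ennreal (v x powr q) \<partial>lebesgue)
             \<le> ennreal (2 powr r) * (\<integral>\<^sup>+x. ennpowr (ennreal (h x)) r * ennreal (v x powr q) \<partial>lebesgue)"
        then show thesis
          unfolding hr L_def[symmetric] y_def by (rule that)
      qed (use 3 in \<open>simp_all only: hr y_def\<close>, measurable)
      have Hm [measurable]: "H \<in> borel_measurable lebesgue" and Hpos: "\<And>x. 0 < H x"
        using H by (auto simp: A1_weight_def)
      define W where "W x = (v x powr q * H x powr (- (r0 - r))) powr (1 / q0)" for x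
      have Wm [measurable]: "W \<in> borel_measurable lebesgue"
        unfolding W_def[abs_def] by measurable
      have Wpos: "0 < W x" for x using vpos[of x] Hpos[of x] by (simp add: W_def)
      have q0: "0 < q0" using p0 by simp
      have Wq: "W x powr q0 = v x powr q * H x powr (- (r0 - r))" for x
        using q0 vpos[of x] Hpos[of x] by (simp add: W_def powr_powr)
      define B where "B = A * (L * A powr (1 / (r - 1))) powr (r0 - r)"
      have B: "0 < B" using A L by (simp add: B_def)
      have "muckenhoupt r0 B (\<lambda>x. W x powr q0)"
        unfolding Wq B_def by (rule muckenhoupt_times_A1_negative_power[OF mu H rr(1,2)])
      then have WA: "W \<in> Apq p0 q0" "Apq_const p0 q0 W \<le> ennreal B"
        using Apq_of_muckenhoupt[OF p01 p0(2) Wm Wpos] rel(5)[OF p01] by auto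
      have main: "ennreal t * ennpowr (\<integral>\<^sup>+x\<in>E. ennreal (W x powr q0) \<partial>lebesgue) (1 / q0)
          \<le> ennreal (c * B powr \<gamma>) * ennpowr ?F (1 / p0)"
      proof -
        have "(\<integral>\<^sup>+x. ennreal ((W x * cmod (f x)) powr p0) \<partial>lebesgue) \<le> ?F"
        proof (rule nn_integral_mono_AE, rule AE_mp[OF hH], intro AE_I2 impI ennreal_leI)
          fix x assume "ennreal (h x) \<le> ennreal (H x)"
          then have le: "h x \<le> H x" using Hpos[of x] by (simp add: ennreal_le_iff less_imp_le)
          show "(W x * cmod (f x)) powr p0 \<le> (v x * cmod (f x)) powr p"
          proof (cases "f x = 0")
            case False
            define a b where "a = ln (v x)" and "b = ln (cmod (f x))"
            have vf: "v x = exp a" "cmod (f x) = exp b"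
              using False vpos[of x] by (simp_all add: a_def b_def)
            have h: "h x = exp (p / r * (a + b) - q / r * a)"
              by (simp add: h_def y_def vf powr_def flip: exp_add)
            have "H x powr (- (r0 - r)) \<le> h x powr (- (r0 - r))"
              using le rr by (intro powr_mono2') (auto simp: h)
            then have "v x powr q * H x powr (- (r0 - r)) \<le> v x powr q * h x powr (- (r0 - r))"
              by (rule mult_left_mono) simp
            then have "W x \<le> (v x powr q * h x powr (- (r0 - r))) powr (1 / q0)"
              unfolding W_def using q0 by (intro powr_mono2) simp_all
            also have "\<dots> = exp (1 / q0 * (q * a - (r0 - r) * (p / r * (a + b) - q / r * a)))"
              unfolding h vf by (rule exp_powr_products(2))
            finally have "W x * cmod (f x) \<le> exp (1 / q0 * (q * a - (r0 - r) * (p / r * (a + b) - q / r * a)) + b)"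
              unfolding vf exp_add by (rule mult_right_mono) simp
            then have "(W x * cmod (f x)) powr p0
                \<le> exp (1 / q0 * (q * a - (r0 - r) * (p / r * (a + b) - q / r * a)) + b) powr p0"
              using p0 Wpos[of x] by (intro powr_mono2) (auto simp: less_imp_le)
            also have "\<dots> = exp (p0 * (1 / q0 * (q * a - (r0 - r) * (p / r * (a + b) - q / r * a)) + b))"
              by (simp only: powr_def ln_exp exp_not_eq_zero if_False)
            also have "\<dots> = exp (p * (a + b))"
              using p p0 q0 rr by (subst smaller_exponent_identity[OF _ _ _ _ _ rel(3) d]) auto
            also have "\<dots> = (v x * cmod (f x)) powr p"
              by (simp add: vf powr_def flip: exp_add)
            finally show ?thesis .
          qed simp
        qed
        then have "ennpowr (\<integral>\<^sup>+x. ennreal ((W x * cmod (f x)) powr p0) \<partial>lebesgue) (1 / p0) \<le> ennpowr ?F (1 / p0)"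
          using p0 by (intro ennpowr_mono) auto
        then show ?thesis
          using level_inequalityD[OF test Wpos WA B \<gamma> c] by (meson mult_left_mono order_trans zero_le)
      qed
      let ?Y = "\<integral>\<^sup>+x\<in>E. ennreal (W x powr q0) \<partial>lebesgue"
      have "?X \<le> ennpowr ?Y (q / q0) * ennpowr (ennreal (2 powr r) * ?F) (1 - q / q0)"
      proof -
        have "?X = (\<integral>\<^sup>+x. ennpowr (ennreal (W x powr q0) * indicator E x) (q / q0)
            * ennpowr (ennpowr (ennreal (H x)) r * ennreal (v x powr q)) (1 - q / q0) \<partial>lebesgue)"
        proof (rule nn_integral_cong)
          fix x
          define a e where "a = ln (v x)" and "e = ln (H x)"
          have vH: "v x = exp a" "H x = exp e"
            using vpos[of x] Hpos[of x] by (simp_all add: a_def e_def)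
          have exponent: "q / q0 * (q * a - (r0 - r) * e) + (1 - q / q0) * (r * e + q * a) = q * a"
          proof -
            have "r0 = r * q0 / q" using rel(3) p by (simp add: field_simps)
            then show ?thesis using p q0 by (simp add: field_simps)
          qed
          have "(W x powr q0) powr (q / q0) * (H x powr r * v x powr q) powr (1 - q / q0)
              = exp (q / q0 * (q * a - (r0 - r) * e) + (1 - q / q0) * (r * e + q * a))"
            unfolding Wq vH exp_powr_products(2) unfolding exp_powr_products(1) by (simp only: exp_add)
          also have "\<dots> = v x powr q"
            unfolding exponent by (simp add: vH powr_def)
          finally have eq: "(W x powr q0) powr (q / q0) * (H x powr r * v x powr q) powr (1 - q / q0) = v x powr q" .
          show "ennreal (v x powr q) * indicator E x = ennpowr (ennreal (W x powr q0) * indicator E x) (q / q0)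
            * ennpowr (ennpowr (ennreal (H x)) r * ennreal (v x powr q)) (1 - q / q0)"
          proof (cases "x \<in> E")
            case True
            have "ennpowr (ennreal (H x)) r * ennreal (v x powr q) = ennreal (H x powr r * v x powr q)"
              using Hpos[of x] by (simp add: ennpowr_ennreal less_imp_le ennreal_mult)
            then show ?thesis
              using True by (simp only: ennpowr_ennreal powr_ge_zero mult_nonneg_nonneg indicator_simps
                  mult_1_right ennreal_mult[symmetric] eq)
          qed simp
        qed
        also have "\<dots> \<le> ennpowr ?Y (q / q0) *
            ennpowr (\<integral>\<^sup>+x. ennpowr (ennreal (H x)) r * ennreal (v x powr q) \<partial>lebesgue) (1 - q / q0)"
          using p lt by (intro nn_integral_Holder) auto
        also have "\<dots> \<le> ennpowr ?Y (q / q0) * ennpowr (ennreal (2 powr r) * ?F) (1 - q / q0)"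
          using p lt by (intro mult_left_mono ennpowr_mono JH) auto
        finally show ?thesis .
      qed
      then have "ennpowr ?X (1 / q) \<le> ennpowr (ennpowr ?Y (q / q0) * ennpowr (ennreal (2 powr r) * ?F) (1 - q / q0)) (1 / q)"
        using p by (intro ennpowr_mono) auto
      also have "\<dots> = ennpowr ?Y (1 / q0) * (ennreal ((2 powr r) powr \<delta>) * ennpowr ?F \<delta>)"
      proof -
        have e: "q / q0 * (1 / q) = 1 / q0" "(1 - q / q0) * (1 / q) = \<delta>"
          using p q0 by (simp_all add: \<delta>_def field_simps)
        show ?thesis
          unfolding ennpowr_mult ennpowr_ennpowr e by (simp only: ennpowr_ennreal powr_ge_zero)
      qed
      finally have "ennreal t * ennpowr ?X (1 / q)
          \<le> ennreal t * (ennpowr ?Y (1 / q0) * (ennreal ((2 powr r) powr \<delta>) * ennpowr ?F \<delta>))"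
        by (rule mult_left_mono) simp
      also have "\<dots> = (ennreal t * ennpowr ?Y (1 / q0)) * (ennreal ((2 powr r) powr \<delta>) * ennpowr ?F \<delta>)"
        by (simp only: mult.assoc)
      also have "\<dots> \<le> (ennreal (c * B powr \<gamma>) * ennpowr ?F (1 / p0)) * (ennreal ((2 powr r) powr \<delta>) * ennpowr ?F \<delta>)"
        by (rule mult_right_mono[OF main]) simp
      also have "\<dots> = (ennreal (c * B powr \<gamma>) * ennreal ((2 powr r) powr \<delta>)) * (ennpowr ?F (1 / p0) * ennpowr ?F \<delta>)"
        by (simp only: mult_ac)
      also have "ennpowr ?F (1 / p0) * ennpowr ?F \<delta> = ennpowr ?F (1 / p)"
        unfolding ennpowr_add[symmetric] \<delta>_def dd by simp
      also have "ennreal (c * B powr \<gamma>) * ennreal ((2 powr r) powr \<delta>) = ennreal (C * A powr (\<gamma> * ((r0 - 1) / (r - 1))))"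
      proof -
        have "B = L powr (r0 - r) * A powr ((r0 - 1) / (r - 1))"
        proof -
          have "B = L powr (r0 - r) * (A powr 1 * A powr (1 / (r - 1) * (r0 - r)))"
            using A L by (simp add: B_def powr_mult powr_powr)
          also have "A powr 1 * A powr (1 / (r - 1) * (r0 - r)) = A powr (1 + 1 / (r - 1) * (r0 - r))"
            by (simp only: powr_add)
          also have "1 + 1 / (r - 1) * (r0 - r) = (r0 - 1) / (r - 1)"
            using rr by (simp add: field_simps)
          finally show ?thesis .
        qed
        then have "c * B powr \<gamma> * (2 powr r) powr \<delta> = C * A powr (\<gamma> * ((r0 - 1) / (r - 1)))"
          by (simp add: C_def powr_mult powr_powr mult_ac)
        moreover have "ennreal (c * B powr \<gamma>) * ennreal ((2 powr r) powr \<delta>) = ennreal (c * B powr \<gamma> * (2 powr r) powr \<delta>)"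
          using c by (intro ennreal_mult[symmetric]) auto
        ultimately show ?thesis by (simp only:)
      qed
      finally show ?thesis .
    qed
  qed
  then show ?thesis
    using C by (intro exI[of _ C] conjI allI impI) auto
qed

section \<open>Extrapolation to larger exponents\<close>

text \<open>With v = exp a, |f| = exp b and H = exp e this is the logarithm of
(W|f|)^(p_0) = ((v|f|)^p)^(p_0/p) (H^(r')\<sigma>)^(1-p_0/p) for the weight
W^(q_0) = v^(q\<theta>) H^(1-\<theta>).\<close>

lemma larger_exponent_identity:
  fixes a b e p q p0 q0 r r0 :: real
  assumes pos: "0 < p" "0 < q" "0 < p0" "0 < q0" "1 < r" and r: "r0 * q = r * q0"
    and d: "1 / p - 1 / q = 1 / p0 - 1 / q0"
    and \<theta>: "\<theta> = (r0 - 1) / (r - 1)"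
  shows "p0 * (1 / q0 * (\<theta> * (q * a) + (1 - \<theta>) * e) + b)
    = p0 / p * (p * (a + b)) + (1 - p0 / p) * (r / (r - 1) * e - 1 / (r - 1) * (q * a))"
proof -
  have dd: "1 / q0 - 1 / q = 1 / p0 - 1 / p" using d by linarith
  define D where "D = 1 / q0 - 1 / q"
  have D: "p0 * D = 1 - p0 / p"
    using pos unfolding D_def dd by (simp add: field_simps)
  have r0: "r0 = r * q0 / q"
    using r pos by (simp add: field_simps)
  have "1 - \<theta> = (r - r0) / (r - 1)"
    using pos by (simp add: \<theta> field_simps)
  also have "r - r0 = r * q0 * D"
    using pos by (simp add: r0 D_def field_simps)
  finally have e: "1 / q0 * (1 - \<theta>) = D * (r / (r - 1))"
    using pos by simp
  have "1 / q0 * (\<theta> * q) - 1 = (q * (r0 - 1) - q0 * (r - 1)) / (q0 * (r - 1))"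
    using pos by (simp add: \<theta> field_simps)
  also have "q * (r0 - 1) - q0 * (r - 1) = - (q * q0 * D)"
    using pos r by (simp add: D_def field_simps)
  also have "- (q * q0 * D) / (q0 * (r - 1)) = - (D * (q / (r - 1)))"
    using pos by simp
  finally have a: "1 / q0 * (\<theta> * q) = 1 - D * (q / (r - 1))"
    by linarith
  have "1 / q0 * (\<theta> * (q * a) + (1 - \<theta>) * e) + b = (1 / q0 * (\<theta> * q)) * a + (1 / q0 * (1 - \<theta>)) * e + b"
    by (simp only: distrib_left mult.assoc)
  also have "\<dots> = (a + b) + D * (r / (r - 1) * e - 1 / (r - 1) * (q * a))"
    unfolding a e by (simp add: algebra_simps)
  finally have "p0 * (1 / q0 * (\<theta> * (q * a) + (1 - \<theta>) * e) + b)
      = p0 * (a + b) + (p0 * D) * (r / (r - 1) * e - 1 / (r - 1) * (q * a))"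
    by (simp add: distrib_left)
  then show ?thesis
    unfolding D using pos by simp
qed

lemma level_inequality_mono:
  fixes f :: "real ^ 'n \<Rightarrow> complex"
  assumes "level_inequality p q \<gamma> c f E t" "E' \<subseteq> E" "0 < q"
  shows "level_inequality p q \<gamma> c f E' t"
  unfolding level_inequality_def
proof (intro allI impI)
  fix W :: "real ^ 'n \<Rightarrow> real" assume W: "\<forall>x. 0 < W x" "W \<in> Apq p q"
  have "weighted_meas (\<lambda>x. W x powr q) E' \<le> weighted_meas (\<lambda>x. W x powr q) E"
    unfolding weighted_meas_def using assms(2) by (intro nn_integral_mono) (auto split: split_indicator)
  then have "ennreal t * ennpowr (weighted_meas (\<lambda>x. W x powr q) E') (1 / q)
      \<le> ennreal t * ennpowr (weighted_meas (\<lambda>x. W x powr q) E) (1 / q)"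
    using assms(3) by (intro mult_left_mono ennpowr_mono) auto
  also have "\<dots> \<le> ennreal c * ennpowr (Apq_const p q W) \<gamma> * Lp_norm p (\<lambda>x. complex_of_real (W x) * f x)"
    using assms(1) W unfolding level_inequality_def by blast
  finally show "ennreal t * ennpowr (weighted_meas (\<lambda>x. W x powr q) E') (1 / q)
      \<le> ennreal c * ennpowr (Apq_const p q W) \<gamma> * Lp_norm p (\<lambda>x. complex_of_real (W x) * f x)" .
qed

text \<open>The case q > q_0: the function h = 1_E v^q satisfies h^(r')\<sigma> = 1_E v^q, so its norm in
L^(r')(\<sigma>) is a power of the very measure that is to be estimated. The set E is first assumed to have finite measure for v^q, since its measure
also appears on the right-hand side and has to be cancelled; the general case follows by
exhaustion with balls. When p_0 = 1 one has \<theta> = 0, and W^(q_0) = H is itself the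
required A_1 weight.\<close>

lemma extrapolation_larger_exponent:
  fixes p q p0 q0 \<gamma> c :: real
  assumes p: "1 < p" "p \<le> q" and p0: "1 \<le> p0" "p0 \<le> q0" and d: "1 / p - 1 / q = 1 / p0 - 1 / q0"
    and lt: "q0 < q" and \<gamma>: "0 < \<gamma>" and c: "0 < c"
  defines "r \<equiv> 1 + q - q / p"
  shows "\<exists>C>0. \<forall>(v :: real ^ 'n \<Rightarrow> real) A f E t.
    v \<in> borel_measurable lebesgue \<longrightarrow> (\<forall>x. 0 < v x) \<longrightarrow> muckenhoupt r A (\<lambda>x. v x powr q) \<longrightarrow>
    f \<in> borel_measurable lebesgue \<longrightarrow> E \<in> sets lebesgue \<longrightarrow> 0 < t \<longrightarrow> level_inequality p0 q0 \<gamma> c f E t \<longrightarrow>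
    ennreal t * ennpowr (\<integral>\<^sup>+x\<in>E. ennreal (v x powr q) \<partial>lebesgue) (1 / q)
      \<le> ennreal (C * A powr \<gamma>)
        * ennpowr (\<integral>\<^sup>+x. ennreal ((v x * cmod (f x)) powr p) \<partial>lebesgue) (1 / p)"
proof -
  define r0 where "r0 = 1 + q0 - q0 / p0"
  note rel = exponent_relations[OF p p0 d, folded r_def r0_def]
  have q0: "0 < q0" using p0 by simp
  have q: "0 < q" using p by simp
  have dd: "1 / q0 - 1 / q = 1 / p0 - 1 / p" using d by linarith
  have "1 / q < 1 / q0" using lt q0 by (simp add: frac_less2)
  then have "1 / p < 1 / p0" using dd by linarith
  then have pp: "p0 < p" using p p0 by (simp add: field_simps)
  have rr: "1 < r" "r0 < r"
  proof -
    show "1 < r" by (fact rel(1))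
    have "r * q0 < r * q" using lt rel(1) by simp
    then have "r0 * q < r * q" using rel(3) by simp
    then show "r0 < r" using q by simp
  qed
  define r' where "r' = r / (r - 1)"
  have r': "1 < r'" "1 / (r - 1) * (1 / (r' - 1)) = 1" "r' - 1 / (r - 1) = 1"
  proof -
    show "1 < r'" using rr by (simp add: r'_def)
    show diff: "r' - 1 / (r - 1) = 1"
      using rr by (simp add: r'_def flip: diff_divide_distrib)
    have "r' - 1 = 1 / (r - 1)" using diff by simp
    then show "1 / (r - 1) * (1 / (r' - 1)) = 1" using rr by simp
  qed
  define \<theta> where "\<theta> = (r0 - 1) / (r - 1)"
  have \<theta>: "0 \<le> \<theta>" "\<theta> < 1" using rr rel(2) by (auto simp: \<theta>_def)
  define L where "L = rdf_const CARD('n) r'"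
  have L: "0 < L" unfolding L_def by (rule rdf_const_pos[OF r'(1)])
  define \<delta> where "\<delta> = 1 / q0 - 1 / q"
  have \<delta>: "\<delta> = (1 - p0 / p) * (1 / p0)"
    using p p0 unfolding \<delta>_def dd by (simp add: field_simps)
  define C where "C = c * (L powr (1 - \<theta>)) powr \<gamma> * (2 powr r') powr \<delta>"
  have C: "0 < C" using c L by (simp add: C_def)
  have finite_case: "ennreal t * ennpowr (\<integral>\<^sup>+x\<in>E. ennreal (v x powr q) \<partial>lebesgue) (1 / q)
      \<le> ennreal (C * A powr \<gamma>)
        * ennpowr (\<integral>\<^sup>+x. ennreal ((v x * cmod (f x)) powr p) \<partial>lebesgue) (1 / p)"
    if vm [measurable]: "v \<in> borel_measurable lebesgue" and vpos: "\<And>x. 0 < v x"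
      and mu: "muckenhoupt r A (\<lambda>x. v x powr q)"
      and fm [measurable]: "f \<in> borel_measurable lebesgue" and Em [measurable]: "E \<in> sets lebesgue"
      and t: "0 < t" and test: "level_inequality p0 q0 \<gamma> c f E t"
      and fin: "(\<integral>\<^sup>+x\<in>E. ennreal (v x powr q) \<partial>lebesgue) \<noteq> top"
      and ne: "(\<integral>\<^sup>+x\<in>E. ennreal (v x powr q) \<partial>lebesgue) \<noteq> 0"
    for v :: "real ^ 'n \<Rightarrow> real" and A and f :: "real ^ 'n \<Rightarrow> complex" and E t
  proof -
    let ?F = "\<integral>\<^sup>+x. ennreal ((v x * cmod (f x)) powr p) \<partial>lebesgue"
    let ?X = "\<integral>\<^sup>+x\<in>E. ennreal (v x powr q) \<partial>lebesgue"
    have A: "0 < A" using mu by (simp add: muckenhoupt_def)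
    define \<sigma> where "\<sigma> x = (v x powr q) powr (- 1 / (r - 1))" for x
    have \<sigma>mu: "muckenhoupt r' (A powr (1 / (r - 1))) \<sigma>"
      unfolding r'_def \<sigma>_def[abs_def] by (rule muckenhoupt_dual[OF mu rr(1)])
    have \<sigma>m [measurable]: "\<sigma> \<in> borel_measurable lebesgue"
      using \<sigma>mu by (simp add: muckenhoupt_def)
    define h where "h x = ennreal (v x powr q) * indicator E x" for x
    have hm [measurable]: "h \<in> borel_measurable lebesgue"
      unfolding h_def[abs_def] by measurable
    have hr: "ennpowr (h x) r' * ennreal (\<sigma> x) = ennreal (v x powr q) * indicator E x" for x
    proof (cases "x \<in> E")
      case True
      have "(v x powr q) powr r' * \<sigma> x = (v x powr q) powr (r' - 1 / (r - 1))"
        by (simp add: \<sigma>_def flip: powr_add)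
      also have "\<dots> = v x powr q"
        unfolding r'(3) by simp
      finally have "(v x powr q) powr r' * \<sigma> x = v x powr q" .
      then show ?thesis
        using True by (simp add: h_def ennpowr_ennreal \<sigma>_def flip: ennreal_mult)
    qed (simp add: h_def)
    obtain H where H: "A1_weight (L * A) H"
      and hH: "AE x in lebesgue. h x \<le> ennreal (H x)"
      and JH: "(\<integral>\<^sup>+x. ennpowr (ennreal (H x)) r' * ennreal (\<sigma> x) \<partial>lebesgue) \<le> ennreal (2 powr r') * ?X"
    proof (rule rubio_de_francia[OF r'(1) \<sigma>mu hm])
      fix H
      assume "A1_weight (rdf_const CARD('n) r' * (A powr (1 / (r - 1))) powr (1 / (r' - 1))) H"
        "AE x in lebesgue. h x \<le> ennreal (H x)"
        "(\<integral>\<^sup>+x. ennpowr (ennreal (H x)) r' * ennreal (\<sigma> x) \<partial>lebesgue)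
           \<le> ennreal (2 powr r') * (\<integral>\<^sup>+x. ennpowr (h x) r' * ennreal (\<sigma> x) \<partial>lebesgue)"
      moreover have "(A powr (1 / (r - 1))) powr (1 / (r' - 1)) = A"
        unfolding powr_powr r'(2) using A by simp
      ultimately show thesis
        unfolding hr L_def[symmetric] by (intro that) simp_all
    qed (use fin ne in \<open>simp_all only: hr not_False_eq_True\<close>)
    have Hm [measurable]: "H \<in> borel_measurable lebesgue" and Hpos: "\<And>x. 0 < H x"
      using H by (auto simp: A1_weight_def)
    define W where "W x = ((v x powr q) powr \<theta> * H x powr (1 - \<theta>)) powr (1 / q0)" for x
    have Wm [measurable]: "W \<in> borel_measurable lebesgue"
      unfolding W_def[abs_def] by measurable
    have Wpos: "0 < W x" for x using vpos[of x] Hpos[of x] by (simp add: W_def)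
    have Wq: "W x powr q0 = (v x powr q) powr \<theta> * H x powr (1 - \<theta>)" for x
      using q0 vpos[of x] Hpos[of x] by (simp add: W_def powr_powr)
    define B where "B = A * L powr (1 - \<theta>)"
    have B: "0 < B" using A L by (simp add: B_def)
    have "W \<in> Apq p0 q0 \<and> Apq_const p0 q0 W \<le> ennreal B"
    proof (cases "p0 = 1")
      case True
      then have "\<theta> = 0" using rel(6) by (simp add: \<theta>_def)
      then have "W x powr q0 = H x" for x
        unfolding Wq using vpos[of x] Hpos[of x] by simp
      then have "A1_weight B (\<lambda>x. W x powr q0)"
        using H L \<open>\<theta> = 0\<close> by (simp add: B_def mult.commute)
      then show ?thesis
        using Apq_1_of_A1_weight[OF _ Wm Wpos, of q0 B] p0 True by simp
    next
      case False
      then have p01: "1 < p0" using p0 by simp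
      have "A powr \<theta> * (L * A) powr (1 - \<theta>) = B"
      proof -
        have "A powr \<theta> * (L * A) powr (1 - \<theta>) = L powr (1 - \<theta>) * (A powr \<theta> * A powr (1 - \<theta>))"
          by (simp add: powr_mult)
        also have "A powr \<theta> * A powr (1 - \<theta>) = A"
          using A by (simp flip: powr_add)
        finally show ?thesis by (simp add: B_def)
      qed
      then have "muckenhoupt r0 B (\<lambda>x. W x powr q0)"
        unfolding Wq using muckenhoupt_interpolate_A1[OF mu H rel(7)[OF p01] rr(2) \<theta>_def] by simp
      then show ?thesis
        using Apq_of_muckenhoupt[OF p01 p0(2) Wm Wpos] rel(5)[OF p01] by auto
    qed
    then have WA: "W \<in> Apq p0 q0" "Apq_const p0 q0 W \<le> ennreal B" by auto
    let ?G = "ennreal (2 powr r') * ?X"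
    have "(\<integral>\<^sup>+x. ennreal ((W x * cmod (f x)) powr p0) \<partial>lebesgue)
        \<le> ennpowr ?F (p0 / p) * ennpowr ?G (1 - p0 / p)"
    proof -
      have "(\<integral>\<^sup>+x. ennreal ((W x * cmod (f x)) powr p0) \<partial>lebesgue)
          = (\<integral>\<^sup>+x. ennpowr (ennreal ((v x * cmod (f x)) powr p)) (p0 / p)
              * ennpowr (ennpowr (ennreal (H x)) r' * ennreal (\<sigma> x)) (1 - p0 / p) \<partial>lebesgue)"
      proof (rule nn_integral_cong)
        fix x
        have nn: "0 \<le> H x powr r' * \<sigma> x"
          by (simp add: \<sigma>_def)
        have Hs: "ennpowr (ennreal (H x)) r' * ennreal (\<sigma> x) = ennreal (H x powr r' * \<sigma> x)"
          using Hpos[of x] by (simp add: ennpowr_ennreal less_imp_le ennreal_mult \<sigma>_def)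
        have "(W x * cmod (f x)) powr p0
            = ((v x * cmod (f x)) powr p) powr (p0 / p) * (H x powr r' * \<sigma> x) powr (1 - p0 / p)"
        proof (cases "f x = 0")
          case False
          define a b e where "a = ln (v x)" and "b = ln (cmod (f x))" and "e = ln (H x)"
          have vf: "v x = exp a" "cmod (f x) = exp b" "H x = exp e"
            using False vpos[of x] Hpos[of x] by (simp_all add: a_def b_def e_def)
          have "W x = exp (1 / q0 * (\<theta> * (q * a) + (1 - \<theta>) * e))"
            by (simp add: W_def vf powr_def flip: exp_add)
          then have "(W x * cmod (f x)) powr p0 = exp (p0 * (1 / q0 * (\<theta> * (q * a) + (1 - \<theta>) * e) + b))"
            unfolding vf by (simp only: exp_add[symmetric] powr_def exp_not_eq_zero if_False ln_exp)
          also have "\<dots> = exp (p0 / p * (p * (a + b)) + (1 - p0 / p) * (r' * e - 1 / (r - 1) * (q * a)))"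
            using p p0 q q0 rr unfolding r'_def
            by (subst larger_exponent_identity[OF _ _ _ _ _ rel(3) d \<theta>_def]) auto
          also have "\<dots> = exp (p0 / p * (p * (a + b))) * exp ((1 - p0 / p) * (r' * e - 1 / (r - 1) * (q * a)))"
            by (rule exp_add)
          also have "exp (p0 / p * (p * (a + b))) = ((v x * cmod (f x)) powr p) powr (p0 / p)"
            unfolding vf exp_add[symmetric] by (simp only: powr_def exp_not_eq_zero if_False ln_exp)
          also have "exp ((1 - p0 / p) * (r' * e - 1 / (r - 1) * (q * a))) = (H x powr r' * \<sigma> x) powr (1 - p0 / p)"
          proof -
            have "H x powr r' * \<sigma> x = exp (r' * e - 1 / (r - 1) * (q * a))"
              by (simp add: \<sigma>_def vf powr_def flip: exp_add)
            then show ?thesis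
              by (simp only: powr_def exp_not_eq_zero if_False ln_exp)
          qed
          finally show ?thesis .
        qed simp
        then show "ennreal ((W x * cmod (f x)) powr p0) = ennpowr (ennreal ((v x * cmod (f x)) powr p)) (p0 / p)
              * ennpowr (ennpowr (ennreal (H x)) r' * ennreal (\<sigma> x)) (1 - p0 / p)"
          by (simp only: Hs nn ennpowr_ennreal powr_ge_zero ennreal_mult[symmetric])
      qed
      also have "\<dots> \<le> ennpowr ?F (p0 / p) *
          ennpowr (\<integral>\<^sup>+x. ennpowr (ennreal (H x)) r' * ennreal (\<sigma> x) \<partial>lebesgue) (1 - p0 / p)"
        using p p0 pp by (intro nn_integral_Holder) auto
      also have "\<dots> \<le> ennpowr ?F (p0 / p) * ennpowr ?G (1 - p0 / p)"
        using p p0 pp by (intro mult_left_mono ennpowr_mono JH) auto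
      finally show ?thesis .
    qed
    then have "ennpowr (\<integral>\<^sup>+x. ennreal ((W x * cmod (f x)) powr p0) \<partial>lebesgue) (1 / p0)
        \<le> ennpowr (ennpowr ?F (p0 / p) * ennpowr ?G (1 - p0 / p)) (1 / p0)"
      using p0 by (intro ennpowr_mono) auto
    also have "\<dots> = ennpowr ?F (1 / p) * (ennreal ((2 powr r') powr \<delta>) * ennpowr ?X \<delta>)"
    proof -
      have e: "p0 / p * (1 / p0) = 1 / p" using p0 by simp
      show ?thesis
        unfolding ennpowr_mult ennpowr_ennpowr e \<delta>[symmetric] by (simp only: ennpowr_ennreal powr_ge_zero)
    qed
    finally have norm: "ennpowr (\<integral>\<^sup>+x. ennreal ((W x * cmod (f x)) powr p0) \<partial>lebesgue) (1 / p0)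
        \<le> ennpowr ?F (1 / p) * (ennreal ((2 powr r') powr \<delta>) * ennpowr ?X \<delta>)" .
    have "?X \<le> (\<integral>\<^sup>+x\<in>E. ennreal (W x powr q0) \<partial>lebesgue)"
    proof (rule nn_integral_mono_AE, rule AE_mp[OF hH], intro AE_I2 impI)
      fix x assume le: "h x \<le> ennreal (H x)"
      show "ennreal (v x powr q) * indicator E x \<le> ennreal (W x powr q0) * indicator E x"
      proof (cases "x \<in> E")
        case True
        then have "v x powr q \<le> H x"
          using le Hpos[of x] by (simp add: h_def ennreal_le_iff less_imp_le)
        then have "(v x powr q) powr \<theta> * (v x powr q) powr (1 - \<theta>) \<le> (v x powr q) powr \<theta> * H x powr (1 - \<theta>)"
          using \<theta> by (intro mult_left_mono powr_mono2) auto
        moreover have "(v x powr q) powr \<theta> * (v x powr q) powr (1 - \<theta>) = v x powr q"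
          unfolding powr_add[symmetric] using vpos[of x] by simp
        ultimately show ?thesis
          using True by (simp add: Wq ennreal_leI)
      qed simp
    qed
    then have "ennpowr ?X (1 / q0) \<le> ennpowr (\<integral>\<^sup>+x\<in>E. ennreal (W x powr q0) \<partial>lebesgue) (1 / q0)"
      using q0 by (intro ennpowr_mono) auto
    then have "ennreal t * ennpowr ?X (1 / q0) \<le> ennreal t * ennpowr (\<integral>\<^sup>+x\<in>E. ennreal (W x powr q0) \<partial>lebesgue) (1 / q0)"
      by (rule mult_left_mono) simp
    also have "\<dots> \<le> ennreal (c * B powr \<gamma>) * (ennpowr ?F (1 / p) * (ennreal ((2 powr r') powr \<delta>) * ennpowr ?X \<delta>))"
      by (rule order_trans[OF level_inequalityD[OF test Wpos WA B \<gamma> c] mult_left_mono[OF norm]]) simp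
    also have "\<dots> = (ennreal (c * B powr \<gamma>) * ennreal ((2 powr r') powr \<delta>)) * ennpowr ?F (1 / p) * ennpowr ?X \<delta>"
      by (simp only: mult_ac)
    also have "ennreal (c * B powr \<gamma>) * ennreal ((2 powr r') powr \<delta>) = ennreal (C * A powr \<gamma>)"
    proof -
      have "c * B powr \<gamma> * (2 powr r') powr \<delta> = C * A powr \<gamma>"
        by (simp add: C_def B_def powr_mult mult_ac)
      moreover have "ennreal (c * B powr \<gamma>) * ennreal ((2 powr r') powr \<delta>) = ennreal (c * B powr \<gamma> * (2 powr r') powr \<delta>)"
        using c by (intro ennreal_mult[symmetric]) auto
      ultimately show ?thesis by (simp only:)
    qed
    also have "ennpowr ?X (1 / q0) = ennpowr ?X (1 / q) * ennpowr ?X \<delta>"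
      unfolding ennpowr_add[symmetric] \<delta>_def by simp
    \<comment> \<open>the factor X^\<delta> with \<delta> = 1/q_0 - 1/q is finite and positive, and cancels\<close>
    finally have "ennpowr ?X \<delta> * (ennreal t * ennpowr ?X (1 / q))
        \<le> ennpowr ?X \<delta> * (ennreal (C * A powr \<gamma>) * ennpowr ?F (1 / p))"
      by (simp only: mult_ac)
    then show ?thesis
      using fin ne by (subst (asm) ennreal_mult_le_mult_iff) simp_all
  qed
  have "ennreal t * ennpowr (\<integral>\<^sup>+x\<in>E. ennreal (v x powr q) \<partial>lebesgue) (1 / q)
      \<le> ennreal (C * A powr \<gamma>)
        * ennpowr (\<integral>\<^sup>+x. ennreal ((v x * cmod (f x)) powr p) \<partial>lebesgue) (1 / p)"
    if vm [measurable]: "v \<in> borel_measurable lebesgue" and vpos: "\<And>x. 0 < v x"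
      and mu: "muckenhoupt r A (\<lambda>x. v x powr q)"
      and fm [measurable]: "f \<in> borel_measurable lebesgue" and Em [measurable]: "E \<in> sets lebesgue"
      and t: "0 < t" and test: "level_inequality p0 q0 \<gamma> c f E t"
    for v :: "real ^ 'n \<Rightarrow> real" and A and f :: "real ^ 'n \<Rightarrow> complex" and E t
  proof -
    let ?R = "ennreal (C * A powr \<gamma>) * ennpowr (\<integral>\<^sup>+x. ennreal ((v x * cmod (f x)) powr p) \<partial>lebesgue) (1 / p)"
    \<comment> \<open>balls are contained in cubes, over which v^q is integrable\<close>
    define EN where "EN N = E \<inter> cball 0 (real N)" for N :: nat
    have ENm [measurable]: "EN N \<in> sets lebesgue" for N
      unfolding EN_def by (intro sets.Int Em) simp
    let ?X = "\<lambda>E. \<integral>\<^sup>+x\<in>E. ennreal (v x powr q) \<partial>lebesgue"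
    have bound: "?X (EN N) \<le> ennpowr (?R / ennreal t) q" for N
    proof -
      have "ennreal t * ennpowr (?X (EN N)) (1 / q) \<le> ?R"
      proof (cases "?X (EN N) = 0")
        case False
        have "bounded (cball (0 :: real ^ 'n) (real N))" by (rule bounded_cball)
        then obtain Q :: "(real ^ 'n) set" where Q: "Q \<in> cubes" "cball 0 (real N) \<subseteq> Q"
          by (rule bounded_subset_cube)
        have "?X (EN N) \<le> ?X Q"
          using Q(2) by (intro nn_integral_mono) (auto simp: EN_def split: split_indicator)
        moreover have "?X Q \<noteq> top"
          using muckenhoupt_average_finite[OF mu Q(1)] emeasure_cube_pos_finite[OF Q(1)]
          by (auto simp: average_def ennreal_top_divide)
        ultimately have "?X (EN N) \<noteq> top"
          by (auto simp: top_unique)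
        then show ?thesis
          using False q0 by (intro finite_case[OF vm vpos mu fm ENm t] level_inequality_mono[OF test])
            (auto simp: EN_def)
      qed simp
      then have "ennpowr (?X (EN N)) (1 / q) * ennreal t / ennreal t \<le> ?R / ennreal t"
        by (intro divide_right_mono_ennreal) (simp only: mult.commute)
      then have "ennpowr (?X (EN N)) (1 / q) \<le> ?R / ennreal t"
        using t by (subst (asm) ennreal_mult_divide_eq) auto
      then show ?thesis
        using q by (subst (asm) ennpowr_le_iff_le) auto
    qed
    have "?X E = (SUP N. ?X (EN N))"
    proof -
      have "(SUP N. ennreal (v x powr q) * indicator (EN N) x) = ennreal (v x powr q) * indicator E x" for x
      proof (cases "x \<in> E")
        case True
        obtain N where "norm x \<le> real N" using real_arch_simple by blast
        then have "x \<in> EN N" using True by (simp add: EN_def)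
        then show ?thesis
          using True by (intro antisym SUP_least SUP_upper2[of N]) (auto split: split_indicator)
      qed (simp add: EN_def)
      then have "?X E = (\<integral>\<^sup>+x. (SUP N. ennreal (v x powr q) * indicator (EN N) x) \<partial>lebesgue)"
        by simp
      also have "\<dots> = (SUP N. ?X (EN N))"
      proof (rule nn_integral_monotone_convergence_SUP)
        show "incseq (\<lambda>N x. ennreal (v x powr q) * indicator (EN N) x)"
          by (intro incseq_SucI le_funI) (auto simp: EN_def split: split_indicator)
      qed measurable
      finally show ?thesis .
    qed
    then have "?X E \<le> ennpowr (?R / ennreal t) q"
      using bound by (simp only: SUP_least)
    then have "ennpowr (?X E) (1 / q) \<le> ?R / ennreal t"
      using q by (subst ennpowr_le_iff_le) auto
    then have "ennreal t * ennpowr (?X E) (1 / q) \<le> ennreal t * (?R / ennreal t)"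
      by (rule mult_left_mono) simp
    also have "\<dots> = ?R"
      using ennreal_mult_divide_cancel_real[OF t, of ?R 1] by (simp only: mult_1_right)
    finally show ?thesis .
  qed
  then show ?thesis
    using C by (intro exI[of _ C] conjI allI impI) auto
qed

section \<open>Weak-type extrapolation\<close>

lemma muckenhoupt_of_Apq_const_finite:
  fixes v :: "real ^ 'n \<Rightarrow> real"
  assumes p: "1 < p" and q: "0 < q" and vm [measurable]: "v \<in> borel_measurable lebesgue" and pos: "\<And>x. 0 < v x"
    and fin: "Apq_const p q v \<noteq> top"
  shows "muckenhoupt (1 + q / conj_exponent p) (enn2real (Apq_const p q v)) (\<lambda>x. v x powr q)"
proof -
  define r where "r = 1 + q / conj_exponent p"
  let ?P = "\<lambda>Q. average Q (\<lambda>x. ennreal (v x powr q)) *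
    ennpowr (average Q (\<lambda>x. ennreal ((v x powr q) powr (- 1 / (r - 1))))) (r - 1)"
  have const: "Apq_const p q v = (SUP Q\<in>cubes. ?P Q)"
    unfolding r_def by (rule Apq_const_eq_SUP[OF p pos q])
  have A: "ennreal (enn2real (Apq_const p q v)) = Apq_const p q v"
    using fin by (simp add: less_top)
  have le: "?P Q \<le> ennreal (enn2real (Apq_const p q v))" if "Q \<in> cubes" for Q
  proof -
    have "?P Q \<le> Apq_const p q v"
      unfolding const using that by (rule SUP_upper)
    then show ?thesis by (simp only: A)
  qed
  obtain Q :: "(real ^ 'n) set" where Q: "Q \<in> cubes"
    using bounded_subset_cube[OF bounded_empty] by blast
  have "average Q (\<lambda>x. ennreal (v x powr q)) \<noteq> 0"
    "average Q (\<lambda>x. ennreal ((v x powr q) powr (- 1 / (r - 1)))) \<noteq> 0"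
    using pos by (intro average_ne_0 Q; simp add: less_le)+
  then have "?P Q \<noteq> 0"
    by (simp only: mult_eq_0_iff ennpowr_eq_0_iff simp_thms)
  then have "0 < enn2real (Apq_const p q v)"
    using le[OF Q] by (cases "enn2real (Apq_const p q v) = 0") (auto simp: less_le)
  then show ?thesis
    unfolding muckenhoupt_def r_def[symmetric] using le pos by (auto simp: less_le)
qed

text \<open>If w vanishes on a set of positive measure and is positive on another, a cube that contains enough
of both sets makes the negative power have infinite average against a nonzero average of w^q. So
apart from the zero weight every weight of A_(p,q) is positive almost everywhere.\<close>

lemma Apq_AE_zero_or_positive:
  fixes w :: "real ^ 'n \<Rightarrow> real"
  assumes w: "w \<in> Apq p q" and p: "1 < p" and q: "0 < q"
  shows "(AE x in lebesgue. w x = 0) \<or> (AE x in lebesgue. 0 < w x)"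
proof (rule disjCI)
  have wm [measurable]: "w \<in> borel_measurable lebesgue" and w0: "\<And>x. 0 \<le> w x"
    and fin: "Apq_const p q w < \<infinity>"
    using w by (auto simp: Apq_def weight_def)
  assume not_pos: "\<not> (AE x in lebesgue. 0 < w x)"
  show "AE x in lebesgue. w x = 0"
  proof (rule ccontr)
    assume not_zero: "\<not> (AE x in lebesgue. w x = 0)"
    obtain Q1 :: "(real ^ 'n) set" where Q1: "Q1 \<in> cubes" "\<not> (AE x in lebesgue. x \<in> Q1 \<longrightarrow> w x = 0)"
      using AE_of_AE_on_cubes[of 0 "\<lambda>x. w x = 0"] not_zero by blast
    obtain Q2 :: "(real ^ 'n) set" where Q2: "Q2 \<in> cubes" "\<not> (AE x in lebesgue. x \<in> Q2 \<longrightarrow> 0 < w x)"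
      using AE_of_AE_on_cubes[of 0 "\<lambda>x. 0 < w x"] not_pos by blast
    have "bounded (Q1 \<union> Q2)"
      using Q1(1) Q2(1) by (auto simp: cubes_def)
    then obtain Q where Q: "Q \<in> cubes" "Q1 \<union> Q2 \<subseteq> Q"
      by (rule bounded_subset_cube)
    note cubes_sets[OF Q(1), measurable]
    let ?u = "average Q (\<lambda>x. ennreal (w x powr q))"
      and ?s = "average Q (\<lambda>x. inverse (ennreal (w x powr conj_exponent p)))"
    have "?u * ennpowr ?s (q / conj_exponent p) \<le> Apq_const p q w"
      using p Q(1) unfolding Apq_const_def by (auto intro!: SUP_upper2[of Q])
    then have "?u * ennpowr ?s (q / conj_exponent p) < top"
      using fin by (simp add: order.strict_trans1)
    moreover have "?u \<noteq> 0"
    proof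
      assume "?u = 0"
      then have "AE x in lebesgue. x \<in> Q \<longrightarrow> ennreal (w x powr q) = 0"
        by (intro average_eq_0D Q) auto
      then have "AE x in lebesgue. x \<in> Q1 \<longrightarrow> w x = 0"
      proof (rule AE_mp, intro AE_I2 impI)
        fix x assume "x \<in> Q \<longrightarrow> ennreal (w x powr q) = 0" "x \<in> Q1"
        then have "w x powr q = 0"
          using Q(2) by (auto simp: ennreal_eq_0_iff intro!: antisym)
        then show "w x = 0" by simp
      qed
      then show False using Q1(2) by blast
    qed
    ultimately have "?s \<noteq> top"
      by (auto simp: ennreal_mult_less_top)
    then have "(\<integral>\<^sup>+x\<in>Q. inverse (ennreal (w x powr conj_exponent p)) \<partial>lebesgue) \<noteq> \<infinity>"
      using emeasure_cube_pos_finite[OF Q(1)] by (auto simp: average_def ennreal_top_divide)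
    then have "AE x in lebesgue. inverse (ennreal (w x powr conj_exponent p)) * indicator Q x \<noteq> \<infinity>"
      by (intro nn_integral_PInf_AE) auto
    then have "AE x in lebesgue. x \<in> Q2 \<longrightarrow> 0 < w x"
    proof (rule AE_mp, intro AE_I2 impI)
      fix x assume "inverse (ennreal (w x powr conj_exponent p)) * indicator Q x \<noteq> \<infinity>" "x \<in> Q2"
      then have "w x powr conj_exponent p \<noteq> 0"
        using Q(2) by auto
      then show "0 < w x" using w0[of x] by (simp add: less_le)
    qed
    then show False using Q2(2) by blast
  qed
qed

lemma level_inequality_of_weak_type:
  fixes f g :: "real ^ 'n \<Rightarrow> complex"
  assumes "\<And>w. w \<in> Apq p q \<Longrightarrow> weak_Lq_norm q (\<lambda>x. w x powr q) g
    \<le> ennreal c * ennpowr (Apq_const p q w) \<gamma> * Lp_norm p (\<lambda>x. complex_of_real (w x) * f x)"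
    and "0 < t"
  shows "level_inequality p q \<gamma> c f {x. t < cmod (g x)} t"
  unfolding level_inequality_def
proof (intro allI impI)
  fix W :: "real ^ 'n \<Rightarrow> real" assume W: "W \<in> Apq p q"
  have "ennreal t * ennpowr (weighted_meas (\<lambda>x. W x powr q) {x. t < cmod (g x)}) (1 / q)
      \<le> weak_Lq_norm q (\<lambda>x. W x powr q) g"
    unfolding weak_Lq_norm_def using assms(2) by (intro SUP_upper2[of t]) auto
  also have "\<dots> \<le> ennreal c * ennpowr (Apq_const p q W) \<gamma> * Lp_norm p (\<lambda>x. complex_of_real (W x) * f x)"
    by (rule assms(1)[OF W])
  finally show "ennreal t * ennpowr (weighted_meas (\<lambda>x. W x powr q) {x. t < cmod (g x)}) (1 / q)
      \<le> ennreal c * ennpowr (Apq_const p q W) \<gamma> * Lp_norm p (\<lambda>x. complex_of_real (W x) * f x)" .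
qed

text \<open>Passage from a bound at each height, for weights positive everywhere, to the weak-type norm: the zero
weight makes the left-hand side vanish, and any other weight can be changed on a null set without
affecting the constants and norms.\<close>

lemma weak_bound_from_positive_weights:
  fixes w :: "real ^ 'n \<Rightarrow> real" and f g :: "real ^ 'n \<Rightarrow> complex"
  assumes p: "1 < p" and q: "0 < q" and C: "0 < C"
    and step: "\<And>v A E t. v \<in> borel_measurable lebesgue \<Longrightarrow> (\<And>x. 0 < v x) \<Longrightarrow>
      muckenhoupt (1 + q / conj_exponent p) A (\<lambda>x. v x powr q) \<Longrightarrow> E \<in> sets lebesgue \<Longrightarrow> 0 < t \<Longrightarrow>
      level_inequality p0 q0 \<gamma> c f E t \<Longrightarrow>
      ennreal t * ennpowr (\<integral>\<^sup>+x\<in>E. ennreal (v x powr q) \<partial>lebesgue) (1 / q)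
        \<le> ennreal (C * A powr \<beta>)
          * ennpowr (\<integral>\<^sup>+x. ennreal ((v x * cmod (f x)) powr p) \<partial>lebesgue) (1 / p)"
    and test: "\<And>t. 0 < t \<Longrightarrow> level_inequality p0 q0 \<gamma> c f {x. t < cmod (g x)} t"
    and gm [measurable]: "g \<in> borel_measurable lebesgue"
    and w: "w \<in> Apq p q"
  shows "weak_Lq_norm q (\<lambda>x. w x powr q) g
    \<le> ennreal C * ennpowr (Apq_const p q w) \<beta> * Lp_norm p (\<lambda>x. complex_of_real (w x) * f x)"
  unfolding weak_Lq_norm_def
proof (rule SUP_least)
  fix t :: real assume "t \<in> {0<..}"
  then have t: "0 < t" by simp
  let ?E = "{x. t < cmod (g x)}"
  have Em: "?E \<in> sets lebesgue"
  proof -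
    have "{x \<in> space lebesgue. t < cmod (g x)} \<in> sets lebesgue" by measurable
    then show ?thesis by simp
  qed
  have wm [measurable]: "w \<in> borel_measurable lebesgue" and w0: "\<And>x. 0 \<le> w x"
    and fin: "Apq_const p q w < \<infinity>"
    using w by (auto simp: Apq_def weight_def)
  consider "AE x in lebesgue. w x = 0" | "AE x in lebesgue. 0 < w x"
    using Apq_AE_zero_or_positive[OF w p q] by blast
  then show "ennreal t * ennpowr (weighted_meas (\<lambda>x. w x powr q) ?E) (1 / q)
    \<le> ennreal C * ennpowr (Apq_const p q w) \<beta> * Lp_norm p (\<lambda>x. complex_of_real (w x) * f x)"
  proof cases
    case 1
    have "weighted_meas (\<lambda>x. w x powr q) ?E = (\<integral>\<^sup>+x. 0 \<partial>(lebesgue :: (real ^ 'n) measure))"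
      unfolding weighted_meas_def
      by (rule nn_integral_cong_AE, rule AE_mp[OF 1], intro AE_I2 impI) simp
    then show ?thesis by simp
  next
    case 2
    \<comment> \<open>the value 1 is arbitrary: it is used on a null set only\<close>
    define v where "v x = (if w x = 0 then 1 else w x)" for x
    have vm [measurable]: "v \<in> borel_measurable lebesgue"
      unfolding v_def[abs_def] by measurable
    have vpos: "0 < v x" for x
      using w0[of x] by (simp add: v_def less_le)
    have vw: "AE x in lebesgue. w x = v x"
      using 2 by (rule AE_mp) (intro AE_I2 impI, simp add: v_def)
    have const: "Apq_const p q w = Apq_const p q v"
    proof -
      have "average Q (\<lambda>x. ennreal (w x powr q)) = average Q (\<lambda>x. ennreal (v x powr q))"
        "average Q (\<lambda>x. inverse (ennreal (w x powr conj_exponent p)))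
          = average Q (\<lambda>x. inverse (ennreal (v x powr conj_exponent p)))" for Q
        by (rule average_cong_AE, rule AE_mp[OF vw], intro AE_I2 impI, simp)+
      then show ?thesis by (simp only: Apq_const_def)  (use p in simp)
    qed
    define A where "A = enn2real (Apq_const p q v)"
    have A: "ennreal A = Apq_const p q w" "0 \<le> A"
      using fin unfolding A_def const by (simp_all add: less_top)
    have mu: "muckenhoupt (1 + q / conj_exponent p) A (\<lambda>x. v x powr q)"
      unfolding A_def using fin const by (intro muckenhoupt_of_Apq_const_finite p q vm vpos) auto
    have "weighted_meas (\<lambda>x. w x powr q) ?E = (\<integral>\<^sup>+x\<in>?E. ennreal (v x powr q) \<partial>lebesgue)"
      unfolding weighted_meas_def
      by (rule nn_integral_cong_AE, rule AE_mp[OF vw], intro AE_I2 impI) simp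
    moreover have "Lp_norm p (\<lambda>x. complex_of_real (w x) * f x)
        = ennpowr (\<integral>\<^sup>+x. ennreal ((v x * cmod (f x)) powr p) \<partial>lebesgue) (1 / p)"
    proof -
      have "(\<integral>\<^sup>+x. ennreal ((w x * cmod (f x)) powr p) \<partial>lebesgue)
          = (\<integral>\<^sup>+x. ennreal ((v x * cmod (f x)) powr p) \<partial>lebesgue)"
        by (rule nn_integral_cong_AE, rule AE_mp[OF vw], intro AE_I2 impI) simp
      then show ?thesis by (simp only: Lp_norm_weighted[OF w0])
    qed
    moreover have "ennreal (C * A powr \<beta>) = ennreal C * ennpowr (Apq_const p q w) \<beta>"
      unfolding A(1)[symmetric] using A(2) C by (simp add: ennpowr_ennreal ennreal_mult)
    ultimately show ?thesis
      using step[OF vm vpos mu Em t test[OF t]] by (simp only:)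
  qed
qed

theorem corollary2p2:
  fixes T :: "(real ^ 'n \<Rightarrow> complex) \<Rightarrow> (real ^ 'n \<Rightarrow> complex)"
    and \<D> :: "(real ^ 'n \<Rightarrow> complex) set"
    and p\<^sub>0 q\<^sub>0 \<gamma> c :: real
  assumes meas_dom: "\<And>f. f \<in> \<D> \<Longrightarrow> f \<in> borel_measurable lebesgue"
    and meas_T: "\<And>f. f \<in> \<D> \<Longrightarrow> T f \<in> borel_measurable lebesgue"
    and exponents: "1 \<le> p\<^sub>0" "p\<^sub>0 \<le> q\<^sub>0"
    and constants: "\<gamma> > 0" "c > 0"
    and weak_type: "\<And>w f. w \<in> Apq p\<^sub>0 q\<^sub>0 \<Longrightarrow> f \<in> \<D> \<Longrightarrow>
      weak_Lq_norm q\<^sub>0 (\<lambda>x. w x powr q\<^sub>0) (T f)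
        \<le> ennreal c * ennpowr (Apq_const p\<^sub>0 q\<^sub>0 w) \<gamma>
            * Lp_norm p\<^sub>0 (\<lambda>x. complex_of_real (w x) * f x)"
  shows "\<forall>p q. 1 < p \<and> p \<le> q \<and> 1 / p - 1 / q = 1 / p\<^sub>0 - 1 / q\<^sub>0 \<longrightarrow>
    (\<exists>C>0. \<forall>w\<in>Apq p q. \<forall>f\<in>\<D>.
      weak_Lq_norm q (\<lambda>x. w x powr q) (T f)
        \<le> ennreal C
            * ennpowr (Apq_const p q w)
                (\<gamma> * max 1 ((if p\<^sub>0 = 1 then 0 else q\<^sub>0 / conj_exponent p\<^sub>0)
                            * (conj_exponent p / q)))
            * Lp_norm p (\<lambda>x. complex_of_real (w x) * f x))"
proof (intro allI impI, elim conjE)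
  fix p q :: real
  assume p: "1 < p" "p \<le> q" and d: "1 / p - 1 / q = 1 / p\<^sub>0 - 1 / q\<^sub>0"
  define r r\<^sub>0 where "r = 1 + q - q / p" and "r\<^sub>0 = 1 + q\<^sub>0 - q\<^sub>0 / p\<^sub>0"
  note rel = exponent_relations[OF p exponents d, folded r_def r\<^sub>0_def]
  have q: "0 < q" and q\<^sub>0: "0 < q\<^sub>0" using p exponents by auto
  define \<rho> where "\<rho> = (if p\<^sub>0 = 1 then 0 else q\<^sub>0 / conj_exponent p\<^sub>0) * (conj_exponent p / q)"
  have \<rho>: "\<rho> = (r\<^sub>0 - 1) / (r - 1)"
  proof -
    have "(if p\<^sub>0 = 1 then 0 else q\<^sub>0 / conj_exponent p\<^sub>0) = r\<^sub>0 - 1"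
      using rel(5,6) exponents by auto
    moreover have "conj_exponent p / q = 1 / (r - 1)"
      using rel(4) by (simp flip: rel(4))
    ultimately show ?thesis by (simp add: \<rho>_def)
  qed
  have ratio: "(r\<^sub>0 \<le> r \<longleftrightarrow> q\<^sub>0 \<le> q) \<and> (r \<le> r\<^sub>0 \<longleftrightarrow> q \<le> q\<^sub>0)"
  proof -
    have "r\<^sub>0 \<le> r \<longleftrightarrow> r\<^sub>0 * q \<le> r * q" "r \<le> r\<^sub>0 \<longleftrightarrow> r * q \<le> r\<^sub>0 * q"
      using q by simp_all
    then show ?thesis
      unfolding rel(3) using rel(1) by simp
  qed
  have bound: "\<exists>C>0. \<forall>w\<in>Apq p q. \<forall>f\<in>\<D>. weak_Lq_norm q (\<lambda>x. w x powr q) (T f)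
      \<le> ennreal C * ennpowr (Apq_const p q w) \<beta> * Lp_norm p (\<lambda>x. complex_of_real (w x) * f x)"
    if "\<exists>C>0. \<forall>(v :: real ^ 'n \<Rightarrow> real) A f E t.
      v \<in> borel_measurable lebesgue \<longrightarrow> (\<forall>x. 0 < v x) \<longrightarrow> muckenhoupt r A (\<lambda>x. v x powr q) \<longrightarrow>
      f \<in> borel_measurable lebesgue \<longrightarrow> E \<in> sets lebesgue \<longrightarrow> 0 < t \<longrightarrow> level_inequality p\<^sub>0 q\<^sub>0 \<gamma> c f E t \<longrightarrow>
      ennreal t * ennpowr (\<integral>\<^sup>+x\<in>E. ennreal (v x powr q) \<partial>lebesgue) (1 / q)
        \<le> ennreal (C * A powr \<beta>)
          * ennpowr (\<integral>\<^sup>+x. ennreal ((v x * cmod (f x)) powr p) \<partial>lebesgue) (1 / p)" for \<beta>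
  proof -
    from that obtain C where C: "0 < C" and step: "\<forall>(v :: real ^ 'n \<Rightarrow> real) A f E t.
      v \<in> borel_measurable lebesgue \<longrightarrow> (\<forall>x. 0 < v x) \<longrightarrow> muckenhoupt r A (\<lambda>x. v x powr q) \<longrightarrow>
      f \<in> borel_measurable lebesgue \<longrightarrow> E \<in> sets lebesgue \<longrightarrow> 0 < t \<longrightarrow> level_inequality p\<^sub>0 q\<^sub>0 \<gamma> c f E t \<longrightarrow>
      ennreal t * ennpowr (\<integral>\<^sup>+x\<in>E. ennreal (v x powr q) \<partial>lebesgue) (1 / q)
        \<le> ennreal (C * A powr \<beta>)
          * ennpowr (\<integral>\<^sup>+x. ennreal ((v x * cmod (f x)) powr p) \<partial>lebesgue) (1 / p)"
      by (elim exE conjE) (rule that)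
    have "weak_Lq_norm q (\<lambda>x. w x powr q) (T f)
      \<le> ennreal C * ennpowr (Apq_const p q w) \<beta> * Lp_norm p (\<lambda>x. complex_of_real (w x) * f x)"
      if w: "w \<in> Apq p q" and f: "f \<in> \<D>" for w f
    proof (rule weak_bound_from_positive_weights[OF p(1) q C _ _ meas_T[OF f] w])
      show "level_inequality p\<^sub>0 q\<^sub>0 \<gamma> c f {x. t < cmod (T f x)} t" if "0 < t" for t
        using weak_type[OF _ f] that by (rule level_inequality_of_weak_type)
      show "ennreal t * ennpowr (\<integral>\<^sup>+x\<in>E. ennreal (v x powr q) \<partial>lebesgue) (1 / q)
        \<le> ennreal (C * A powr \<beta>)
          * ennpowr (\<integral>\<^sup>+x. ennreal ((v x * cmod (f x)) powr p) \<partial>lebesgue) (1 / p)"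
        if "v \<in> borel_measurable lebesgue" "\<And>x. 0 < v x"
          "muckenhoupt (1 + q / conj_exponent p) A (\<lambda>x. v x powr q)" "E \<in> sets lebesgue" "0 < t"
          "level_inequality p\<^sub>0 q\<^sub>0 \<gamma> c f E t" for v A E t
        using that unfolding rel(4) by (intro step[rule_format] meas_dom f)
    qed
    then show ?thesis
      using C by (intro exI[of _ C]) simp
  qed
  consider "q < q\<^sub>0" | "q\<^sub>0 < q" | "q = q\<^sub>0" by linarith
  then show "\<exists>C>0. \<forall>w\<in>Apq p q. \<forall>f\<in>\<D>.
      weak_Lq_norm q (\<lambda>x. w x powr q) (T f)
        \<le> ennreal C
            * ennpowr (Apq_const p q w)
                (\<gamma> * max 1 ((if p\<^sub>0 = 1 then 0 else q\<^sub>0 / conj_exponent p\<^sub>0)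
                            * (conj_exponent p / q)))
            * Lp_norm p (\<lambda>x. complex_of_real (w x) * f x)"
    unfolding \<rho>_def[symmetric]
  proof cases
    case 1
    then have "1 \<le> \<rho>"
      using ratio rel(1) unfolding \<rho> by simp
    then have "max 1 \<rho> = (r\<^sub>0 - 1) / (r - 1)"
      unfolding \<rho>[symmetric] by simp
    then show "\<exists>C>0. \<forall>w\<in>Apq p q. \<forall>f\<in>\<D>. weak_Lq_norm q (\<lambda>x. w x powr q) (T f)
        \<le> ennreal C * ennpowr (Apq_const p q w) (\<gamma> * max 1 \<rho>) * Lp_norm p (\<lambda>x. complex_of_real (w x) * f x)"
      using bound[OF extrapolation_smaller_exponent[OF p exponents d 1 constants, folded r_def r\<^sub>0_def]] by (simp only:)
  next
    case 2
    then have "\<rho> \<le> 1"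
      using ratio rel(1) unfolding \<rho> by simp
    then have "\<gamma> * max 1 \<rho> = \<gamma>" by simp
    then show "\<exists>C>0. \<forall>w\<in>Apq p q. \<forall>f\<in>\<D>. weak_Lq_norm q (\<lambda>x. w x powr q) (T f)
        \<le> ennreal C * ennpowr (Apq_const p q w) (\<gamma> * max 1 \<rho>) * Lp_norm p (\<lambda>x. complex_of_real (w x) * f x)"
      using bound[OF extrapolation_larger_exponent[OF p exponents d 2 constants, folded r_def]] by (simp only:)
  next
    case 3
    then have "r\<^sub>0 = r" using ratio by auto
    then have "\<gamma> * max 1 \<rho> = \<gamma>"
      using rel(1) unfolding \<rho> by simp
    moreover have "p = p\<^sub>0" using d 3 p exponents by simp
    ultimately show "\<exists>C>0. \<forall>w\<in>Apq p q. \<forall>f\<in>\<D>. weak_Lq_norm q (\<lambda>x. w x powr q) (T f)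
        \<le> ennreal C * ennpowr (Apq_const p q w) (\<gamma> * max 1 \<rho>) * Lp_norm p (\<lambda>x. complex_of_real (w x) * f x)"
      using weak_type 3 constants by (intro exI[of _ c]) simp
  qed
qed

end
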